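(* Let $\sigma\in L^\infty(\mathbb{R}_+)$, let $h(t)=\int_0^\infty e^{-t\lambda}\sigma(\lambda)\,d\lambda$ for $t>0$, and let $H$ be the Hankel operator $(Hu)(t)=\int_0^\infty h(t+s)u(s)\,ds$ in $L^2(\mathbb{R}_+)$. Put $s(\xi)=\sigma(e^{-\xi})$ for $\xi\in\mathbb{R}$ (so that the operator $s(D)$ is bounded in $L^2(\mathbb{R})$) and $v(x)=\sqrt{\pi}/\sqrt{\cosh(\pi x)}$. Then $$H=\mathbf{M}^{-1}\,v(X)\,s(D)\,v(X)\,\mathbf{M}.$$
   Context: $\mathbb{R}_+=(0,\infty)$. $v(X)$ is the operator of multiplication by $v(x)$ in $L^2(\mathbb{R})$. With the Fourier transform $(\Phi f)(\xi)=(2\pi)^{-1/2}\int_{-\infty}^\infty e^{-ix\xi}f(x)\,dx$, the operator $s(D)$ (where $D=-i\,d/dx$) is $\Phi^{-1}s\,\Phi$, with $s$ acting as multiplication by $s(\xi)$. The Mellin transform $M:L^2(\mathbb{R}_+)\to L^2(\mathbb{R})$ is the unitary operator $(Mu)(x)=(2\pi)^{-1/2}\int_0^\infty u(t)\,t^{-1/2-ix}\,dt$, and $\mathbf{M}:L^2(\mathbb{R}_+)\to L^2(\mathbb{R})$ is the unitary operator $$(\mathbf{M}f)(x)=\frac{\Gamma(1/2-ix)}{|\Gamma(1/2-ix)|}\,(Mf)(-x),$$ where $\Gamma$ is the gamma function. *)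

theory Defs
  imports "HOL-Analysis.Analysis"
begin

(* Elements of L^2 and L^infinity are represented by measurable functions; operators
   act on representatives, and equality of operators is equality almost everywhere. *)

definition L2 :: "'a measure \<Rightarrow> ('a \<Rightarrow> complex) set" where
  "L2 M = {f. f \<in> borel_measurable M \<and> integrable M (\<lambda>x. (norm (f x))\<^sup>2)}"

definition L2_norm :: "'a measure \<Rightarrow> ('a \<Rightarrow> complex) \<Rightarrow> real" where
  "L2_norm M f = sqrt (LINT x|M. (norm (f x))\<^sup>2)"

definition Linf :: "'a measure \<Rightarrow> ('a \<Rightarrow> complex) set" where
  "Linf M = {f. f \<in> borel_measurable M \<and> (\<exists>C::real. AE x in M. norm (f x) \<le> C)}"

definition L2_op_eq ::
  "'a measure \<Rightarrow> 'b measure \<Rightarrow> (('a \<Rightarrow> complex) \<Rightarrow> 'b \<Rightarrow> complex)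
    \<Rightarrow> (('a \<Rightarrow> complex) \<Rightarrow> 'b \<Rightarrow> complex) \<Rightarrow> bool" where
  "L2_op_eq M N A B \<longleftrightarrow>
    (\<forall>f\<in>L2 M. A f \<in> L2 N \<and> B f \<in> L2 N \<and> (AE x in N. A f x = B f x))"

definition L2_bounded_operator ::
  "'a measure \<Rightarrow> 'b measure \<Rightarrow> (('a \<Rightarrow> complex) \<Rightarrow> 'b \<Rightarrow> complex) \<Rightarrow> bool" where
  "L2_bounded_operator M N T \<longleftrightarrow>
    (\<forall>f\<in>L2 M. T f \<in> L2 N) \<and>
    (\<forall>f\<in>L2 M. \<forall>g\<in>L2 M. AE x in N. T (\<lambda>y. f y + g y) x = T f x + T g x) \<and>
    (\<forall>c. \<forall>f\<in>L2 M. AE x in N. T (\<lambda>y. c * f y) x = c * T f x) \<and>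
    (\<exists>C. \<forall>f\<in>L2 M. L2_norm N (T f) \<le> C * L2_norm M f)"

(* Limit in mean, determined up to a null set. The distance is an extended nonnegative
   integral, so that a non-square-integrable difference has distance infinity, not 0. *)
definition L2_lim :: "'a measure \<Rightarrow> (nat \<Rightarrow> 'a \<Rightarrow> complex) \<Rightarrow> 'a \<Rightarrow> complex" where
  "L2_lim M F = (SOME g. g \<in> L2 M \<and>
     (\<lambda>n. \<integral>\<^sup>+x. ennreal ((norm (F n x - g x))\<^sup>2) \<partial>M) \<longlonglongrightarrow> 0)"

(* Inverse of an operator T from L^2(M) onto L^2(N), determined up to a null set if T is
   injective modulo null sets. *)
definition L2_inv ::
  "'a measure \<Rightarrow> 'b measure \<Rightarrow> (('a \<Rightarrow> complex) \<Rightarrow> 'b \<Rightarrow> complex)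
    \<Rightarrow> ('b \<Rightarrow> complex) \<Rightarrow> 'a \<Rightarrow> complex" where
  "L2_inv M N T g = (SOME f. f \<in> L2 M \<and> (AE x in N. T f x = g x))"

abbreviation lebesgue_pos :: "real measure" where
  "lebesgue_pos \<equiv> lebesgue_on {0<..}"

(* For general square-integrable functions the integrals defining the Fourier and Mellin
   transforms do not converge absolutely; as usual they are read as limits in mean of
   the integrals over an exhausting sequence of compact intervals. *)

definition fourier :: "(real \<Rightarrow> complex) \<Rightarrow> real \<Rightarrow> complex" where
  "fourier f = L2_lim lebesgue (\<lambda>n \<xi>.
     of_real (1 / sqrt (2 * pi)) *
     (LINT x:{- real n..real n}|lebesgue. exp (- (\<i> * of_real x * of_real \<xi>)) * f x))"

definition mellin :: "(real \<Rightarrow> complex) \<Rightarrow> real \<Rightarrow> complex" where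
  "mellin u = L2_lim lebesgue (\<lambda>n x.
     of_real (1 / sqrt (2 * pi)) *
     (LINT t:{1 / real (Suc n)..real (Suc n)}|lebesgue.
        u t * of_real t powr (- 1 / 2 - \<i> * of_real x)))"

(* The modified ("bold") Mellin transform. *)
definition bmellin :: "(real \<Rightarrow> complex) \<Rightarrow> real \<Rightarrow> complex" where
  "bmellin f x =
     Gamma (1 / 2 - \<i> * of_real x) / of_real (norm (Gamma (1 / 2 - \<i> * of_real x :: complex)))
     * mellin f (- x)"

definition bmellin_inv :: "(real \<Rightarrow> complex) \<Rightarrow> real \<Rightarrow> complex" where
  "bmellin_inv = L2_inv lebesgue_pos lebesgue bmellin"

definition mult_op :: "(real \<Rightarrow> complex) \<Rightarrow> (real \<Rightarrow> complex) \<Rightarrow> real \<Rightarrow> complex" where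
  "mult_op a f x = a x * f x"

(* The operator a(D) with D = -i d/dx. *)
definition fourier_mult :: "(real \<Rightarrow> complex) \<Rightarrow> (real \<Rightarrow> complex) \<Rightarrow> real \<Rightarrow> complex" where
  "fourier_mult a f = L2_inv lebesgue lebesgue fourier (mult_op a (fourier f))"

definition hankel :: "(real \<Rightarrow> complex) \<Rightarrow> (real \<Rightarrow> complex) \<Rightarrow> real \<Rightarrow> complex" where
  "hankel h u t = (LINT s|lebesgue_pos. h (t + s) * u s)"

end

theory Submission
  imports Defs "HOL-Probability.Characteristic_Functions"
begin

text \<open>
  Let \<open>L\<close> be the Laplace transform on \<open>L\<^sup>2(0,\<infinity>)\<close>. By Fubini's theorem \<open>H = L \<sigma> L\<close>, and Euler's
  integral gives \<open>(M L u)(x) = \<Gamma>(1/2 - ix) (M u)(-x)\<close>. Since \<open>|\<Gamma>(1/2 - ix)| = v(x)\<close> by the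
  reflection formula, writing \<open>B\<close> for the modified Mellin transform this says both \<open>M L = v B\<close> and
  \<open>B L = v M\<close>. After the substitution \<open>t = e\<^sup>y\<close> the Mellin transform is the Fourier transform \<open>\<Phi>\<close>, and
  \<open>\<Phi>\<^sup>2\<close> is the reflection \<open>y \<mapsto> -y\<close>, so \<open>M \<sigma> = s(D) M\<close>. Therefore
  \<open>B H = B L \<sigma> L = v M \<sigma> L = v s(D) M L = v s(D) v B\<close>.

  The Plancherel theorem is obtained from \<open>\<integral> (\<Phi> f) g = \<integral> f (\<Phi> g)\<close>: applied twice with a Gaussian
  cutoff it gives \<open>\<parallel>\<Phi> f\<parallel> = \<parallel>f\<parallel>\<close> for continuous \<open>f\<close> with compact support, and, after extension to
  \<open>L\<^sup>2\<close>, it shows that \<open>\<parallel>\<Phi>\<^sup>2 f - f(-\<cdot>)\<parallel>\<^sup>2 = 0\<close> by expanding the square.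
\<close>

section \<open>Square-integrable functions\<close>

text \<open>The transforms are defined by choice: \<open>L2_lim\<close> selects a limit in mean and
  \<open>L2_inv\<close> a preimage. Nothing follows about them until existence is proved, and
  uniqueness holds only up to null sets, so identities between transforms are almost-everywhere
  statements obtained from uniqueness of limits or from injectivity. For \<open>bmellin_inv\<close>
  the preimage is exhibited: the function to be inverted is the modified Mellin transform of L
  applied to \<sigma> L u. Fubini is available only under absolute convergence. For H this is
  automatic, because exp(-t l) is square integrable in l for t > 0. For the Mellin transform of L u
  it requires u(s) / sqrt s to be integrable, so that formula is proved for truncations and extended
  by the boundedness of L, of \<Phi> and of \<Gamma> on the critical line. A further obstacle is
  that the two limits in mean use different truncations: [1/(n+1), n+1] becomes [-ln(n+1), ln(n+1)]
  in the logarithmic variable, whereas the Fourier transform uses [-n, n]. Hence \<Phi> must be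
  shown independent of the approximating sequence.\<close>

definition nrm2 :: "'a measure \<Rightarrow> ('a \<Rightarrow> complex) \<Rightarrow> ennreal" where
  "nrm2 M f = (\<integral>\<^sup>+x. ennreal ((norm (f x))\<^sup>2) \<partial>M)"

text \<open>This is the convergence by which \<open>L2_lim\<close> selects. The squared extended
  distance is infinite for a difference that is not square integrable, so convergence can be stated
  before membership in \<open>L2\<close> is known.\<close>

definition L2_tendsto ::
  "'a measure \<Rightarrow> (nat \<Rightarrow> 'a \<Rightarrow> complex) \<Rightarrow> ('a \<Rightarrow> complex) \<Rightarrow> bool" where
  "L2_tendsto M F g \<longleftrightarrow> (\<lambda>n. nrm2 M (\<lambda>x. F n x - g x)) \<longlonglongrightarrow> 0"

lemma L2_measurable: "f \<in> L2 M \<Longrightarrow> f \<in> borel_measurable M"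
  by (simp add: L2_def)

lemma L2_iff_nrm2: "f \<in> L2 M \<longleftrightarrow> f \<in> borel_measurable M \<and> nrm2 M f < \<infinity>"
  by (auto simp: L2_def nrm2_def integrable_iff_bounded)

lemma nrm2_eq_L2_norm:
  assumes "f \<in> L2 M"
  shows "nrm2 M f = ennreal ((L2_norm M f)\<^sup>2)"
  using assms unfolding nrm2_def L2_norm_def L2_def
  by (subst nn_integral_eq_integral) auto

lemma L2_norm_nonneg [simp]: "0 \<le> L2_norm M f"
  by (simp add: L2_norm_def)

lemma nrm2_cong_AE: "AE x in M. f x = g x \<Longrightarrow> nrm2 M f = nrm2 M g"
  unfolding nrm2_def by (intro nn_integral_cong_AE) auto

lemma L2_norm_cong_AE:
  assumes "f \<in> borel_measurable M" "g \<in> borel_measurable M" "AE x in M. f x = g x"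
  shows "L2_norm M f = L2_norm M g"
  unfolding L2_norm_def using assms by (intro arg_cong[where f=sqrt] integral_cong_AE) auto

lemma nrm2_eq_0_iff:
  "f \<in> borel_measurable M \<Longrightarrow> nrm2 M f = 0 \<longleftrightarrow> (AE x in M. f x = 0)"
  unfolding nrm2_def by (subst nn_integral_0_iff_AE) auto

lemma sq_norm_add_le: "(norm (a + b))\<^sup>2 \<le> 2 * (norm a)\<^sup>2 + 2 * (norm (b::'a::real_normed_vector))\<^sup>2"
proof -
  have "(norm (a + b))\<^sup>2 \<le> (norm a + norm b)\<^sup>2"
    by (intro power_mono norm_triangle_ineq) auto
  also have "\<dots> \<le> 2 * (norm a)\<^sup>2 + 2 * (norm b)\<^sup>2"
    using zero_le_power2[of "norm a - norm b"] by (simp add: power2_eq_square algebra_simps)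
  finally show ?thesis .
qed

text \<open>The factor 2 takes the place of Minkowski's inequality: the estimate holds in the
  extended reals without finiteness, and constants are harmless when the terms tend to 0.\<close>

lemma nrm2_add_le:
  assumes [measurable]: "f \<in> borel_measurable M" "g \<in> borel_measurable M"
  shows "nrm2 M (\<lambda>x. f x + g x) \<le> 2 * nrm2 M f + 2 * nrm2 M g"
proof -
  have "nrm2 M (\<lambda>x. f x + g x)
      \<le> (\<integral>\<^sup>+x. 2 * ennreal ((norm (f x))\<^sup>2) + 2 * ennreal ((norm (g x))\<^sup>2) \<partial>M)"
    unfolding nrm2_def
    by (intro nn_integral_mono)
       (auto simp: ennreal_plus[symmetric] ennreal_mult'[symmetric] sq_norm_add_le
             simp flip: ennreal_numeral simp del: ennreal_plus intro!: ennreal_leI)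
  also have "\<dots> = 2 * nrm2 M f + 2 * nrm2 M g"
    unfolding nrm2_def by (subst nn_integral_add) (auto simp: nn_integral_cmult)
  finally show ?thesis .
qed

lemma nrm2_cmult:
  assumes "f \<in> borel_measurable M"
  shows "nrm2 M (\<lambda>x. c * f x) = ennreal ((norm c)\<^sup>2) * nrm2 M f"
  unfolding nrm2_def using assms
  by (subst nn_integral_cmult[symmetric]) (auto simp: norm_mult power_mult_distrib ennreal_mult)

lemma nrm2_minus_commute: "nrm2 M (\<lambda>x. f x - g x) = nrm2 M (\<lambda>x. g x - f x)"
  unfolding nrm2_def by (simp add: norm_minus_commute)

lemma nrm2_triangle:
  assumes [measurable]: "f \<in> borel_measurable M" "g \<in> borel_measurable M" "h \<in> borel_measurable M"
  shows "nrm2 M (\<lambda>x. f x - h x) \<le> 2 * nrm2 M (\<lambda>x. f x - g x) + 2 * nrm2 M (\<lambda>x. g x - h x)"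
  using nrm2_add_le[of "\<lambda>x. f x - g x" M "\<lambda>x. g x - h x"] by simp

lemma L2_add:
  assumes "f \<in> L2 M" "g \<in> L2 M"
  shows "(\<lambda>x. f x + g x) \<in> L2 M"
proof -
  have "nrm2 M (\<lambda>x. f x + g x) \<le> 2 * nrm2 M f + 2 * nrm2 M g"
    using assms by (intro nrm2_add_le) (auto simp: L2_def)
  also have "\<dots> < \<infinity>" using assms by (auto simp: L2_iff_nrm2 ennreal_mult_less_top)
  finally show ?thesis using assms by (auto simp: L2_iff_nrm2)
qed

lemma L2_cmult:
  assumes "f \<in> L2 M"
  shows "(\<lambda>x. c * f x) \<in> L2 M"
  using assms by (auto simp: L2_def norm_mult power_mult_distrib)

lemma L2_diff:
  assumes "f \<in> L2 M" "g \<in> L2 M"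
  shows "(\<lambda>x. f x - g x) \<in> L2 M"
  using L2_add[OF assms(1) L2_cmult[OF assms(2), of "-1"]] by simp

lemma borel_measurable_cnj [measurable]: "cnj \<in> borel_measurable borel"
  by (intro borel_measurable_continuous_onI continuous_intros)

lemma L2_cnj: "f \<in> L2 M \<Longrightarrow> (\<lambda>x. cnj (f x)) \<in> L2 M"
  using measurable_compose[OF _ borel_measurable_cnj, of f M] by (simp add: L2_def)

lemma L2_bounded_mult:
  assumes a: "a \<in> borel_measurable M" "AE x in M. norm (a x) \<le> C" and f: "f \<in> L2 M"
  shows "(\<lambda>x. a x * f x) \<in> L2 M" "nrm2 M (\<lambda>x. a x * f x) \<le> ennreal (C\<^sup>2) * nrm2 M f"
proof -
  have [measurable]: "a \<in> borel_measurable M" "f \<in> borel_measurable M"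
    using a f by (auto simp: L2_def)
  have "nrm2 M (\<lambda>x. a x * f x) \<le> (\<integral>\<^sup>+x. ennreal (C\<^sup>2) * ennreal ((norm (f x))\<^sup>2) \<partial>M)"
    unfolding nrm2_def
  proof (rule nn_integral_mono_AE, use a(2) in eventually_elim)
    case (elim x)
    have "(norm (a x * f x))\<^sup>2 \<le> C\<^sup>2 * (norm (f x))\<^sup>2"
      unfolding norm_mult power_mult_distrib using elim by (intro mult_right_mono power_mono) auto
    then show ?case by (simp add: ennreal_mult[symmetric] ennreal_leI)
  qed
  also have "\<dots> = ennreal (C\<^sup>2) * nrm2 M f"
    unfolding nrm2_def by (intro nn_integral_cmult) auto
  finally show *: "nrm2 M (\<lambda>x. a x * f x) \<le> ennreal (C\<^sup>2) * nrm2 M f" .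
  have "nrm2 M f < \<infinity>" using f by (auto simp: L2_iff_nrm2)
  then have "ennreal (C\<^sup>2) * nrm2 M f < \<infinity>" by (auto simp: ennreal_mult_less_top)
  with * show "(\<lambda>x. a x * f x) \<in> L2 M" by (auto simp: L2_iff_nrm2)
qed

text \<open>Cauchy-Schwarz for extended integrals gives finiteness first, hence integrability, and
  only then the real estimate. The pairing carries no conjugate, which suits the symmetric Fourier
  kernel.\<close>

lemma L2_mult_integrable:
  assumes "f \<in> L2 M" "g \<in> L2 M"
  shows "integrable M (\<lambda>x. f x * g x)"
    and "norm (LINT x|M. f x * g x) \<le> L2_norm M f * L2_norm M g"
    and "integrable M (\<lambda>x. norm (f x) * norm (g x))"
    and "(LINT x|M. norm (f x) * norm (g x)) \<le> L2_norm M f * L2_norm M g"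
proof -
  have [measurable]: "f \<in> borel_measurable M" "g \<in> borel_measurable M"
    using assms by (auto simp: L2_def)
  let ?I = "\<integral>\<^sup>+x. ennreal (norm (f x)) * ennreal (norm (g x)) \<partial>M"
  have "?I\<^sup>2 \<le> (\<integral>\<^sup>+x. (ennreal (norm (f x)))\<^sup>2 \<partial>M) * (\<integral>\<^sup>+x. (ennreal (norm (g x)))\<^sup>2 \<partial>M)"
    by (rule Cauchy_Schwarz_nn_integral) auto
  also have "\<dots> = nrm2 M f * nrm2 M g" unfolding nrm2_def by (simp add: ennreal_power)
  also have "\<dots> = ennreal ((L2_norm M f * L2_norm M g)\<^sup>2)"
    using assms by (simp add: nrm2_eq_L2_norm power_mult_distrib ennreal_mult)
  finally have *: "?I\<^sup>2 \<le> ennreal ((L2_norm M f * L2_norm M g)\<^sup>2)" .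
  then have "?I\<^sup>2 < \<infinity>" using le_less_trans by fastforce
  then have fin: "?I < \<infinity>" by (simp add: power_less_top_ennreal)
  then show i: "integrable M (\<lambda>x. norm (f x) * norm (g x))"
    by (auto simp: integrable_iff_bounded ennreal_mult norm_mult)
  from i show "integrable M (\<lambda>x. f x * g x)"
    by (rule Bochner_Integration.integrable_bound) (auto simp: norm_mult)
  have I: "?I = ennreal (LINT x|M. norm (f x) * norm (g x))"
    using nn_integral_eq_integral[OF i] by (simp add: ennreal_mult)
  have "(LINT x|M. norm (f x) * norm (g x))\<^sup>2 \<le> (L2_norm M f * L2_norm M g)\<^sup>2"
    using * unfolding I by (simp add: ennreal_power)
  then show le: "(LINT x|M. norm (f x) * norm (g x)) \<le> L2_norm M f * L2_norm M g"
    by (rule power2_le_imp_le) simp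
  show "norm (LINT x|M. f x * g x) \<le> L2_norm M f * L2_norm M g"
    using integral_norm_bound[of M "\<lambda>x. f x * g x"] le by (simp add: norm_mult)
qed

text \<open>Expand the square and apply Cauchy-Schwarz to the cross term. The sharp constant
  matters: the continuity of \<open>L2_norm\<close> under convergence in mean is derived from
  it.\<close>

lemma L2_norm_triangle:
  assumes "f \<in> L2 M" "g \<in> L2 M"
  shows "L2_norm M (\<lambda>x. f x + g x) \<le> L2_norm M f + L2_norm M g"
proof -
  have sq: "(L2_norm M f)\<^sup>2 = (LINT x|M. (norm (f x))\<^sup>2)" for f :: "'a \<Rightarrow> complex"
    by (simp add: L2_norm_def)
  have i: "integrable M (\<lambda>x. (norm (f x))\<^sup>2)" "integrable M (\<lambda>x. (norm (g x))\<^sup>2)"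
    "integrable M (\<lambda>x. norm (f x) * norm (g x))" "integrable M (\<lambda>x. (norm (f x + g x))\<^sup>2)"
    using assms L2_mult_integrable[OF assms] L2_add[OF assms] by (auto simp: L2_def)
  have "(L2_norm M (\<lambda>x. f x + g x))\<^sup>2
      \<le> (LINT x|M. (norm (f x))\<^sup>2 + 2 * (norm (f x) * norm (g x)) + (norm (g x))\<^sup>2)"
    unfolding sq
  proof (rule integral_mono)
    fix x
    have "(norm (f x + g x))\<^sup>2 \<le> (norm (f x) + norm (g x))\<^sup>2"
      by (intro power_mono norm_triangle_ineq) auto
    then show "(norm (f x + g x))\<^sup>2
        \<le> (norm (f x))\<^sup>2 + 2 * (norm (f x) * norm (g x)) + (norm (g x))\<^sup>2"
      by (simp add: power2_eq_square algebra_simps)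
  qed (use i in auto)
  also have "\<dots> = (L2_norm M f)\<^sup>2 + 2 * (LINT x|M. norm (f x) * norm (g x)) + (L2_norm M g)\<^sup>2"
    using i by (simp add: sq)
  also have "\<dots> \<le> (L2_norm M f + L2_norm M g)\<^sup>2"
    using L2_mult_integrable(4)[OF assms] by (simp add: power2_eq_square algebra_simps)
  finally show ?thesis by (rule power2_le_imp_le) simp
qed

lemma L2_norm_minus_commute: "L2_norm M (\<lambda>x. f x - g x) = L2_norm M (\<lambda>x. g x - f x)"
  by (simp add: L2_norm_def norm_minus_commute)

lemma L2_norm_diff_le:
  assumes "f \<in> L2 M" "g \<in> L2 M"
  shows "\<bar>L2_norm M f - L2_norm M g\<bar> \<le> L2_norm M (\<lambda>x. f x - g x)"
  using L2_norm_triangle[OF L2_diff[OF assms] assms(2)]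
    L2_norm_triangle[OF L2_diff[OF assms(2,1)] assms(1)]
  by (simp add: L2_norm_minus_commute[of M f g])

section \<open>Convergence in mean and completeness\<close>

lemma L2_tendsto_iff:
  assumes "\<And>n. F n \<in> L2 M" "g \<in> L2 M"
  shows "L2_tendsto M F g \<longleftrightarrow> (\<lambda>n. L2_norm M (\<lambda>x. F n x - g x)) \<longlonglongrightarrow> 0"
proof -
  have "L2_tendsto M F g \<longleftrightarrow> (\<lambda>n. ennreal ((L2_norm M (\<lambda>x. F n x - g x))\<^sup>2)) \<longlonglongrightarrow> ennreal 0"
    unfolding L2_tendsto_def using assms by (subst nrm2_eq_L2_norm) (auto intro: L2_diff)
  also have "\<dots> \<longleftrightarrow> (\<lambda>n. (L2_norm M (\<lambda>x. F n x - g x))\<^sup>2) \<longlonglongrightarrow> 0"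
    by (subst tendsto_ennreal_iff) auto
  also have "\<dots> \<longleftrightarrow> (\<lambda>n. L2_norm M (\<lambda>x. F n x - g x)) \<longlonglongrightarrow> 0"
  proof
    assume "(\<lambda>n. (L2_norm M (\<lambda>x. F n x - g x))\<^sup>2) \<longlonglongrightarrow> 0"
    from tendsto_real_sqrt[OF this] show "(\<lambda>n. L2_norm M (\<lambda>x. F n x - g x)) \<longlonglongrightarrow> 0" by simp
  next
    assume "(\<lambda>n. L2_norm M (\<lambda>x. F n x - g x)) \<longlonglongrightarrow> 0"
    from tendsto_power[OF this, of 2] show "(\<lambda>n. (L2_norm M (\<lambda>x. F n x - g x))\<^sup>2) \<longlonglongrightarrow> 0" by simp
  qed
  finally show ?thesis .
qed

lemma L2_tendsto_norm:
  assumes "\<And>n. F n \<in> L2 M" "g \<in> L2 M" "L2_tendsto M F g"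
  shows "(\<lambda>n. L2_norm M (F n)) \<longlonglongrightarrow> L2_norm M g"
proof -
  have "(\<lambda>n. L2_norm M (F n) - L2_norm M g) \<longlonglongrightarrow> 0"
    using assms(3)[unfolded L2_tendsto_iff[OF assms(1,2)]]
    by (rule Lim_null_comparison[rotated]) (auto intro!: always_eventually L2_norm_diff_le assms)
  then show ?thesis by (simp add: LIM_zero_iff)
qed

lemma L2_tendsto_const: "L2_tendsto M (\<lambda>_. f) f"
  by (simp add: L2_tendsto_def nrm2_def)

lemma L2_tendsto_lincomb:
  assumes F: "\<And>n. F n \<in> borel_measurable M" "f \<in> borel_measurable M" "L2_tendsto M F f"
    and G: "\<And>n. G n \<in> borel_measurable M" "g \<in> borel_measurable M" "L2_tendsto M G g"
  shows "L2_tendsto M (\<lambda>n x. c * F n x + G n x) (\<lambda>x. c * f x + g x)"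
  unfolding L2_tendsto_def
proof (rule tendsto_sandwich[OF _ _ tendsto_const])
  note [measurable] = F(1,2) G(1,2)
  have eq: "(\<lambda>x. c * F n x + G n x - (c * f x + g x))
      = (\<lambda>x. c * (F n x - f x) + (G n x - g x))" for n
    by (simp add: algebra_simps)
  have "nrm2 M (\<lambda>x. c * F n x + G n x - (c * f x + g x))
     \<le> 2 * (ennreal ((norm c)\<^sup>2) * nrm2 M (\<lambda>x. F n x - f x)) + 2 * nrm2 M (\<lambda>x. G n x - g x)" for n
    unfolding eq by (rule order_trans[OF nrm2_add_le]) (auto simp: nrm2_cmult)
  then show "\<forall>\<^sub>F n in sequentially. nrm2 M (\<lambda>x. c * F n x + G n x - (c * f x + g x))
     \<le> 2 * (ennreal ((norm c)\<^sup>2) * nrm2 M (\<lambda>x. F n x - f x)) + 2 * nrm2 M (\<lambda>x. G n x - g x)"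
    by auto
  have "(\<lambda>n. 2 * (ennreal ((norm c)\<^sup>2) * nrm2 M (\<lambda>x. F n x - f x)) + 2 * nrm2 M (\<lambda>x. G n x - g x))
      \<longlonglongrightarrow> 2 * (ennreal ((norm c)\<^sup>2) * 0) + 2 * 0"
    using F(3) G(3) unfolding L2_tendsto_def
    by (intro tendsto_add ennreal_tendsto_cmult) auto
  then show "(\<lambda>n. 2 * (ennreal ((norm c)\<^sup>2) * nrm2 M (\<lambda>x. F n x - f x)) + 2 * nrm2 M (\<lambda>x. G n x - g x))
      \<longlonglongrightarrow> 0" by simp
qed simp

lemma L2_tendsto_bounded_mult:
  assumes a: "a \<in> borel_measurable M" "AE x in M. norm (a x) \<le> C"
    and F: "\<And>n. F n \<in> L2 M" "f \<in> L2 M" "L2_tendsto M F f"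
  shows "L2_tendsto M (\<lambda>n x. a x * F n x) (\<lambda>x. a x * f x)"
  unfolding L2_tendsto_def
proof (rule tendsto_sandwich[OF _ _ tendsto_const])
  have "nrm2 M (\<lambda>x. a x * (F n x - f x)) \<le> ennreal (C\<^sup>2) * nrm2 M (\<lambda>x. F n x - f x)" for n
    by (intro L2_bounded_mult a L2_diff F)
  then show "\<forall>\<^sub>F n in sequentially. nrm2 M (\<lambda>x. a x * F n x - a x * f x)
      \<le> ennreal (C\<^sup>2) * nrm2 M (\<lambda>x. F n x - f x)"
    by (simp add: algebra_simps)
  show "(\<lambda>n. ennreal (C\<^sup>2) * nrm2 M (\<lambda>x. F n x - f x)) \<longlonglongrightarrow> 0"
    using ennreal_tendsto_cmult[OF _ F(3)[unfolded L2_tendsto_def], of "ennreal (C\<^sup>2)"] by simp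
qed simp

lemma L2_tendsto_unique:
  assumes "\<And>n. F n \<in> borel_measurable M" "f \<in> borel_measurable M" "g \<in> borel_measurable M"
    and "L2_tendsto M F f" "L2_tendsto M F g"
  shows "AE x in M. f x = g x"
proof -
  note [measurable] = assms(1-3)
  have "(\<lambda>n. 2 * nrm2 M (\<lambda>x. F n x - f x) + 2 * nrm2 M (\<lambda>x. F n x - g x)) \<longlonglongrightarrow> 2 * 0 + 2 * 0"
    using assms(4,5) unfolding L2_tendsto_def
    by (intro tendsto_add ennreal_tendsto_cmult) auto
  moreover have "nrm2 M (\<lambda>x. f x - g x)
      \<le> 2 * nrm2 M (\<lambda>x. F n x - f x) + 2 * nrm2 M (\<lambda>x. F n x - g x)" for n
    using nrm2_triangle[of f M "F n" g] by (simp add: nrm2_minus_commute[of M f "F n"])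
  ultimately have "nrm2 M (\<lambda>x. f x - g x) \<le> 2 * 0 + 2 * 0"
    by (intro LIMSEQ_le_const) auto
  then have "nrm2 M (\<lambda>x. f x - g x) = 0" by simp
  then show ?thesis by (subst (asm) nrm2_eq_0_iff) auto
qed

text \<open>Write \<open>F n * G n - f * g\<close> as
  \<open>(F n - f) * G n + f * (G n - g)\<close>. The norms of \<open>G n\<close> converge, so
  Cauchy-Schwarz makes both terms vanish.\<close>

lemma L2_tendsto_pairing:
  assumes F: "\<And>n. F n \<in> L2 M" "f \<in> L2 M" "L2_tendsto M F f"
    and G: "\<And>n. G n \<in> L2 M" "g \<in> L2 M" "L2_tendsto M G g"
  shows "(\<lambda>n. LINT x|M. F n x * G n x) \<longlonglongrightarrow> (LINT x|M. f x * g x)"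
proof -
  have "(\<lambda>n. (LINT x|M. F n x * G n x) - (LINT x|M. f x * g x)) \<longlonglongrightarrow> 0"
  proof (rule Lim_null_comparison)
    have "norm ((LINT x|M. F n x * G n x) - (LINT x|M. f x * g x))
       \<le> L2_norm M (\<lambda>x. F n x - f x) * L2_norm M (G n) + L2_norm M f * L2_norm M (\<lambda>x. G n x - g x)" for n
    proof -
      have "(LINT x|M. F n x * G n x) - (LINT x|M. f x * g x)
          = (LINT x|M. F n x * G n x - f x * g x)"
        by (intro Bochner_Integration.integral_diff[symmetric] L2_mult_integrable F G)
      also have "\<dots> = (LINT x|M. (F n x - f x) * G n x + f x * (G n x - g x))"
        by (simp add: algebra_simps)
      also have "\<dots> = (LINT x|M. (F n x - f x) * G n x) + (LINT x|M. f x * (G n x - g x))"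
        by (intro Bochner_Integration.integral_add L2_mult_integrable L2_diff F G)
      also have "norm \<dots> \<le> norm (LINT x|M. (F n x - f x) * G n x) + norm (LINT x|M. f x * (G n x - g x))"
        by (rule norm_triangle_ineq)
      also have "\<dots> \<le> L2_norm M (\<lambda>x. F n x - f x) * L2_norm M (G n)
          + L2_norm M f * L2_norm M (\<lambda>x. G n x - g x)"
        by (intro add_mono L2_mult_integrable L2_diff F G)
      finally show ?thesis .
    qed
    then show "\<forall>\<^sub>F n in sequentially. norm ((LINT x|M. F n x * G n x) - (LINT x|M. f x * g x))
       \<le> L2_norm M (\<lambda>x. F n x - f x) * L2_norm M (G n) + L2_norm M f * L2_norm M (\<lambda>x. G n x - g x)"
      by auto
    have "(\<lambda>n. L2_norm M (\<lambda>x. F n x - f x) * L2_norm M (G n) + L2_norm M f * L2_norm M (\<lambda>x. G n x - g x))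
        \<longlonglongrightarrow> 0 * L2_norm M g + L2_norm M f * 0"
      by (intro tendsto_intros L2_tendsto_norm G F(3)[unfolded L2_tendsto_iff[OF F(1,2)]]
            G(3)[unfolded L2_tendsto_iff[OF G(1,2)]])
    then show "(\<lambda>n. L2_norm M (\<lambda>x. F n x - f x) * L2_norm M (G n) + L2_norm M f * L2_norm M (\<lambda>x. G n x - g x))
        \<longlonglongrightarrow> 0" by simp
  qed
  then show ?thesis by (simp add: LIM_zero_iff)
qed

text \<open>It bounds a pointwise limit with no prior integrability of that limit, which is how
  limits are shown to be square integrable below.\<close>

lemma nrm2_Fatou:
  assumes [measurable]: "\<And>n. F n \<in> borel_measurable M" and lim: "AE x in M. (\<lambda>n. F n x) \<longlonglongrightarrow> g x"
  shows "nrm2 M g \<le> liminf (\<lambda>n. nrm2 M (F n))"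
proof -
  have "nrm2 M g = (\<integral>\<^sup>+x. liminf (\<lambda>n. ennreal ((norm (F n x))\<^sup>2)) \<partial>M)"
    unfolding nrm2_def
  proof (rule nn_integral_cong_AE, use lim in eventually_elim)
    case (elim x)
    then have "(\<lambda>n. ennreal ((norm (F n x))\<^sup>2)) \<longlonglongrightarrow> ennreal ((norm (g x))\<^sup>2)"
      by (intro tendsto_ennrealI tendsto_intros)
    then show ?case by (intro lim_imp_Liminf[symmetric]) auto
  qed
  also have "\<dots> \<le> liminf (\<lambda>n. nrm2 M (F n))"
    unfolding nrm2_def by (intro nn_integral_liminf) auto
  finally show ?thesis .
qed

text \<open>Riesz-Fischer: a rapidly converging subsequence converges almost everywhere, and Fatou's
  lemma turns its pointwise limit into a limit in mean of the whole sequence.\<close>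

lemma L2_complete:
  assumes F: "\<And>n. F n \<in> L2 M"
    and cauchy: "\<And>e. e > 0 \<Longrightarrow> \<exists>N. \<forall>m\<ge>N. \<forall>n\<ge>N. nrm2 M (\<lambda>x. F m x - F n x) \<le> ennreal e"
  shows "\<exists>g\<in>L2 M. L2_tendsto M F g"
proof -
  have [measurable]: "F n \<in> borel_measurable M" for n using F by (auto simp: L2_def)
  have "\<exists>N. \<forall>k. \<forall>m\<ge>N k. \<forall>n\<ge>N k. nrm2 M (\<lambda>x. F m x - F n x) \<le> ennreal ((1/4)^k)"
    by (intro choice allI cauchy) simp
  then obtain N where N: "\<And>k m n. m \<ge> N k \<Longrightarrow> n \<ge> N k \<Longrightarrow>
      nrm2 M (\<lambda>x. F m x - F n x) \<le> ennreal ((1/4)^k)" by blast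
  \<comment> \<open>Summing all thresholds up to \<open>k\<close> puts \<open>r k\<close> and
    \<open>r (Suc k)\<close> above \<open>N k\<close> without \<open>N\<close> being monotone; the
    extra \<open>k\<close> sends \<open>r\<close> to infinity.\<close>
  define r where "r k = (\<Sum>i\<le>k. N i) + k" for k
  have r: "r k \<ge> N k" "r k \<ge> k" "r (Suc k) \<ge> N k" for k
    unfolding r_def using member_le_sum[of k "{..k}" N] by auto
  define d where "d k x = F (r (Suc k)) x - F (r k) x" for k x
  have [measurable]: "d k \<in> borel_measurable M" for k unfolding d_def by measurable
  \<comment> \<open>The weight \<open>2^k\<close> keeps the integrals summable, since
    \<open>2^k * (1/4)^k = (1/2)^k\<close>, and is strong enough to recover summability of the
    unsquared increments.\<close>
  have "(\<integral>\<^sup>+x. (\<Sum>k. ennreal (2^k * (norm (d k x))\<^sup>2)) \<partial>M) = (\<Sum>k. \<integral>\<^sup>+x. ennreal (2^k * (norm (d k x))\<^sup>2) \<partial>M)"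
    by (intro nn_integral_suminf) auto
  also have "\<dots> \<le> (\<Sum>k. ennreal ((1/2)^k))"
  proof (intro suminf_le summableI)
    fix k
    have "(\<integral>\<^sup>+x. ennreal (2^k * (norm (d k x))\<^sup>2) \<partial>M) = ennreal (2^k) * nrm2 M (d k)"
      unfolding nrm2_def by (subst nn_integral_cmult[symmetric]) (auto simp: ennreal_mult)
    also have "\<dots> \<le> ennreal (2^k) * ennreal ((1/4)^k)"
      unfolding d_def by (intro mult_left_mono N r) auto
    also have "\<dots> = ennreal ((1/2)^k)"
      using power_mult_distrib[of "2::real" "1/4" k] by (subst ennreal_mult[symmetric]) auto
    finally show "(\<integral>\<^sup>+x. ennreal (2^k * (norm (d k x))\<^sup>2) \<partial>M) \<le> ennreal ((1/2)^k)" .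
  qed
  also have "\<dots> = ennreal (\<Sum>k. (1/2)^k)"
    by (intro suminf_ennreal2) (auto intro: summable_geometric)
  also have "\<dots> < \<infinity>" by simp
  finally have "AE x in M. (\<Sum>k. ennreal (2^k * (norm (d k x))\<^sup>2)) \<noteq> \<infinity>"
    by (intro nn_integral_PInf_AE) auto
  then have conv: "AE x in M. convergent (\<lambda>k. F (r k) x)"
  proof eventually_elim
    case (elim x)
    then have s: "summable (\<lambda>k. 2^k * (norm (d k x))\<^sup>2)"
      by (intro summable_suminf_not_top) auto
    have "summable (\<lambda>k. ((1/2)^k + 2^k * (norm (d k x))\<^sup>2))"
      by (intro summable_add s summable_geometric) auto
    then have "summable (\<lambda>k. d k x)"
    proof (rule summable_comparison_test'[where N=0])
      fix k
      \<comment> \<open>Expanding this square bounds twice the norm of the increment by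
        \<open>(1/2)^k\<close> plus the weighted square, both of which are summable.\<close>
      have "0 \<le> (1/2)^k * (1 - 2^k * norm (d k x))\<^sup>2" by simp
      also have "\<dots> = (1/2)^k + (1/2 * 2)^k * (2^k * (norm (d k x))\<^sup>2) - (1/2 * 2)^k * (2 * norm (d k x))"
        unfolding power_mult_distrib power2_diff by (simp add: power2_eq_square algebra_simps)
      also have "\<dots> = (1/2)^k + 2^k * (norm (d k x))\<^sup>2 - 2 * norm (d k x)" by simp
      finally show "norm (d k x) \<le> (1/2)^k + 2^k * (norm (d k x))\<^sup>2"
        using norm_ge_zero[of "d k x"] by linarith
    qed
    then have "convergent (\<lambda>n. \<Sum>k<n. d k x)" by (simp add: summable_iff_convergent)
    moreover have "(\<Sum>k<n. d k x) = F (r n) x - F (r 0) x" for n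
      unfolding d_def by (rule sum_lessThan_telescope)
    ultimately have "convergent (\<lambda>n. F (r n) x - F (r 0) x + F (r 0) x)"
      by (intro convergent_add convergent_const) simp
    then show ?case by simp
  qed
  define g where "g x = lim (\<lambda>k. F (r k) x)" for x
  have [measurable]: "g \<in> borel_measurable M" unfolding g_def by (intro borel_measurable_lim_metric) auto
  have lim: "AE x in M. (\<lambda>k. F (r k) x) \<longlonglongrightarrow> g x"
    using conv unfolding g_def by eventually_elim (simp add: convergent_LIMSEQ_iff)
  \<comment> \<open>The index \<open>n\<close> stays fixed while Fatou's lemma sends the other index
    to infinity along \<open>r\<close>.\<close>
  have bound: "nrm2 M (\<lambda>x. F n x - g x) \<le> ennreal e"
    if "\<And>m. m \<ge> N \<Longrightarrow> nrm2 M (\<lambda>x. F n x - F m x) \<le> ennreal e" for n N e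
  proof -
    have "nrm2 M (\<lambda>x. F n x - g x) \<le> liminf (\<lambda>k. nrm2 M (\<lambda>x. F n x - F (r k) x))"
      by (rule nrm2_Fatou) (use lim in \<open>auto intro!: tendsto_intros\<close>)
    also have "\<dots> \<le> ennreal e"
    proof (rule Liminf_le)
      show "\<forall>\<^sub>F k in sequentially. nrm2 M (\<lambda>x. F n x - F (r k) x) \<le> ennreal e"
        using eventually_ge_at_top[of N]
        by eventually_elim (rule that, use r(2) le_trans in blast)
    qed auto
    finally show ?thesis .
  qed
  have tendsto: "L2_tendsto M F g"
    unfolding L2_tendsto_def
  proof (rule order_tendstoI)
    fix a :: ennreal assume "0 < a"
    then obtain b where b: "0 < b" "b < a" using dense by blast
    then obtain e where e: "b = ennreal e" "0 < e" by (cases b) auto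
    obtain N where "\<And>m n. m \<ge> N \<Longrightarrow> n \<ge> N \<Longrightarrow> nrm2 M (\<lambda>x. F m x - F n x) \<le> ennreal e"
      using cauchy[OF e(2)] by blast
    then have "nrm2 M (\<lambda>x. F n x - g x) \<le> ennreal e" if "n \<ge> N" for n
      using that by (intro bound[of N]) auto
    then show "\<forall>\<^sub>F n in sequentially. nrm2 M (\<lambda>x. F n x - g x) < a"
      unfolding eventually_sequentially using b(2) e(1) le_less_trans by blast
  qed simp
  obtain N1 where N1: "\<And>m n. m \<ge> N1 \<Longrightarrow> n \<ge> N1 \<Longrightarrow> nrm2 M (\<lambda>x. F m x - F n x) \<le> ennreal 1"
    using cauchy[of 1] by fastforce
  have "nrm2 M (\<lambda>x. F N1 x - g x) \<le> ennreal 1"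
    by (rule bound[of N1]) (use N1 in auto)
  then have "(\<lambda>x. F N1 x - g x) \<in> L2 M"
    by (auto simp: L2_iff_nrm2 intro: le_less_trans)
  from L2_diff[OF F[of N1] this] have "g \<in> L2 M" by simp
  with tendsto show ?thesis by blast
qed

text \<open>One limit in \<open>L2\<close> validates the choice made by \<open>L2_lim\<close>;
  uniqueness of limits in mean then identifies the chosen function up to a null set.\<close>

lemma L2_limI:
  assumes F: "\<And>n. F n \<in> borel_measurable M" and g: "g \<in> L2 M" "L2_tendsto M F g"
  shows "L2_lim M F \<in> L2 M" "L2_tendsto M F (L2_lim M F)" "AE x in M. L2_lim M F x = g x"
proof -
  have "\<exists>g. g \<in> L2 M \<and> L2_tendsto M F g" using g by blast
  then have "L2_lim M F \<in> L2 M \<and> L2_tendsto M F (L2_lim M F)"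
    unfolding L2_lim_def L2_tendsto_def nrm2_def by (rule someI_ex)
  then show *: "L2_lim M F \<in> L2 M" "L2_tendsto M F (L2_lim M F)" by auto
  show "AE x in M. L2_lim M F x = g x"
    by (rule L2_tendsto_unique[OF F _ _ *(2) g(2)]) (use * g in \<open>auto simp: L2_def\<close>)
qed

section \<open>Fourier integrals of integrable functions\<close>

lemma sigma_finite_lebesgue: "sigma_finite_measure (lebesgue :: real measure)"
proof
  show "\<exists>A::real set set. countable A \<and> A \<subseteq> sets lebesgue \<and> \<Union>A = space lebesgue
      \<and> (\<forall>a\<in>A. emeasure lebesgue a \<noteq> \<infinity>)"
  proof (intro exI[of _ "range (\<lambda>n::nat. {- real n..real n})"] conjI)
    have "\<exists>n::nat. x \<in> {- real n..real n}" for x :: real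
      using real_arch_simple[of "\<bar>x\<bar>"] by (metis abs_le_iff atLeastAtMost_iff minus_le_iff)
    then show "(\<Union>n::nat. {- real n..real n}) = space lebesgue" by auto
  qed auto
qed

interpretation lebesgue_sf: sigma_finite_measure "lebesgue :: real measure"
  by (rule sigma_finite_lebesgue)

interpretation lebesgue_pair: pair_sigma_finite "lebesgue :: real measure" "lebesgue :: real measure"
  by unfold_locales

lemma lebesgue_measurable_of_borel: "f \<in> borel_measurable borel \<Longrightarrow> f \<in> borel_measurable lebesgue"
  by (intro measurable_completion) simp

lemma lebesgue_measurable_ident: "(\<lambda>x::real. x) \<in> lebesgue \<rightarrow>\<^sub>M borel"
  by (intro lebesgue_measurable_of_borel) simp

text \<open>The transform by a plain integral, with its intended meaning for integrable
  \<open>f\<close>. The transform \<open>fourier\<close> is the limit in mean of \<open>ft\<close>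
  along truncations.\<close>

definition ft :: "(real \<Rightarrow> complex) \<Rightarrow> real \<Rightarrow> complex" where
  "ft f \<xi> = of_real (1 / sqrt (2 * pi)) *
     (LINT x|lebesgue. exp (- (\<i> * of_real x * of_real \<xi>)) * f x)"

lemma fourier_kernel_measurable [measurable]:
  assumes [measurable]: "f \<in> M \<rightarrow>\<^sub>M borel" "g \<in> M \<rightarrow>\<^sub>M borel"
  shows "(\<lambda>p. exp (- (\<i> * complex_of_real (f p) * complex_of_real (g p)))) \<in> borel_measurable M"
  by measurable

lemma fourier_kernel_measurable_lebesgue [measurable]:
  "(\<lambda>x. exp (- (\<i> * complex_of_real x * complex_of_real \<xi>))) \<in> borel_measurable lebesgue"
  "(\<lambda>x. exp (- (\<i> * complex_of_real \<xi> * complex_of_real x))) \<in> borel_measurable lebesgue"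
  by (rule lebesgue_measurable_of_borel, measurable)+

text \<open>Fubini runs over a product of two completed sigma-algebras. Projections measured into
  \<open>borel\<close> can be composed with the continuous kernels, which makes the integrands
  jointly measurable.\<close>

lemma lebesgue_fst_snd_measurable [measurable]:
  "(\<lambda>p. fst p) \<in> (lebesgue :: real measure) \<Otimes>\<^sub>M N \<rightarrow>\<^sub>M borel"
  "(\<lambda>p. snd p) \<in> N \<Otimes>\<^sub>M (lebesgue :: real measure) \<rightarrow>\<^sub>M borel"
  by (rule measurable_compose[OF measurable_fst lebesgue_measurable_ident],
      rule measurable_compose[OF measurable_snd lebesgue_measurable_ident])

lemma ft_integrable:
  "integrable lebesgue f \<Longrightarrow> integrable lebesgue (\<lambda>x. exp (- (\<i> * of_real x * of_real \<xi>)) * f x)"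
  by (rule Bochner_Integration.integrable_bound[of _ f]) (auto simp: norm_mult)

lemma ft_measurable [measurable]:
  assumes [measurable]: "f \<in> borel_measurable lebesgue"
  shows "ft f \<in> borel_measurable lebesgue"
proof -
  have [measurable]: "(\<lambda>p. exp (- (\<i> * complex_of_real (snd p) * complex_of_real (fst p))) * f (snd p))
      \<in> borel_measurable (lebesgue \<Otimes>\<^sub>M lebesgue)"
    by measurable
  have "(\<lambda>\<xi>. LINT x|lebesgue. exp (- (\<i> * complex_of_real x * complex_of_real \<xi>)) * f x)
      \<in> borel_measurable lebesgue"
    by (rule lebesgue_sf.borel_measurable_lebesgue_integral) (simp add: case_prod_unfold)
  then show ?thesis unfolding ft_def[abs_def] by measurable
qed

lemma ft_cong_AE:
  assumes "f \<in> borel_measurable lebesgue" "g \<in> borel_measurable lebesgue" "AE x in lebesgue. f x = g x"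
  shows "ft f = ft g"
proof
  fix \<xi>
  note [measurable] = assms(1,2)
  show "ft f \<xi> = ft g \<xi>"
    unfolding ft_def using assms(3)
    by (intro arg_cong2[where f="(*)"] refl integral_cong_AE) (auto elim: eventually_mono)
qed

lemma norm_ft_le:
  assumes "integrable lebesgue f"
  shows "norm (ft f \<xi>) \<le> (LINT x|lebesgue. norm (f x))"
proof -
  have "norm (ft f \<xi>)
      \<le> 1 / sqrt (2 * pi) * (LINT x|lebesgue. norm (exp (- (\<i> * of_real x * of_real \<xi>)) * f x))"
    unfolding ft_def norm_mult[of "of_real (1 / sqrt (2 * pi))"]
    by (intro mult_mono integral_norm_bound) (auto simp: norm_divide)
  also have "\<dots> \<le> 1 * (LINT x|lebesgue. norm (f x))"
  proof (intro mult_mono)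
    have "1 \<le> sqrt (2 * pi)" using pi_gt3 by simp
    then show "1 / sqrt (2 * pi) \<le> 1" by simp
  qed (auto simp: norm_mult)
  finally show ?thesis by simp
qed

lemma ft_lincomb:
  assumes "integrable lebesgue f" "integrable lebesgue g"
  shows "ft (\<lambda>x. c * f x + g x) \<xi> = c * ft f \<xi> + ft g \<xi>"
proof -
  have "(\<lambda>x. exp (- (\<i> * of_real x * of_real \<xi>)) * (c * f x + g x))
      = (\<lambda>x. c * (exp (- (\<i> * of_real x * of_real \<xi>)) * f x) + exp (- (\<i> * of_real x * of_real \<xi>)) * g x)"
    by (simp add: algebra_simps)
  then show ?thesis
    unfolding ft_def
    using ft_integrable[OF assms(1), of \<xi>] ft_integrable[OF assms(2), of \<xi>]
    by (simp add: algebra_simps)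
qed

lemma ft_diff:
  assumes "integrable lebesgue f" "integrable lebesgue g"
  shows "ft (\<lambda>x. f x - g x) \<xi> = ft f \<xi> - ft g \<xi>"
  using ft_lincomb[OF assms(2,1), of "-1" \<xi>] by simp

section \<open>Reflection of the line and the symmetric pairing\<close>

lemma
  fixes f :: "real \<Rightarrow> complex"
  shows nn_integral_lebesgue_reflect:
      "g \<in> borel_measurable lebesgue \<Longrightarrow> (\<integral>\<^sup>+x. g (- x) \<partial>lebesgue) = (\<integral>\<^sup>+(x::real). g x \<partial>lebesgue)"
    and lebesgue_measurable_uminus: "uminus \<in> (lebesgue :: real measure) \<rightarrow>\<^sub>M lebesgue"
    and integral_lebesgue_reflect: "(LINT x|lebesgue. f (- x)) = (LINT x|lebesgue. f x)"
    and integrable_lebesgue_reflect: "integrable lebesgue f \<Longrightarrow> integrable lebesgue (\<lambda>x. f (- x))"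
    and AE_lebesgue_reflect: "(AE x in (lebesgue :: real measure). P (- x)) \<longleftrightarrow> (AE x in lebesgue. P x)"
proof -
  show 1: "uminus \<in> (lebesgue :: real measure) \<rightarrow>\<^sub>M lebesgue"
  proof -
    have "(*\<^sub>R) (-1) = (uminus :: real \<Rightarrow> real)" by (simp add: fun_eq_iff)
    then show ?thesis using lebesgue_measurable_scaling[of "-1", where 'a=real] by simp
  qed
  have 2: "distr lebesgue lebesgue uminus = (lebesgue :: real measure)"
    using lebesgue_real_affine[of "-1" 0] by (simp add: density_1)
  show "(\<integral>\<^sup>+x. g (- x) \<partial>lebesgue) = (\<integral>\<^sup>+(x::real). g x \<partial>lebesgue)"
    if "g \<in> borel_measurable lebesgue" for g
    using nn_integral_distr[OF 1, of g] that by (simp add: 2)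
  have 3: "integrable lebesgue (\<lambda>x. f (- x))" if "integrable lebesgue f" for f :: "real \<Rightarrow> complex"
    using integrable_distr[OF 1, of f] that by (simp add: 2)
  then show "integrable lebesgue f \<Longrightarrow> integrable lebesgue (\<lambda>x. f (- x))" .
  show "(LINT x|lebesgue. f (- x)) = (LINT x|lebesgue. f x)"
  proof (cases "f \<in> borel_measurable lebesgue")
    case True
    then show ?thesis using integral_distr[OF 1, of f] by (simp add: 2)
  next
    case False
    \<comment> \<open>Both integrals then have the default value 0: were the reflected function
      integrable, reflecting it again would make \<open>f\<close> measurable.\<close>
    then have "\<not> integrable lebesgue f" by auto
    moreover from False have "\<not> integrable lebesgue (\<lambda>x. f (- x))"
      using 3[of "\<lambda>x. f (- x)"] by auto
    ultimately show ?thesis by (simp add: not_integrable_integral_eq)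
  qed
  have "AE x in lebesgue. P (- x)" if "AE x in lebesgue. P (x::real)" for P
    using that by (intro AE_distrD[OF 1]) (simp only: 2)
  from this[of P] this[of "\<lambda>x. P (- x)"]
  show "(AE x in (lebesgue :: real measure). P (- x)) \<longleftrightarrow> (AE x in lebesgue. P x)"
    by (intro iffI) (simp_all only: minus_minus)
qed

text \<open>Conjugation flips the sign in the kernel and reflection flips it back. The conjugate of
  a transform is thus itself a transform, which permits a second use of the pairing formula.\<close>

lemma cnj_ft: "cnj (ft f \<xi>) = ft (\<lambda>x. cnj (f (- x))) \<xi>"
proof -
  have "cnj (LINT x|lebesgue. exp (- (\<i> * of_real x * of_real \<xi>)) * f x)
      = (LINT x|lebesgue. cnj (exp (- (\<i> * of_real x * of_real \<xi>)) * f x))"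
    by (rule Bochner_Integration.integral_cnj[symmetric])
  also have "\<dots> = (LINT x|lebesgue. cnj (exp (- (\<i> * of_real (- x) * of_real \<xi>)) * f (- x)))"
    by (rule integral_lebesgue_reflect[symmetric])
  also have "\<dots> = (LINT x|lebesgue. exp (- (\<i> * of_real x * of_real \<xi>)) * cnj (f (- x)))"
    by (simp add: exp_cnj)
  finally show ?thesis unfolding ft_def by simp
qed

text \<open>The kernel is symmetric in its two variables and has modulus one, so the double
  integrand is dominated by \<open>norm (f x) * norm (g \<xi>)\<close> and Fubini applies.\<close>

lemma ft_pairing:
  assumes f: "integrable lebesgue f" and g: "integrable lebesgue g"
  shows "(LINT \<xi>|lebesgue. ft f \<xi> * g \<xi>) = (LINT x|lebesgue. f x * ft g x)"
proof -
  let ?K = "\<lambda>x \<xi>. exp (- (\<i> * complex_of_real x * complex_of_real \<xi>))"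
  have [measurable]: "f \<in> borel_measurable lebesgue" "g \<in> borel_measurable lebesgue"
    using f g by auto
  have int: "integrable (lebesgue \<Otimes>\<^sub>M lebesgue) (\<lambda>(x, \<xi>). ?K x \<xi> * f x * g \<xi>)"
  proof (rule lebesgue_pair.Fubini_integrable)
    show "(\<lambda>(x, \<xi>). ?K x \<xi> * f x * g \<xi>) \<in> borel_measurable (lebesgue \<Otimes>\<^sub>M lebesgue)"
      unfolding case_prod_unfold by measurable
    show "integrable lebesgue (\<lambda>x. LINT \<xi>|lebesgue. norm (case (x, \<xi>) of (x, \<xi>) \<Rightarrow> ?K x \<xi> * f x * g \<xi>))"
      using f by (simp add: norm_mult)
    show "AE x in lebesgue. integrable lebesgue (\<lambda>\<xi>. case (x, \<xi>) of (x, \<xi>) \<Rightarrow> ?K x \<xi> * f x * g \<xi>)"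
    proof (intro AE_I2)
      fix x :: real
      show "integrable lebesgue (\<lambda>\<xi>. case (x, \<xi>) of (x, \<xi>) \<Rightarrow> ?K x \<xi> * f x * g \<xi>)"
        by (rule Bochner_Integration.integrable_bound[of _ "\<lambda>\<xi>. f x * g \<xi>"])
           (use g in \<open>auto simp: norm_mult\<close>)
    qed
  qed
  let ?c = "complex_of_real (1 / sqrt (2 * pi))"
  have "(LINT \<xi>|lebesgue. ft f \<xi> * g \<xi>)
      = (LINT \<xi>|lebesgue. ?c * ((LINT x|lebesgue. ?K x \<xi> * f x) * g \<xi>))"
    unfolding ft_def by (simp only: mult.assoc[of ?c])
  also have "\<dots> = ?c * (LINT \<xi>|lebesgue. LINT x|lebesgue. ?K x \<xi> * f x * g \<xi>)"
    by (simp only: integral_mult_left_zero integral_mult_right_zero)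
  also have "\<dots> = ?c * (LINT x|lebesgue. LINT \<xi>|lebesgue. ?K x \<xi> * f x * g \<xi>)"
    by (subst lebesgue_pair.Fubini_integral) (use int in auto)
  also have "\<dots> = ?c * (LINT x|lebesgue. LINT \<xi>|lebesgue. f x * (?K \<xi> x * g \<xi>))"
    by (simp only: mult_ac)
  also have "\<dots> = (LINT x|lebesgue. ?c * (f x * (LINT \<xi>|lebesgue. ?K \<xi> x * g \<xi>)))"
    by (simp only: integral_mult_right_zero)
  also have "\<dots> = (LINT x|lebesgue. f x * ft g x)"
    unfolding ft_def by (simp only: mult.left_commute[of ?c])
  finally show ?thesis .
qed

text \<open>A cutoff of width \<open>c\<close>, normalised to be 1 at the origin so that it
  increases to 1 as \<open>c\<close> grows. For \<open>c = 1\<close> it is a multiple of the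
  standard normal density.\<close>

definition gauss :: "real \<Rightarrow> real \<Rightarrow> complex" where
  "gauss c x = of_real (exp (- (x / c)\<^sup>2 / 2))"

lemma gauss_measurable [measurable]: "gauss c \<in> borel_measurable borel"
  unfolding gauss_def by measurable

lemma gauss_1: "gauss 1 x = of_real (sqrt (2 * pi) * std_normal_density x)"
  by (simp add: gauss_def std_normal_density_def)

lemma integrable_gauss:
  assumes "c > 0"
  shows "integrable lborel (gauss c)"
proof -
  have "integrable lborel (gauss 1)"
    unfolding gauss_1 by (intro integrable_of_real integrable_mult_right) simp
  from lborel_integrable_real_affine[OF this, of "1/c" 0] show ?thesis
    using assms by (simp add: gauss_def[abs_def])
qed

lemma integral_gauss_1: "(LINT x|lborel. gauss 1 x) = of_real (sqrt (2 * pi))"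
  unfolding gauss_1 by simp

lemma ft_eq_lborel:
  "f \<in> borel_measurable borel \<Longrightarrow>
    ft f \<xi> = of_real (1 / sqrt (2 * pi)) * (LINT x|lborel. exp (- (\<i> * of_real x * of_real \<xi>)) * f x)"
  unfolding ft_def by (subst integral_completion) auto

text \<open>The integral is the characteristic function of the standard normal law, taken at
  \<open>- \<xi>\<close> because \<open>char\<close> uses the opposite sign in the exponent.\<close>

lemma ft_gauss_1: "ft (gauss 1) \<xi> = of_real (exp (- \<xi>\<^sup>2 / 2))"
proof -
  have "char std_normal_distribution (- \<xi>) = (LINT x|lborel. std_normal_density x *\<^sub>R iexp (- \<xi> * x))"
    unfolding char_def by (subst integral_density) auto
  then have "(LINT x|lborel. std_normal_density x *\<^sub>R iexp (- \<xi> * x)) = of_real (exp (- \<xi>\<^sup>2 / 2))"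
    by (simp add: char_std_normal_distribution)
  then show ?thesis
    unfolding ft_eq_lborel[OF gauss_measurable] gauss_1
    by (subst integral_mult_right_zero[symmetric]) (simp add: scaleR_conv_of_real mult_ac)
qed

text \<open>Rescaling by \<open>c\<close> turns the wide cutoff into a peak of height
  \<open>c\<close> and width \<open>1 / c\<close>, that is, into an approximate identity.\<close>

lemma ft_gauss:
  assumes c: "c > 0"
  shows "ft (gauss c) \<xi> = of_real (c * exp (- (c * \<xi>)\<^sup>2 / 2))"
proof -
  have "ft (gauss c) \<xi> = of_real (1 / sqrt (2 * pi)) *
      (c *\<^sub>R (LINT x|lborel. exp (- (\<i> * of_real (0 + c * x) * of_real \<xi>)) * gauss c (0 + c * x)))"
    unfolding ft_eq_lborel[OF gauss_measurable]
    by (subst lborel_integral_real_affine[of c _ 0]) (use c in auto)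
  also have "\<dots> = of_real c * ft (gauss 1) (c * \<xi>)"
    unfolding ft_eq_lborel[OF gauss_measurable] using c
    by (simp add: gauss_def scaleR_conv_of_real mult_ac)
  finally show ?thesis by (simp add: ft_gauss_1)
qed

lemma ft_modulate: "ft (\<lambda>\<xi>. exp (- (\<i> * of_real x * of_real \<xi>)) * g \<xi>) y = ft g (x + y)"
proof -
  have "exp (- (\<i> * of_real \<xi> * of_real y)) * (exp (- (\<i> * of_real x * of_real \<xi>)) * g \<xi>)
      = exp (- (\<i> * of_real \<xi> * of_real (x + y))) * g \<xi>" for \<xi>
    unfolding mult.assoc[symmetric, of "exp _"] exp_add[symmetric] by (simp add: algebra_simps)
  then show ?thesis unfolding ft_def by (simp only:)
qed

lemma continuous_support_integrable:
  fixes f :: "real \<Rightarrow> complex"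
  assumes f: "continuous_on UNIV f" "\<And>x. x \<notin> {-R..R} \<Longrightarrow> f x = 0"
  shows "integrable lborel f" "\<exists>B. \<forall>x. norm (f x) \<le> B"
proof -
  have "integrable lborel (\<lambda>x. indicator {-R..R} x *\<^sub>R f x)"
    by (rule borel_integrable_compact) (use f in \<open>auto intro: continuous_on_subset\<close>)
  also have "(\<lambda>x. indicator {-R..R} x *\<^sub>R f x) = f"
    using f(2) by (auto simp: indicator_def fun_eq_iff)
  finally show "integrable lborel f" .
  have "compact (f ` {-R..R})"
    by (rule compact_continuous_image) (use f in \<open>auto intro: continuous_on_subset\<close>)
  then obtain B where B: "\<And>x. x \<in> {-R..R} \<Longrightarrow> norm (f x) \<le> B"
    by (meson bounded_iff compact_imp_bounded imageI)
  have "norm (f x) \<le> max B 0" for x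
    using B[of x] f(2)[of x] by (cases "x \<in> {-R..R}") auto
  then show "\<exists>B. \<forall>x. norm (f x) \<le> B" by blast
qed

text \<open>In the rescaled variable the Gaussian weight is fixed and only the argument of
  \<open>f\<close> moves, so one dominating function serves all \<open>n\<close>. The bound
  \<open>B\<close>, uniform in the scale, is what the outer dominated convergence needs
  later.\<close>

lemma gaussian_mean_tendsto:
  fixes f :: "real \<Rightarrow> complex"
  assumes f: "continuous_on UNIV f" and B: "\<And>x. norm (f x) \<le> B"
  shows "(\<lambda>n. of_real (1 / sqrt (2 * pi)) * (LINT w|lborel. f (x - w / real (Suc n)) * gauss 1 w)) \<longlonglongrightarrow> f x"
    and "norm (of_real (1 / sqrt (2 * pi)) * (LINT w|lborel. f (x - w / c) * gauss 1 w)) \<le> B"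
proof -
  have [measurable]: "f \<in> borel_measurable borel"
    using f by (rule borel_measurable_continuous_onI)
  have dom: "integrable lborel (\<lambda>w. B * norm (gauss 1 w))"
    using integrable_gauss[of 1] by auto
  have bound: "norm (f y * gauss 1 w) \<le> B * norm (gauss 1 w)" for y w
    unfolding norm_mult by (intro mult_right_mono B) auto
  have "(\<lambda>n. LINT w|lborel. f (x - w / real (Suc n)) * gauss 1 w) \<longlonglongrightarrow> (LINT w|lborel. f x * gauss 1 w)"
  proof (rule integral_dominated_convergence[OF _ _ dom])
    show "AE w in lborel. (\<lambda>n. f (x - w / real (Suc n)) * gauss 1 w) \<longlonglongrightarrow> f x * gauss 1 w"
    proof (intro AE_I2 tendsto_mult tendsto_const)
      fix w
      have "(\<lambda>n. x - w / real (Suc n)) \<longlonglongrightarrow> x - 0"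
        by (intro tendsto_diff tendsto_const LIMSEQ_Suc lim_const_over_n)
      then show "(\<lambda>n. f (x - w / real (Suc n))) \<longlonglongrightarrow> f x"
        using f by (intro isCont_tendsto_compose[of x f]) (auto simp: continuous_on_eq_continuous_at)
    qed
  qed (auto simp: bound)
  then have "(\<lambda>n. of_real (1 / sqrt (2 * pi)) * (LINT w|lborel. f (x - w / real (Suc n)) * gauss 1 w))
      \<longlonglongrightarrow> of_real (1 / sqrt (2 * pi)) * (LINT w|lborel. f x * gauss 1 w)"
    by (intro tendsto_intros)
  also have "of_real (1 / sqrt (2 * pi)) * (LINT w|lborel. f x * gauss 1 w) = f x"
    by (simp add: integral_gauss_1 flip: of_real_mult)
  finally show "(\<lambda>n. of_real (1 / sqrt (2 * pi)) * (LINT w|lborel. f (x - w / real (Suc n)) * gauss 1 w)) \<longlonglongrightarrow> f x" .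
  have "norm (LINT w|lborel. f (x - w / c) * gauss 1 w) \<le> (LINT w|lborel. norm (f (x - w / c) * gauss 1 w))"
    by (rule integral_norm_bound)
  also have "\<dots> \<le> (LINT w|lborel. B * norm (gauss 1 w))"
  proof (rule integral_mono[OF _ dom bound])
    show "integrable lborel (\<lambda>w. norm (f (x - w / c) * gauss 1 w))"
    proof (rule Bochner_Integration.integrable_bound[OF dom])
      show "AE w in lborel. norm (norm (f (x - w / c) * gauss 1 w)) \<le> norm (B * norm (gauss 1 w))"
        by (intro AE_I2) (use bound abs_ge_self order_trans in fastforce)
    qed measurable
  qed
  also have "\<dots> = B * sqrt (2 * pi)"
    unfolding gauss_1 by (simp add: norm_mult)
  finally show "norm (of_real (1 / sqrt (2 * pi)) * (LINT w|lborel. f (x - w / c) * gauss 1 w)) \<le> B"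
    by (simp add: norm_mult norm_divide field_simps)
qed

text \<open>The cutoff gives absolute convergence although no decay of \<open>ft f\<close> is known
  yet. As it widens, the damped integral of the squared modulus of \<open>ft f\<close> increases to
  \<open>nrm2 lebesgue (ft f)\<close> by monotone convergence, while its second form tends to the
  squared norm of \<open>f\<close> by dominated convergence.\<close>

lemma ft_isometry_continuous:
  fixes f :: "real \<Rightarrow> complex"
  assumes cont: "continuous_on UNIV f" and supp: "\<And>x. x \<notin> {-R..R} \<Longrightarrow> f x = 0"
  shows "nrm2 lebesgue (ft f) = nrm2 lebesgue f"
proof -
  obtain B where B: "\<And>x. norm (f x) \<le> B"
    using continuous_support_integrable(2)[OF assms] by blast
  have intb: "integrable lborel f" by (rule continuous_support_integrable(1)[OF assms])
  have fm [measurable]: "f \<in> borel_measurable borel"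
    using cont by (rule borel_measurable_continuous_onI)
  have fml [measurable]: "f \<in> borel_measurable lebesgue" by (rule lebesgue_measurable_of_borel) simp
  have gl [measurable]: "gauss c \<in> borel_measurable lebesgue" for c
    by (rule lebesgue_measurable_of_borel) simp
  have intf: "integrable lebesgue f" using intb by (simp add: integrable_completion)
  have intg: "integrable lebesgue (gauss c)" if "c > 0" for c
    using integrable_gauss[OF that] by (simp add: integrable_completion)
  have [measurable]: "(\<lambda>\<xi>. exp (- (\<xi> / c)\<^sup>2 / 2)) \<in> borel_measurable lebesgue" for c :: real
    by (rule lebesgue_measurable_of_borel) measurable
  \<comment> \<open>By \<open>cnj_ft\<close> the transform of \<open>k\<close> is the conjugate of
    \<open>ft f\<close>.\<close>
  define k where "k y = cnj (f (- y))" for y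
  have [measurable]: "(\<lambda>y. cnj (f y)) \<in> borel_measurable lebesgue"
    by (rule measurable_compose[OF fml borel_measurable_cnj])
  have [measurable]: "(\<lambda>y. cnj (ft f y)) \<in> borel_measurable lebesgue"
    by (rule measurable_compose[OF ft_measurable[OF fml] borel_measurable_cnj])
  have km [measurable]: "k \<in> borel_measurable borel"
    unfolding k_def by (rule measurable_compose[OF _ borel_measurable_cnj]) measurable
  have intk: "integrable lebesgue k"
    unfolding k_def using integrable_lebesgue_reflect[of "\<lambda>y. cnj (f y)"] intf by simp
  define K where "K = (LINT x|lebesgue. norm (f x))"
  have K: "norm (ft f \<xi>) \<le> K" for \<xi> unfolding K_def by (rule norm_ft_le[OF intf])
  have K0: "0 \<le> K" using norm_ge_zero[of "ft f 0"] K[of 0] by linarith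
  have B0: "0 \<le> B" using norm_ge_zero[of "f 0"] B[of 0] by linarith
  have int1: "integrable lebesgue (\<lambda>\<xi>. cnj (ft f \<xi>) * gauss c \<xi>)" if "c > 0" for c
    by (rule Bochner_Integration.integrable_bound[of _ "\<lambda>\<xi>. of_real K * gauss c \<xi>"])
       (use intg[OF that] K K0 in \<open>auto simp: norm_mult intro!: AE_I2 mult_right_mono\<close>)
  \<comment> \<open>Pairing with the modulated Gaussian shifts its transform by \<open>x\<close>;
    what results is an average of \<open>cnj f\<close> around \<open>x\<close> at scale
    \<open>1 / c\<close>.\<close>
  have inner: "ft (\<lambda>\<xi>. cnj (ft f \<xi>) * gauss c \<xi>) x
      = of_real (1 / sqrt (2 * pi)) * (LINT w|lborel. cnj (f (x - w / c)) * gauss 1 w)"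
    if c: "c > 0" for c x
  proof -
    have "(LINT \<xi>|lebesgue. exp (- (\<i> * of_real \<xi> * of_real x)) * (cnj (ft f \<xi>) * gauss c \<xi>))
        = (LINT \<xi>|lebesgue. ft k \<xi> * (exp (- (\<i> * of_real x * of_real \<xi>)) * gauss c \<xi>))"
      unfolding cnj_ft k_def by (simp add: mult_ac)
    also have "\<dots> = (LINT y|lebesgue. k y * ft (gauss c) (x + y))"
    proof (subst ft_pairing[OF intk])
      have "integrable lebesgue (\<lambda>\<xi>. exp (- (\<i> * of_real \<xi> * of_real x)) * gauss c \<xi>)"
        by (rule ft_integrable[OF intg[OF c]])
      then show "integrable lebesgue (\<lambda>\<xi>. exp (- (\<i> * of_real x * of_real \<xi>)) * gauss c \<xi>)"
        by (simp add: mult_ac)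
    qed (simp add: ft_modulate)
    also have "\<dots> = (LINT y|lborel. k y * of_real (c * exp (- (c * (x + y))\<^sup>2 / 2)))"
      unfolding ft_gauss[OF c] by (rule integral_completion) measurable
    \<comment> \<open>The substitution \<open>y = - x + w / c\<close> centres the peak. Its Jacobian
      cancels the height \<open>c\<close>, and \<open>k\<close> turns the argument into
      \<open>x - w / c\<close>.\<close>
    also have "\<dots> = (1 / c) *\<^sub>R (LINT w|lborel. k (- x + 1 / c * w) * of_real (c * exp (- (c * (x + (- x + 1 / c * w)))\<^sup>2 / 2)))"
      by (subst lborel_integral_real_affine[of "1/c" _ "-x"]) (use c in auto)
    also have "\<dots> = (1 / c) *\<^sub>R (LINT w|lborel. of_real c * (cnj (f (x - w / c)) * gauss 1 w))"
      using c by (simp add: k_def gauss_def mult_ac)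
    also have "\<dots> = (LINT w|lborel. cnj (f (x - w / c)) * gauss 1 w)"
      using c by (simp add: scaleR_conv_of_real)
    finally show ?thesis unfolding ft_def by simp
  qed
  define I where "I c = (LINT \<xi>|lebesgue. ft f \<xi> * (cnj (ft f \<xi>) * gauss c \<xi>))" for c
  have I_eq: "I c = (LINT x|lborel. f x * (of_real (1 / sqrt (2 * pi)) * (LINT w|lborel. cnj (f (x - w / c)) * gauss 1 w)))"
    if c: "c > 0" for c
  proof -
    have [measurable]: "(\<lambda>y. cnj (f y)) \<in> borel_measurable borel"
      by (rule measurable_compose[OF fm borel_measurable_cnj])
    have "I c = (LINT x|lebesgue. f x * (of_real (1 / sqrt (2 * pi)) * (LINT w|lborel. cnj (f (x - w / c)) * gauss 1 w)))"
      unfolding I_def ft_pairing[OF intf int1[OF c]] inner[OF c] ..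
    also have "\<dots> = (LINT x|lborel. f x * (of_real (1 / sqrt (2 * pi)) * (LINT w|lborel. cnj (f (x - w / c)) * gauss 1 w)))"
      by (rule integral_completion) measurable
    finally show ?thesis .
  qed
  have lim: "(\<lambda>n. I (real (Suc n))) \<longlonglongrightarrow> (LINT x|lborel. f x * cnj (f x))"
  proof -
    have [measurable]: "(\<lambda>y. cnj (f y)) \<in> borel_measurable borel"
      by (rule measurable_compose[OF fm borel_measurable_cnj])
    have cont': "continuous_on UNIV (\<lambda>x. cnj (f x))" by (intro continuous_intros cont)
    have B': "norm (cnj (f x)) \<le> B" for x using B by simp
    show ?thesis
      unfolding I_eq[OF of_nat_0_less_iff[THEN iffD2, OF zero_less_Suc]]
    proof (rule integral_dominated_convergence)
      show "integrable lborel (\<lambda>x. norm (f x) * B)" using intb by auto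
      show "AE x in lborel. (\<lambda>n. f x * (of_real (1 / sqrt (2 * pi)) *
          (LINT w|lborel. cnj (f (x - w / real (Suc n))) * gauss 1 w))) \<longlonglongrightarrow> f x * cnj (f x)"
        by (intro AE_I2 tendsto_mult tendsto_const gaussian_mean_tendsto(1)[OF cont' B'])
      show "AE x in lborel. norm (f x * (of_real (1 / sqrt (2 * pi)) *
          (LINT w|lborel. cnj (f (x - w / real (Suc n))) * gauss 1 w))) \<le> norm (f x) * B" for n
        unfolding norm_mult[of "f _"]
        by (intro AE_I2 mult_left_mono gaussian_mean_tendsto(2)[OF cont' B']) simp
    qed measurable
  qed
  have mass: "(LINT x|lborel. f x * cnj (f x)) = of_real (LINT x|lborel. (norm (f x))\<^sup>2)"
    unfolding complex_norm_square[symmetric] of_real_power[symmetric] by (rule integral_complex_of_real)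
  have J: "(\<integral>\<^sup>+\<xi>. ennreal ((norm (ft f \<xi>))\<^sup>2 * exp (- (\<xi> / c)\<^sup>2 / 2)) \<partial>lebesgue) = ennreal (Re (I c))"
    if c: "c > 0" for c
  proof -
    have eq: "ft f \<xi> * (cnj (ft f \<xi>) * gauss c \<xi>)
        = of_real ((norm (ft f \<xi>))\<^sup>2 * exp (- (\<xi> / c)\<^sup>2 / 2))" for \<xi>
      by (simp add: gauss_def complex_norm_square mult.assoc del: of_real_power)
    have i: "integrable lebesgue (\<lambda>\<xi>. ft f \<xi> * (cnj (ft f \<xi>) * gauss c \<xi>))"
      by (rule Bochner_Integration.integrable_bound[of _ "\<lambda>\<xi>. of_real K * (cnj (ft f \<xi>) * gauss c \<xi>)"])
         (use int1[OF c] K K0 in \<open>auto simp: norm_mult intro!: AE_I2 mult_right_mono\<close>)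
    then have i': "integrable lebesgue (\<lambda>\<xi>. (norm (ft f \<xi>))\<^sup>2 * exp (- (\<xi> / c)\<^sup>2 / 2))"
      unfolding eq by (simp only: complex_of_real_integrable_eq)
    have "Re (I c) = (LINT \<xi>|lebesgue. (norm (ft f \<xi>))\<^sup>2 * exp (- (\<xi> / c)\<^sup>2 / 2))"
      unfolding I_def eq integral_complex_of_real by simp
    then show ?thesis
      by (subst nn_integral_eq_integral[OF i']) auto
  qed
  have lim1: "(\<lambda>n. \<integral>\<^sup>+\<xi>. ennreal ((norm (ft f \<xi>))\<^sup>2 * exp (- (\<xi> / real (Suc n))\<^sup>2 / 2)) \<partial>lebesgue)
      \<longlonglongrightarrow> nrm2 lebesgue (ft f)"
    unfolding nrm2_def
  proof (rule nn_integral_LIMSEQ)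
    show "incseq (\<lambda>n \<xi>. ennreal ((norm (ft f \<xi>))\<^sup>2 * exp (- (\<xi> / real (Suc n))\<^sup>2 / 2)))"
    proof (intro incseq_SucI le_funI ennreal_leI mult_left_mono)
      fix n \<xi>
      have "(\<xi> / real (Suc (Suc n)))\<^sup>2 \<le> (\<xi> / real (Suc n))\<^sup>2"
        unfolding power_divide by (intro divide_left_mono power_mono) auto
      then show "exp (- (\<xi> / real (Suc n))\<^sup>2 / 2) \<le> exp (- (\<xi> / real (Suc (Suc n)))\<^sup>2 / 2)" by simp
    qed simp
    show "(\<lambda>n. ennreal ((norm (ft f \<xi>))\<^sup>2 * exp (- (\<xi> / real (Suc n))\<^sup>2 / 2)))
        \<longlonglongrightarrow> ennreal ((norm (ft f \<xi>))\<^sup>2)" for \<xi>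
    proof (rule tendsto_ennrealI)
      have "(\<lambda>n. (norm (ft f \<xi>))\<^sup>2 * exp (- (\<xi> / real (Suc n))\<^sup>2 / 2))
          \<longlonglongrightarrow> (norm (ft f \<xi>))\<^sup>2 * exp (- 0\<^sup>2 / 2)"
        by (intro tendsto_intros LIMSEQ_Suc lim_const_over_n) auto
      then show "(\<lambda>n. (norm (ft f \<xi>))\<^sup>2 * exp (- (\<xi> / real (Suc n))\<^sup>2 / 2))
          \<longlonglongrightarrow> (norm (ft f \<xi>))\<^sup>2" by simp
    qed
  qed measurable
  have lim2: "(\<lambda>n. \<integral>\<^sup>+\<xi>. ennreal ((norm (ft f \<xi>))\<^sup>2 * exp (- (\<xi> / real (Suc n))\<^sup>2 / 2)) \<partial>lebesgue)
      \<longlonglongrightarrow> ennreal (LINT x|lborel. (norm (f x))\<^sup>2)"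
    unfolding J[OF of_nat_0_less_iff[THEN iffD2, OF zero_less_Suc]]
    by (intro tendsto_ennrealI) (use tendsto_Re[OF lim] in \<open>simp add: mass\<close>)
  have "integrable lborel (\<lambda>x. (norm (f x))\<^sup>2)"
    by (rule Bochner_Integration.integrable_bound[of _ "\<lambda>x. B * f x"])
       (use intb B B0 in \<open>auto simp: power2_eq_square norm_mult intro!: AE_I2 mult_right_mono\<close>)
  then have "nrm2 lebesgue f = ennreal (LINT x|lborel. (norm (f x))\<^sup>2)"
    unfolding nrm2_def nn_integral_completion by (intro nn_integral_eq_integral) auto
  then show ?thesis using LIMSEQ_unique[OF lim1 lim2] by simp
qed

section \<open>The Plancherel theorem\<close>

lemma indicator_interval_measurable [measurable]:
  "indicator {a..b} \<in> borel_measurable (lebesgue :: real measure)"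
  by (rule lebesgue_measurable_of_borel) measurable

lemma L2_tendsto_dominated:
  assumes [measurable]: "\<And>n. g n \<in> borel_measurable M" "f \<in> borel_measurable M"
    and lim: "AE x in M. (\<lambda>n. g n x) \<longlonglongrightarrow> f x"
    and bound: "\<And>n. AE x in M. norm (g n x) \<le> w x" and w: "integrable M (\<lambda>x. (w x)\<^sup>2)"
  shows "L2_tendsto M g f" "f \<in> L2 M" "\<And>n. g n \<in> L2 M"
proof -
  have all: "AE x in M. \<forall>n. norm (g n x) \<le> w x"
    using bound by (simp add: AE_all_countable)
  have fw: "AE x in M. norm (f x) \<le> w x"
    using lim all
  proof eventually_elim
    case (elim x)
    then show ?case by (intro LIMSEQ_le_const2[OF tendsto_norm[OF elim(1)]]) auto
  qed
  have L2: "h \<in> L2 M" if [measurable]: "h \<in> borel_measurable M" and "AE x in M. norm (h x) \<le> w x" for h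
  proof -
    have "integrable M (\<lambda>x. (norm (h x))\<^sup>2)"
      by (rule Bochner_Integration.integrable_bound[OF w], measurable, use that(2) in eventually_elim)
         (auto intro: power_mono)
    then show ?thesis by (simp add: L2_def)
  qed
  show f: "f \<in> L2 M" and g: "\<And>n. g n \<in> L2 M" using L2 fw bound by auto
  have "(\<lambda>n. LINT x|M. (norm (g n x - f x))\<^sup>2) \<longlonglongrightarrow> (LINT x|M. 0)"
  proof (rule integral_dominated_convergence[where w="\<lambda>x. (2 * w x)\<^sup>2"])
    show "AE x in M. (\<lambda>n. (norm (g n x - f x))\<^sup>2) \<longlonglongrightarrow> 0"
      using lim
    proof eventually_elim
      case (elim x)
      have "(\<lambda>n. (norm (g n x - f x))\<^sup>2) \<longlonglongrightarrow> (norm (f x - f x))\<^sup>2"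
        by (intro tendsto_intros elim)
      then show ?case by simp
    qed
    show "AE x in M. norm ((norm (g n x - f x))\<^sup>2) \<le> (2 * w x)\<^sup>2" for n
      using fw bound[of n]
    proof eventually_elim
      case (elim x)
      then have "norm (g n x - f x) \<le> 2 * w x"
        using norm_triangle_ineq4[of "g n x" "f x"] by simp
      then show ?case using power_mono[of "norm (g n x - f x)" "2 * w x" 2] by simp
    qed
  qed (use w in \<open>auto simp: power_mult_distrib\<close>)
  then have "(\<lambda>n. L2_norm M (\<lambda>x. g n x - f x)) \<longlonglongrightarrow> 0"
    unfolding L2_norm_def using tendsto_real_sqrt by fastforce
  then show "L2_tendsto M g f" using L2_tendsto_iff[OF g f] by simp
qed

lemma L1_tendsto_dominated:
  fixes f :: "'a \<Rightarrow> complex"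
  assumes [measurable]: "\<And>n. g n \<in> borel_measurable M" "f \<in> borel_measurable M"
    and lim: "AE x in M. (\<lambda>n. g n x) \<longlonglongrightarrow> f x"
    and bound: "\<And>n. AE x in M. norm (g n x) \<le> w x" and w: "integrable M w"
  shows "(\<lambda>n. LINT x|M. norm (g n x - f x)) \<longlonglongrightarrow> 0" "integrable M f" "\<And>n. integrable M (g n)"
proof -
  have "integrable M f \<and> (\<forall>n. integrable M (g n))"
    using integrable_dominated_convergence[OF assms(2,1) w lim bound]
      integrable_dominated_convergence2[OF assms(2,1) w lim bound] by auto
  then show f: "integrable M f" and g: "\<And>n. integrable M (g n)" by auto
  have all: "AE x in M. \<forall>n. norm (g n x) \<le> w x"
    using bound by (simp add: AE_all_countable)
  have fw: "AE x in M. norm (f x) \<le> w x"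
    using lim all
  proof eventually_elim
    case (elim x)
    then show ?case by (intro LIMSEQ_le_const2[OF tendsto_norm[OF elim(1)]]) auto
  qed
  have "(\<lambda>n. LINT x|M. norm (g n x - f x)) \<longlonglongrightarrow> (LINT x|M. 0)"
  proof (rule integral_dominated_convergence[where w="\<lambda>x. 2 * w x"])
    show "AE x in M. (\<lambda>n. norm (g n x - f x)) \<longlonglongrightarrow> 0"
      using lim
    proof eventually_elim
      case (elim x)
      have "(\<lambda>n. norm (g n x - f x)) \<longlonglongrightarrow> norm (f x - f x)"
        by (intro tendsto_intros elim)
      then show ?case by simp
    qed
    show "AE x in M. norm (norm (g n x - f x)) \<le> 2 * w x" for n
      using fw bound[of n]
    proof eventually_elim
      case (elim x)
      then show ?case
        using norm_triangle_ineq4[of "g n x" "f x"] by simp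
    qed
  qed (use w in auto)
  then show "(\<lambda>n. LINT x|M. norm (g n x - f x)) \<longlonglongrightarrow> 0" by simp
qed

text \<open>Convergence in the mean of order one gives pointwise convergence of the transforms; the
  isometry on differences gives the Cauchy property in \<open>L2\<close>. Fatou's lemma joins the
  two, identifying the limit in mean of the transforms as \<open>ft f\<close>.\<close>

lemma ft_isometry_limit:
  assumes f: "f \<in> L2 lebesgue" "integrable lebesgue f"
    and g: "\<And>n. g n \<in> L2 lebesgue" "\<And>n. integrable lebesgue (g n)"
    and lim2: "L2_tendsto lebesgue g f"
    and lim1: "(\<lambda>n. LINT x|lebesgue. norm (g n x - f x)) \<longlonglongrightarrow> 0"
    and iso: "\<And>n. nrm2 lebesgue (ft (g n)) = nrm2 lebesgue (g n)"
      "\<And>m n. nrm2 lebesgue (ft (\<lambda>x. g m x - g n x)) = nrm2 lebesgue (\<lambda>x. g m x - g n x)"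
  shows "nrm2 lebesgue (ft f) = nrm2 lebesgue f"
proof -
  have [measurable]: "f \<in> borel_measurable lebesgue" "g n \<in> borel_measurable lebesgue" for n
    using f g by (auto simp: L2_def)
  have ptw: "(\<lambda>n. ft (g n) \<xi>) \<longlonglongrightarrow> ft f \<xi>" for \<xi>
  proof -
    have "(\<lambda>n. ft (g n) \<xi> - ft f \<xi>) \<longlonglongrightarrow> 0"
    proof (rule Lim_null_comparison[OF always_eventually lim1], intro allI)
      fix n
      show "norm (ft (g n) \<xi> - ft f \<xi>) \<le> (LINT x|lebesgue. norm (g n x - f x))"
        unfolding ft_diff[OF g(2) f(2), symmetric] by (rule norm_ft_le) (use f g in auto)
    qed
    then show ?thesis by (simp add: LIM_zero_iff)
  qed
  \<comment> \<open>Fatou's lemma in the second index \<open>m\<close>, with \<open>n\<close> fixed;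
    the isometry then transfers the estimate to the functions themselves.\<close>
  have bound: "nrm2 lebesgue (\<lambda>\<xi>. ft (g n) \<xi> - ft f \<xi>) \<le> 2 * nrm2 lebesgue (\<lambda>x. g n x - f x)" for n
  proof -
    have "nrm2 lebesgue (\<lambda>\<xi>. ft (g n) \<xi> - ft f \<xi>)
        \<le> liminf (\<lambda>m. nrm2 lebesgue (\<lambda>\<xi>. ft (g n) \<xi> - ft (g m) \<xi>))"
      by (rule nrm2_Fatou) (use ptw in \<open>auto intro!: tendsto_intros\<close>)
    also have "\<dots> = liminf (\<lambda>m. nrm2 lebesgue (\<lambda>x. g n x - g m x))"
      unfolding ft_diff[OF g(2) g(2), symmetric] iso ..
    also have "\<dots> \<le> liminf (\<lambda>m. 2 * nrm2 lebesgue (\<lambda>x. g n x - f x) + 2 * nrm2 lebesgue (\<lambda>x. g m x - f x))"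
    proof (intro Liminf_mono always_eventually allI)
      fix m
      show "nrm2 lebesgue (\<lambda>x. g n x - g m x)
          \<le> 2 * nrm2 lebesgue (\<lambda>x. g n x - f x) + 2 * nrm2 lebesgue (\<lambda>x. g m x - f x)"
        using nrm2_triangle[of "g n" lebesgue f "g m"] by (simp add: nrm2_minus_commute[of _ f])
    qed
    also have "\<dots> = 2 * nrm2 lebesgue (\<lambda>x. g n x - f x) + 2 * 0"
      by (intro lim_imp_Liminf tendsto_add tendsto_const ennreal_tendsto_cmult lim2[unfolded L2_tendsto_def]) auto
    finally show ?thesis by simp
  qed
  have gL2: "ft (g n) \<in> L2 lebesgue" for n
    using g(1)[of n] by (auto simp: L2_iff_nrm2 iso)
  \<comment> \<open>A single index suffices here: \<open>ft f\<close> is \<open>ft (g 0)\<close>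
    minus this square-integrable difference.\<close>
  have "(\<lambda>\<xi>. ft (g 0) \<xi> - ft f \<xi>) \<in> L2 lebesgue"
  proof -
    have "nrm2 lebesgue (\<lambda>x. g 0 x - f x) < \<infinity>"
      using L2_diff[OF g(1)[of 0] f(1)] by (simp add: L2_iff_nrm2)
    then show ?thesis
      using bound[of 0] by (auto simp: L2_iff_nrm2 ennreal_mult_less_top intro: le_less_trans)
  qed
  from L2_diff[OF gL2[of 0] this] have fL2: "ft f \<in> L2 lebesgue" by simp
  have lim: "L2_tendsto lebesgue (\<lambda>n. ft (g n)) (ft f)"
    unfolding L2_tendsto_def
  proof (rule tendsto_sandwich[OF _ _ tendsto_const])
    show "(\<lambda>n. 2 * nrm2 lebesgue (\<lambda>x. g n x - f x)) \<longlonglongrightarrow> 0"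
      using ennreal_tendsto_cmult[OF _ lim2[unfolded L2_tendsto_def], of 2] by simp
  qed (use bound in auto)
  have "L2_norm lebesgue (ft (g n)) = L2_norm lebesgue (g n)" for n
    using iso(1)[of n] g(1)[of n] gL2[of n] by (simp add: nrm2_eq_L2_norm)
  then have "L2_norm lebesgue (ft f) = L2_norm lebesgue f"
    using LIMSEQ_unique[OF L2_tendsto_norm[OF gL2 fL2 lim]] L2_tendsto_norm[OF g(1) f(1) lim2] by simp
  then show ?thesis using f(1) fL2 by (simp add: nrm2_eq_L2_norm)
qed

text \<open>Measurability provides continuous functions converging off a negligible set, but with no
  control of size or support. Composing with a retraction onto the ball of radius \<open>B\<close>
  and multiplying by a cutoff restores both without disturbing the limit.\<close>

lemma measurable_approx_continuous:
  fixes f :: "real \<Rightarrow> complex"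
  assumes f: "f \<in> borel_measurable lebesgue"
    and B: "\<And>x. norm (f x) \<le> B" and supp: "\<And>x. x \<notin> {-R..R} \<Longrightarrow> f x = 0"
  obtains g where "\<And>n. continuous_on UNIV (g n)" "\<And>n x. norm (g n x) \<le> B * indicator {-(R+1)..R+1} x"
    "AE x in lebesgue. (\<lambda>n. g n x) \<longlonglongrightarrow> f x"
proof (cases "B > 0")
  case False
  \<comment> \<open>The bound at a point also forces \<open>B\<close> to be nonnegative, so here
    \<open>B = 0\<close> and the zero sequence serves.\<close>
  then have "f x = 0" for x using B[of x] norm_ge_zero[of "f x"] by (metis norm_le_zero_iff not_less order_trans)
  moreover have "B = 0 \<or> B < 0" using False by auto
  moreover have "B \<ge> 0" using B[of 0] norm_ge_zero[of "f 0"] by linarith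
  ultimately show ?thesis by (intro that[of "\<lambda>_ _. 0"]) auto
next
  case True
  have "f measurable_on UNIV" by (rule lebesgue_measurable_imp_measurable_on[OF f]) simp
  then obtain N h where N: "negligible N" and h: "\<And>n. continuous_on UNIV (h n)"
    and lim: "\<And>x. x \<notin> N \<Longrightarrow> (\<lambda>n. h n x) \<longlonglongrightarrow> f x"
    unfolding measurable_on_def by auto
  \<comment> \<open>Radial retraction onto the closed ball of radius \<open>B\<close>; the maximum
    keeps the denominator away from 0. The function \<open>cut\<close> is a trapezoid falling from 1
    to 0 on the unit margins around \<open>{-R..R}\<close>, whence the radius
    \<open>R + 1\<close>.\<close>
  define clip where "clip z = (B / max B (norm z)) *\<^sub>R z" for z :: complex
  define cut where "cut x = max 0 (min 1 (R + 1 - \<bar>x\<bar>))" for x :: real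
  have clip: "norm (clip z) \<le> B" "norm z \<le> B \<Longrightarrow> clip z = z" for z
    using True by (auto simp: clip_def max_def field_simps)
  have contc: "continuous_on UNIV clip"
    unfolding clip_def using True by (intro continuous_intros) (auto simp: max_def)
  have contcut: "continuous_on UNIV cut" unfolding cut_def by (intro continuous_intros)
  have cut: "0 \<le> cut x" "cut x \<le> 1" "x \<notin> {-(R+1)..R+1} \<Longrightarrow> cut x = 0" "x \<in> {-R..R} \<Longrightarrow> cut x = 1" for x
    by (auto simp: cut_def)
  show ?thesis
  proof (rule that[of "\<lambda>n x. cut x *\<^sub>R clip (h n x)"])
    show "continuous_on UNIV (\<lambda>x. cut x *\<^sub>R clip (h n x))" for n
      by (intro continuous_intros contcut continuous_on_compose2[OF contc h]) auto
    show "norm (cut x *\<^sub>R clip (h n x)) \<le> B * indicator {-(R+1)..R+1} x" for n x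
    proof (cases "x \<in> {-(R+1)..R+1}")
      case True
      have "norm (cut x *\<^sub>R clip (h n x)) \<le> 1 * B"
        unfolding norm_scaleR by (intro mult_mono clip) (use cut[of x] in auto)
      then show ?thesis using True by simp
    qed (simp add: cut)
    have "AE x in lebesgue. x \<notin> N"
      using N by (intro AE_not_in) (simp add: negligible_iff_null_sets)
    then show "AE x in lebesgue. (\<lambda>n. cut x *\<^sub>R clip (h n x)) \<longlonglongrightarrow> f x"
    proof eventually_elim
      case (elim x)
      have "(\<lambda>n. clip (h n x)) \<longlonglongrightarrow> clip (f x)"
        using contc lim[OF elim] by (intro isCont_tendsto_compose[of "f x" clip]) (auto simp: continuous_on_eq_continuous_at)
      then have "(\<lambda>n. cut x *\<^sub>R clip (h n x)) \<longlonglongrightarrow> cut x *\<^sub>R clip (f x)"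
        by (intro tendsto_intros)
      also have "cut x *\<^sub>R clip (f x) = f x"
        using clip(2)[OF B] clip(2)[of 0] \<open>B > 0\<close> cut(4)[of x] supp[of x] by (cases "x \<in> {-R..R}") auto
      finally show ?case .
    qed
  qed
qed

text \<open>A constant on a bounded interval dominates the continuous approximants in both norms.
  Their differences are again continuous with the same bounded support, so the isometry on
  differences is available.\<close>

lemma ft_isometry_bounded:
  assumes f [measurable]: "f \<in> borel_measurable lebesgue"
    and B: "\<And>x. norm (f x) \<le> B" and supp: "\<And>x. x \<notin> {-R..R} \<Longrightarrow> f x = 0"
  shows "nrm2 lebesgue (ft f) = nrm2 lebesgue f"
proof -
  obtain g where cont: "\<And>n. continuous_on UNIV (g n)"
    and bound: "\<And>n x. norm (g n x) \<le> B * indicator {-(R+1)..R+1} x"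
    and lim: "AE x in lebesgue. (\<lambda>n. g n x) \<longlonglongrightarrow> f x"
    using measurable_approx_continuous[OF assms] by blast
  have zero: "g n x = 0" if "x \<notin> {-(R+1)..R+1}" for n x
    using bound[of n x] that by simp
  have gm: "g n \<in> borel_measurable lebesgue" for n
    by (rule lebesgue_measurable_of_borel[OF borel_measurable_continuous_onI[OF cont]])
  have ind: "integrable lebesgue (\<lambda>x. c * indicator {-(R+1)..R+1} x :: real)" for c
    by (intro integrable_mult_right integrable_real_indicator) (auto simp: emeasure_lborel_Icc_eq)
  have w1: "integrable lebesgue (\<lambda>x. B * indicator {-(R+1)..R+1} x)" by (rule ind)
  have "(\<lambda>x. (B * indicator {-(R+1)..R+1} x :: real)\<^sup>2) = (\<lambda>x. B\<^sup>2 * indicator {-(R+1)..R+1} x)"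
    by (auto simp: indicator_def)
  then have w2: "integrable lebesgue (\<lambda>x. (B * indicator {-(R+1)..R+1} x)\<^sup>2)" using ind[of "B\<^sup>2"] by simp
  note L2 = L2_tendsto_dominated[OF gm f lim AE_I2[OF bound] w2]
  note L1 = L1_tendsto_dominated[OF gm f lim AE_I2[OF bound] w1]
  show ?thesis
  proof (rule ft_isometry_limit[OF L2(2) L1(2) L2(3) L1(3) L2(1) L1(1)])
    show "nrm2 lebesgue (ft (g n)) = nrm2 lebesgue (g n)" for n
      by (rule ft_isometry_continuous[OF cont zero])
    show "nrm2 lebesgue (ft (\<lambda>x. g m x - g n x)) = nrm2 lebesgue (\<lambda>x. g m x - g n x)" for m n
      by (rule ft_isometry_continuous[of _ "R+1"]) (use cont zero in \<open>auto intro: continuous_on_diff\<close>)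
  qed
qed

text \<open>Cutting off both the argument and the values of \<open>f\<close> at \<open>n\<close>
  gives bounded functions of bounded support, dominated by \<open>norm (f x)\<close> simultaneously
  in the first and second mean.\<close>

theorem ft_isometry:
  assumes f: "f \<in> L2 lebesgue" "integrable lebesgue f"
  shows "nrm2 lebesgue (ft f) = nrm2 lebesgue f" "ft f \<in> L2 lebesgue"
proof -
  have fm [measurable]: "f \<in> borel_measurable lebesgue" using f by auto
  define g where "g n x = (if x \<in> {- real n..real n} \<and> norm (f x) \<le> real n then f x else 0)" for n x
  have [measurable]: "{- real n..real n} \<in> sets lebesgue" for n by simp
  have gm [measurable]: "g n \<in> borel_measurable lebesgue" for n
    unfolding g_def by measurable
  have bound: "norm (g n x) \<le> norm (f x)" for n x by (auto simp: g_def)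
  have lim: "(\<lambda>n. g n x) \<longlonglongrightarrow> f x" for x
  proof (rule tendsto_eventually)
    obtain N where N: "max \<bar>x\<bar> (norm (f x)) \<le> real N" using real_arch_simple by blast
    show "\<forall>\<^sub>F n in sequentially. g n x = f x"
      using eventually_ge_at_top[of N]
    proof eventually_elim
      case (elim n)
      then have "real N \<le> real n" by simp
      with N show ?case by (auto simp: g_def)
    qed
  qed
  have w2: "integrable lebesgue (\<lambda>x. (norm (f x))\<^sup>2)" using f by (simp add: L2_def)
  have w1: "integrable lebesgue (\<lambda>x. norm (f x))" using f by simp
  note L2 = L2_tendsto_dominated[OF gm fm AE_I2[OF lim] AE_I2[OF bound] w2]
  note L1 = L1_tendsto_dominated[OF gm fm AE_I2[OF lim] AE_I2[OF bound] w1]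
  show *: "nrm2 lebesgue (ft f) = nrm2 lebesgue f"
  proof (rule ft_isometry_limit[OF L2(2) L1(2) L2(3) L1(3) L2(1) L1(1)])
    show "nrm2 lebesgue (ft (g n)) = nrm2 lebesgue (g n)" for n
      by (rule ft_isometry_bounded[OF gm, of _ "real n" "real n"]) (auto simp: g_def)
    show "nrm2 lebesgue (ft (\<lambda>x. g m x - g n x)) = nrm2 lebesgue (\<lambda>x. g m x - g n x)" for m n
    proof (rule ft_isometry_bounded[of _ "real m + real n" "real (max m n)"])
      fix x
      have "norm (g k x) \<le> real k" for k by (auto simp: g_def)
      then show "norm (g m x - g n x) \<le> real m + real n"
        by (intro order_trans[OF norm_triangle_ineq4] add_mono)
    qed (measurable, auto simp: g_def)
  qed
  then show "ft f \<in> L2 lebesgue" using f by (simp add: L2_iff_nrm2)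
qed

section \<open>The Fourier transform on square-integrable functions\<close>

definition trunc :: "nat \<Rightarrow> (real \<Rightarrow> complex) \<Rightarrow> real \<Rightarrow> complex" where
  "trunc n f x = indicator {- real n..real n} x *\<^sub>R f x"

lemma L2_interval_integrable:
  fixes f :: "real \<Rightarrow> complex"
  assumes "f \<in> L2 lebesgue"
  shows "(\<lambda>x. indicator {a..b} x *\<^sub>R f x) \<in> L2 lebesgue" "integrable lebesgue (\<lambda>x. indicator {a..b} x *\<^sub>R f x)"
proof -
  have m: "indicat_real {a..b} \<in> borel_measurable (lebesgue :: real measure)"
    by (rule indicator_interval_measurable)
  have "(\<lambda>x. of_real (indicator {a..b} x) :: complex) \<in> L2 lebesgue"
  proof -
    have "integrable lebesgue (indicator {a..b} :: real \<Rightarrow> real)"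
      by (intro integrable_real_indicator) (auto simp: emeasure_lborel_Icc_eq)
    moreover have "(\<lambda>x. (norm (of_real (indicator {a..b} x) :: complex))\<^sup>2) = indicator {a..b}"
      by (auto simp: indicator_def)
    ultimately show ?thesis using m by (simp add: L2_def)
  qed
  from L2_mult_integrable(1)[OF this assms]
  show "integrable lebesgue (\<lambda>x. indicator {a..b} x *\<^sub>R f x)" by (simp add: scaleR_conv_of_real)
  have "(\<lambda>x. of_real (indicator {a..b} x) * f x) \<in> L2 lebesgue"
    by (rule L2_bounded_mult(1)[of _ _ 1, OF _ _ assms])
       (use m in \<open>auto simp: indicator_def[abs_def] intro!: borel_measurable_of_real\<close>)
  then show "(\<lambda>x. indicator {a..b} x *\<^sub>R f x) \<in> L2 lebesgue" by (simp add: scaleR_conv_of_real)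
qed

lemma trunc_L2:
  assumes "f \<in> L2 lebesgue"
  shows "trunc n f \<in> L2 lebesgue" "integrable lebesgue (trunc n f)"
  unfolding trunc_def[abs_def] by (intro L2_interval_integrable assms)+

text \<open>General endpoints are kept because the Fourier and Mellin transforms truncate along
  different sequences.\<close>

lemma L2_interval_tendsto:
  fixes a b :: "nat \<Rightarrow> real"
  assumes f: "f \<in> L2 lebesgue"
    and a: "filterlim a at_bot sequentially" and b: "filterlim b at_top sequentially"
  shows "L2_tendsto lebesgue (\<lambda>n x. indicator {a n..b n} x *\<^sub>R f x) f"
proof (rule L2_tendsto_dominated(1)[where w="\<lambda>x. norm (f x)"])
  show "AE x in lebesgue. (\<lambda>n. indicator {a n..b n} x *\<^sub>R f x) \<longlonglongrightarrow> f x"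
  proof (intro AE_I2 tendsto_eventually)
    fix x
    have "\<forall>\<^sub>F n in sequentially. a n \<le> x" "\<forall>\<^sub>F n in sequentially. x \<le> b n"
      using a b by (auto simp: filterlim_at_bot filterlim_at_top)
    then show "\<forall>\<^sub>F n in sequentially. indicator {a n..b n} x *\<^sub>R f x = f x"
      by eventually_elim simp
  qed
  show "AE x in lebesgue. norm (indicator {a n..b n} x *\<^sub>R f x) \<le> norm (f x)" for n
    by (intro AE_I2) (simp add: indicator_def)
  show "(\<lambda>x. indicator {a n..b n} x *\<^sub>R f x) \<in> borel_measurable lebesgue" for n
    using L2_interval_integrable(1)[OF f] by (simp add: L2_def)
qed (use f in \<open>auto simp: L2_def\<close>)

lemma trunc_tendsto:
  assumes "f \<in> L2 lebesgue"
  shows "L2_tendsto lebesgue (\<lambda>n. trunc n f) f"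
  unfolding trunc_def[abs_def]
  by (rule L2_interval_tendsto[OF assms])
     (auto simp: filterlim_uminus_at_bot filterlim_real_sequentially)

lemma fourier_eq_L2_lim: "fourier f = L2_lim lebesgue (\<lambda>n. ft (trunc n f))"
  unfolding fourier_def ft_def[abs_def] trunc_def[abs_def] set_lebesgue_integral_def by simp

text \<open>The values agree everywhere: the truncated integrals coincide exactly, so
  \<open>L2_lim\<close> makes its choice from one and the same sequence.\<close>

lemma fourier_cong_AE:
  assumes f: "f \<in> borel_measurable lebesgue" "g \<in> borel_measurable lebesgue" "AE x in lebesgue. f x = g x"
  shows "fourier f = fourier g"
proof -
  have "ft (trunc n f) = ft (trunc n g)" for n
  proof (rule ft_cong_AE)
    show "trunc n f \<in> borel_measurable lebesgue" "trunc n g \<in> borel_measurable lebesgue"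
      unfolding trunc_def[abs_def] using f(1,2) by (auto intro!: borel_measurable_scaleR indicator_interval_measurable)
    show "AE x in lebesgue. trunc n f x = trunc n g x"
      using f(3) by eventually_elim (simp add: trunc_def)
  qed
  then show ?thesis unfolding fourier_eq_L2_lim by simp
qed

lemma ft_diff_isometry:
  assumes "f \<in> L2 lebesgue" "integrable lebesgue f" "g \<in> L2 lebesgue" "integrable lebesgue g"
  shows "nrm2 lebesgue (\<lambda>\<xi>. ft f \<xi> - ft g \<xi>) = nrm2 lebesgue (\<lambda>x. f x - g x)"
proof -
  have "(\<lambda>\<xi>. ft f \<xi> - ft g \<xi>) = ft (\<lambda>x. f x - g x)"
    by (simp add: fun_eq_iff ft_diff[OF assms(2,4)])
  then show ?thesis
    using ft_isometry(1)[OF L2_diff[OF assms(1,3)]] assms by simp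
qed

text \<open>The isometry carries the Cauchy property from the truncations to their transforms, and
  completeness supplies the limit that the choice in \<open>fourier\<close> presupposes.\<close>

lemma fourier_trunc_tendsto:
  assumes f: "f \<in> L2 lebesgue"
  shows "fourier f \<in> L2 lebesgue" "L2_tendsto lebesgue (\<lambda>n. ft (trunc n f)) (fourier f)"
proof -
  have fm: "f \<in> borel_measurable lebesgue" "trunc n f \<in> borel_measurable lebesgue" for n
    using f trunc_L2[OF f] by (auto simp: L2_def)
  have "\<exists>g\<in>L2 lebesgue. L2_tendsto lebesgue (\<lambda>n. ft (trunc n f)) g"
  proof (rule L2_complete)
    show "ft (trunc n f) \<in> L2 lebesgue" for n by (intro ft_isometry trunc_L2 f)
    fix e :: real assume e: "e > 0"
    \<comment> \<open>The quarter offsets the two factors 2 of \<open>nrm2_triangle\<close>: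
      \<open>2 * (e/4) + 2 * (e/4) = e\<close>.\<close>
    have "\<forall>\<^sub>F n in sequentially. nrm2 lebesgue (\<lambda>x. trunc n f x - f x) < ennreal (e / 4)"
      using e by (intro order_tendstoD(2)[OF trunc_tendsto[OF f, unfolded L2_tendsto_def]]) simp
    then obtain N where N: "\<And>n. n \<ge> N \<Longrightarrow> nrm2 lebesgue (\<lambda>x. trunc n f x - f x) < ennreal (e / 4)"
      unfolding eventually_sequentially by blast
    have "nrm2 lebesgue (\<lambda>\<xi>. ft (trunc m f) \<xi> - ft (trunc n f) \<xi>) \<le> ennreal e" if "m \<ge> N" "n \<ge> N" for m n
    proof -
      have "nrm2 lebesgue (\<lambda>\<xi>. ft (trunc m f) \<xi> - ft (trunc n f) \<xi>)
          = nrm2 lebesgue (\<lambda>x. trunc m f x - trunc n f x)"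
        by (intro ft_diff_isometry trunc_L2 f)
      also have "\<dots> \<le> 2 * nrm2 lebesgue (\<lambda>x. trunc m f x - f x) + 2 * nrm2 lebesgue (\<lambda>x. trunc n f x - f x)"
        using nrm2_triangle[OF fm(2) fm(1) fm(2), of m n] by (simp add: nrm2_minus_commute[of _ f])
      also have "\<dots> \<le> 2 * ennreal (e / 4) + 2 * ennreal (e / 4)"
        using N that by (intro add_mono mult_left_mono less_imp_le) auto
      also have "\<dots> = ennreal e"
        using e by (simp flip: ennreal_plus ennreal_numeral ennreal_mult add: ennreal_mult[symmetric])
      finally show ?thesis .
    qed
    then show "\<exists>N. \<forall>m\<ge>N. \<forall>n\<ge>N. nrm2 lebesgue (\<lambda>\<xi>. ft (trunc m f) \<xi> - ft (trunc n f) \<xi>) \<le> ennreal e"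
      by blast
  qed
  then obtain g where g: "g \<in> L2 lebesgue" "L2_tendsto lebesgue (\<lambda>n. ft (trunc n f)) g" by blast
  from L2_limI[OF ft_measurable[OF fm(2)] g]
  show "fourier f \<in> L2 lebesgue" "L2_tendsto lebesgue (\<lambda>n. ft (trunc n f)) (fourier f)"
    unfolding fourier_eq_L2_lim by auto
qed

lemma fourier_measurable: "f \<in> L2 lebesgue \<Longrightarrow> fourier f \<in> borel_measurable lebesgue"
  using fourier_trunc_tendsto(1) by (auto simp: L2_def)

text \<open>Independence of the approximating sequence. By the isometry the transforms of two
  sequences with the same limit approach each other, so any integrable approximation may replace the
  symmetric truncations.\<close>

lemma ft_tendsto_fourier:
  assumes f: "f \<in> L2 lebesgue"
    and g: "\<And>n. g n \<in> L2 lebesgue" "\<And>n. integrable lebesgue (g n)" "L2_tendsto lebesgue g f"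
  shows "L2_tendsto lebesgue (\<lambda>n. ft (g n)) (fourier f)"
  unfolding L2_tendsto_def
proof (rule tendsto_sandwich[OF _ _ tendsto_const])
  have m [measurable]: "f \<in> borel_measurable lebesgue" "trunc n f \<in> borel_measurable lebesgue"
    "g n \<in> borel_measurable lebesgue" "fourier f \<in> borel_measurable lebesgue" for n
    using f trunc_L2[OF f] g fourier_measurable[OF f] by (auto simp: L2_def)
  let ?b = "\<lambda>n. 2 * (2 * nrm2 lebesgue (\<lambda>x. g n x - f x) + 2 * nrm2 lebesgue (\<lambda>x. trunc n f x - f x))
      + 2 * nrm2 lebesgue (\<lambda>\<xi>. ft (trunc n f) \<xi> - fourier f \<xi>)"
  have "nrm2 lebesgue (\<lambda>\<xi>. ft (g n) \<xi> - fourier f \<xi>) \<le> ?b n" for n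
  proof -
    have "nrm2 lebesgue (\<lambda>\<xi>. ft (g n) \<xi> - fourier f \<xi>)
        \<le> 2 * nrm2 lebesgue (\<lambda>\<xi>. ft (g n) \<xi> - ft (trunc n f) \<xi>)
          + 2 * nrm2 lebesgue (\<lambda>\<xi>. ft (trunc n f) \<xi> - fourier f \<xi>)"
      by (intro nrm2_triangle) measurable
    also have "nrm2 lebesgue (\<lambda>\<xi>. ft (g n) \<xi> - ft (trunc n f) \<xi>) = nrm2 lebesgue (\<lambda>x. g n x - trunc n f x)"
      by (intro ft_diff_isometry trunc_L2 f g)
    also have "2 * nrm2 lebesgue (\<lambda>x. g n x - trunc n f x) + 2 * nrm2 lebesgue (\<lambda>\<xi>. ft (trunc n f) \<xi> - fourier f \<xi>)
        \<le> ?b n"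
      using nrm2_triangle[OF m(3,1,2), of n n]
      by (intro add_mono mult_left_mono) (auto simp: nrm2_minus_commute[of _ f])
    finally show ?thesis .
  qed
  then show "\<forall>\<^sub>F n in sequentially. nrm2 lebesgue (\<lambda>\<xi>. ft (g n) \<xi> - fourier f \<xi>) \<le> ?b n" by auto
  have "?b \<longlonglongrightarrow> 2 * (2 * 0 + 2 * 0) + 2 * 0"
    using g(3) trunc_tendsto[OF f] fourier_trunc_tendsto(2)[OF f] unfolding L2_tendsto_def
    by (intro tendsto_add ennreal_tendsto_cmult) auto
  then show "?b \<longlonglongrightarrow> 0" by simp
qed simp

theorem fourier_isometry:
  assumes f: "f \<in> L2 lebesgue"
  shows "L2_norm lebesgue (fourier f) = L2_norm lebesgue f"
proof -
  have iso: "L2_norm lebesgue (ft (trunc n f)) = L2_norm lebesgue (trunc n f)" for n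
    using ft_isometry[OF trunc_L2[OF f], of n] trunc_L2[OF f, of n] by (simp add: nrm2_eq_L2_norm)
  have "ft (trunc n f) \<in> L2 lebesgue" for n by (intro ft_isometry trunc_L2 f)
  from L2_tendsto_norm[OF this fourier_trunc_tendsto[OF f]] L2_tendsto_norm[OF trunc_L2(1)[OF f] f trunc_tendsto[OF f]]
  show ?thesis unfolding iso by (rule LIMSEQ_unique)
qed

lemma fourier_lincomb:
  assumes f: "f \<in> L2 lebesgue" and g: "g \<in> L2 lebesgue"
  shows "AE \<xi> in lebesgue. fourier (\<lambda>x. c * f x + g x) \<xi> = c * fourier f \<xi> + fourier g \<xi>"
proof (rule L2_tendsto_unique)
  show "L2_tendsto lebesgue (\<lambda>n \<xi>. c * ft (trunc n f) \<xi> + ft (trunc n g) \<xi>) (\<lambda>\<xi>. c * fourier f \<xi> + fourier g \<xi>)"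
    by (auto intro!: L2_tendsto_lincomb L2_measurable ft_isometry trunc_L2 fourier_trunc_tendsto f g)
  have lim: "L2_tendsto lebesgue (\<lambda>n. ft (\<lambda>x. c * trunc n f x + trunc n g x)) (fourier (\<lambda>x. c * f x + g x))"
    by (rule ft_tendsto_fourier)
       (auto intro!: L2_add L2_cmult L2_tendsto_lincomb L2_measurable trunc_L2 trunc_tendsto f g)
  show "L2_tendsto lebesgue (\<lambda>n \<xi>. c * ft (trunc n f) \<xi> + ft (trunc n g) \<xi>) (fourier (\<lambda>x. c * f x + g x))"
  proof -
    have "ft (\<lambda>x. c * trunc n f x + trunc n g x) = (\<lambda>\<xi>. c * ft (trunc n f) \<xi> + ft (trunc n g) \<xi>)" for n
      by (simp add: fun_eq_iff ft_lincomb[OF trunc_L2(2)[OF f] trunc_L2(2)[OF g]])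
    then show ?thesis using lim by simp
  qed
  show "fourier (\<lambda>x. c * f x + g x) \<in> borel_measurable lebesgue"
    by (intro fourier_measurable L2_add L2_cmult f g)
qed (auto intro!: L2_measurable L2_add L2_cmult ft_isometry trunc_L2 fourier_trunc_tendsto f g)

lemma fourier_diff:
  assumes f: "f \<in> L2 lebesgue" and g: "g \<in> L2 lebesgue"
  shows "AE \<xi> in lebesgue. fourier (\<lambda>x. f x - g x) \<xi> = fourier f \<xi> - fourier g \<xi>"
  using fourier_lincomb[OF g f, of "-1"] by simp

lemma L2_norm_eq_0D:
  assumes "f \<in> L2 M" "L2_norm M f = 0"
  shows "AE x in M. f x = 0"
  using nrm2_eq_L2_norm[OF assms(1)] nrm2_eq_0_iff[OF L2_measurable[OF assms(1)]] assms(2) by simp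

lemma fourier_inj:
  assumes f: "f \<in> L2 lebesgue" and g: "g \<in> L2 lebesgue"
    and eq: "AE \<xi> in lebesgue. fourier f \<xi> = fourier g \<xi>"
  shows "AE x in lebesgue. f x = g x"
proof -
  have "AE \<xi> in lebesgue. fourier (\<lambda>x. f x - g x) \<xi> = 0"
    using eq fourier_diff[OF f g] by eventually_elim simp
  then have "L2_norm lebesgue (fourier (\<lambda>x. f x - g x)) = L2_norm lebesgue (\<lambda>_::real. 0)"
    using L2_norm_cong_AE[OF fourier_measurable[OF L2_diff[OF f g]], of "\<lambda>_. 0"] by simp
  then have "L2_norm lebesgue (\<lambda>x. f x - g x) = 0"
    unfolding fourier_isometry[OF L2_diff[OF f g]] by (simp add: L2_norm_def)
  from L2_norm_eq_0D[OF L2_diff[OF f g] this] show ?thesis by simp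
qed

section \<open>Fourier inversion and Fourier multipliers\<close>

lemma fourier_pairing:
  assumes f: "f \<in> L2 lebesgue" and g: "g \<in> L2 lebesgue"
  shows "(LINT \<xi>|lebesgue. fourier f \<xi> * g \<xi>) = (LINT x|lebesgue. f x * fourier g x)"
proof (rule LIMSEQ_unique)
  have ftL2: "ft (trunc n f) \<in> L2 lebesgue" "ft (trunc n g) \<in> L2 lebesgue" for n
    by (intro ft_isometry trunc_L2 f g)+
  show "(\<lambda>n. LINT \<xi>|lebesgue. ft (trunc n f) \<xi> * trunc n g \<xi>) \<longlonglongrightarrow> (LINT \<xi>|lebesgue. fourier f \<xi> * g \<xi>)"
    by (intro L2_tendsto_pairing ftL2 trunc_L2 fourier_trunc_tendsto trunc_tendsto f g)
  show "(\<lambda>n. LINT \<xi>|lebesgue. ft (trunc n f) \<xi> * trunc n g \<xi>) \<longlonglongrightarrow> (LINT x|lebesgue. f x * fourier g x)"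
    unfolding ft_pairing[OF trunc_L2(2)[OF f] trunc_L2(2)[OF g]]
    by (intro L2_tendsto_pairing ftL2 trunc_L2 fourier_trunc_tendsto trunc_tendsto f g)
qed

lemma nrm2_reflect:
  fixes f :: "real \<Rightarrow> complex"
  assumes "f \<in> borel_measurable lebesgue"
  shows "nrm2 lebesgue (\<lambda>x. f (- x)) = nrm2 lebesgue f"
  unfolding nrm2_def using assms nn_integral_lebesgue_reflect[of "\<lambda>x. ennreal ((norm (f x))\<^sup>2)"] by simp

lemma reflect_measurable:
  "f \<in> borel_measurable (lebesgue :: real measure) \<Longrightarrow> (\<lambda>x. f (- x)) \<in> borel_measurable lebesgue"
  by (rule measurable_compose[OF lebesgue_measurable_uminus])

lemma L2_reflect:
  fixes f :: "real \<Rightarrow> complex"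
  assumes "f \<in> L2 lebesgue"
  shows "(\<lambda>x. f (- x)) \<in> L2 lebesgue"
  using assms nrm2_reflect[of f] reflect_measurable[of f] by (simp add: L2_iff_nrm2)

lemma L2_norm_reflect:
  fixes f :: "real \<Rightarrow> complex"
  assumes "f \<in> L2 lebesgue"
  shows "L2_norm lebesgue (\<lambda>x. f (- x)) = L2_norm lebesgue f"
proof -
  have "ennreal ((L2_norm lebesgue (\<lambda>x. f (- x)))\<^sup>2) = ennreal ((L2_norm lebesgue f)\<^sup>2)"
    using nrm2_reflect[OF L2_measurable[OF assms]] L2_reflect[OF assms] assms by (simp add: nrm2_eq_L2_norm)
  then show ?thesis by simp
qed

lemma fourier_cnj_reflect:
  assumes f: "f \<in> L2 lebesgue"
  shows "AE \<xi> in lebesgue. fourier (\<lambda>x. cnj (f (- x))) \<xi> = cnj (fourier f \<xi>)"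
proof (rule L2_tendsto_unique)
  have fr: "(\<lambda>x. cnj (f (- x))) \<in> L2 lebesgue" by (intro L2_cnj L2_reflect f)
  \<comment> \<open>The truncation intervals are symmetric, hence truncation commutes with
    reflection and \<open>cnj_ft\<close> applies at each stage.\<close>
  have eq: "trunc n (\<lambda>x. cnj (f (- x))) = (\<lambda>x. cnj (trunc n f (- x)))" for n
    by (auto simp: trunc_def indicator_def fun_eq_iff)
  show "L2_tendsto lebesgue (\<lambda>n \<xi>. cnj (ft (trunc n f) \<xi>)) (fourier (\<lambda>x. cnj (f (- x))))"
    using fourier_trunc_tendsto(2)[OF fr] unfolding eq cnj_ft[symmetric] by (simp add: cnj_ft[abs_def])
  show "L2_tendsto lebesgue (\<lambda>n \<xi>. cnj (ft (trunc n f) \<xi>)) (\<lambda>\<xi>. cnj (fourier f \<xi>))"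
    using fourier_trunc_tendsto(2)[OF f] unfolding L2_tendsto_def nrm2_def
    by (simp flip: complex_cnj_diff)
  show "(\<lambda>\<xi>. cnj (ft (trunc n f) \<xi>)) \<in> borel_measurable lebesgue" for n
    by (intro L2_measurable L2_cnj ft_isometry trunc_L2 f)
  show "fourier (\<lambda>x. cnj (f (- x))) \<in> borel_measurable lebesgue" by (rule fourier_measurable[OF fr])
  show "(\<lambda>\<xi>. cnj (fourier f \<xi>)) \<in> borel_measurable lebesgue"
    by (intro L2_measurable L2_cnj fourier_trunc_tendsto f)
qed

theorem fourier_fourier:
  assumes f: "f \<in> L2 lebesgue"
  shows "AE x in lebesgue. fourier (fourier f) x = f (- x)"
proof -
  let ?F = "fourier f" and ?A = "fourier (fourier f)" and ?R = "\<lambda>x. f (- x)"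
  have L2: "?F \<in> L2 lebesgue" "?A \<in> L2 lebesgue" "?R \<in> L2 lebesgue" "(\<lambda>x. cnj (?R x)) \<in> L2 lebesgue"
    by (intro fourier_trunc_tendsto L2_reflect L2_cnj f)+
  have sq: "(LINT x|lebesgue. (norm (g x))\<^sup>2) = (L2_norm lebesgue g)\<^sup>2" for g :: "real \<Rightarrow> complex"
    by (simp add: L2_norm_def)
  \<comment> \<open>Cross term: the pairing moves one transform onto the conjugate of the reflected
    \<open>f\<close>, whose transform is the conjugate of \<open>?F\<close>. The term therefore
    equals the squared norm of \<open>?F\<close>, hence that of \<open>f\<close>, and the expanded
    square becomes one plus one minus two times this quantity.\<close>
  have "(LINT x|lebesgue. ?A x * cnj (?R x)) = (LINT x|lebesgue. ?F x * fourier (\<lambda>x. cnj (?R x)) x)"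
    by (rule fourier_pairing[OF L2(1,4)])
  also have "\<dots> = (LINT x|lebesgue. ?F x * cnj (?F x))"
  proof (rule integral_cong_AE)
    have "(\<lambda>x. cnj (?F x)) \<in> L2 lebesgue" by (rule L2_cnj[OF L2(1)])
    then show "(\<lambda>x. ?F x * cnj (?F x)) \<in> borel_measurable lebesgue"
      using L2(1) by (auto simp: L2_def)
    show "(\<lambda>x. ?F x * fourier (\<lambda>x. cnj (?R x)) x) \<in> borel_measurable lebesgue"
      using L2(1) fourier_measurable[OF L2(4)] by (auto simp: L2_def)
    show "AE x in lebesgue. ?F x * fourier (\<lambda>x. cnj (?R x)) x = ?F x * cnj (?F x)"
      using fourier_cnj_reflect[OF f] by eventually_elim simp
  qed
  also have "\<dots> = of_real (LINT x|lebesgue. (norm (?F x))\<^sup>2)"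
    unfolding complex_norm_square[symmetric] of_real_power[symmetric] by (rule integral_complex_of_real)
  also have "\<dots> = of_real ((L2_norm lebesgue f)\<^sup>2)"
    by (simp add: sq fourier_isometry[OF f])
  finally have cross: "(LINT x|lebesgue. Re (?A x * cnj (?R x))) = (L2_norm lebesgue f)\<^sup>2"
    using L2_mult_integrable(1)[OF L2(2,4)] by (subst integral_Re) auto
  have "(LINT x|lebesgue. (norm (?A x - ?R x))\<^sup>2)
      = (LINT x|lebesgue. (norm (?A x))\<^sup>2 + (norm (?R x))\<^sup>2 - 2 * Re (?A x * cnj (?R x)))"
    unfolding cmod_power2 by (simp add: power2_eq_square algebra_simps)
  also have "\<dots> = (L2_norm lebesgue ?A)\<^sup>2 + (L2_norm lebesgue ?R)\<^sup>2 - 2 * (L2_norm lebesgue f)\<^sup>2"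
  proof -
    have i: "integrable lebesgue (\<lambda>x. (norm (?A x))\<^sup>2)" "integrable lebesgue (\<lambda>x. (norm (?R x))\<^sup>2)"
      "integrable lebesgue (\<lambda>x. Re (?A x * cnj (?R x)))"
      using L2 integrable_Re[OF L2_mult_integrable(1)[OF L2(2,4)]] by (auto simp: L2_def)
    have gen: "(LINT x|lebesgue. a x + b x - 2 * c x)
        = (LINT x|lebesgue. a x) + (LINT x|lebesgue. b x) - 2 * (LINT x|lebesgue. c x)"
      if "integrable lebesgue a" "integrable lebesgue b" "integrable lebesgue c" for a b c :: "real \<Rightarrow> real"
      using that by simp
    show ?thesis
      using gen[OF i] unfolding cross by (simp only: sq)
  qed
  also have "\<dots> = 0"
    by (simp add: fourier_isometry[OF L2(1)] fourier_isometry[OF f] L2_norm_reflect[OF f])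
  finally have "L2_norm lebesgue (\<lambda>x. ?A x - ?R x) = 0" by (simp add: L2_norm_def)
  from L2_norm_eq_0D[OF L2_diff[OF L2(2,3)] this] show ?thesis by simp
qed

text \<open>The square of the transform is the reflection, so its fourth power is the identity and
  its cube yields a preimage.\<close>

lemma fourier_surj:
  assumes g: "g \<in> L2 lebesgue"
  shows "\<exists>f\<in>L2 lebesgue. AE x in lebesgue. fourier f x = g x"
proof (intro bexI)
  have L2: "fourier (fourier g) \<in> L2 lebesgue" by (intro fourier_trunc_tendsto g)
  have "AE x in lebesgue. fourier (fourier g) (- x) = g (- (- x))"
    using fourier_fourier[OF g] AE_lebesgue_reflect[of "\<lambda>x. fourier (fourier g) x = g (- x)"] by blast
  with fourier_fourier[OF L2]
  show "AE x in lebesgue. fourier (fourier (fourier (fourier g))) x = g x"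
    by eventually_elim simp
  show "fourier (fourier (fourier g)) \<in> L2 lebesgue" by (intro fourier_trunc_tendsto L2)
qed

text \<open>Surjectivity of \<open>fourier\<close> guarantees that the choice in
  \<open>L2_inv\<close> finds a preimage; this is the property by which the multiplier is used from
  here on.\<close>

lemma fourier_mult_spec:
  assumes s: "s \<in> borel_measurable lebesgue" "AE x in lebesgue. norm (s x) \<le> C" and f: "f \<in> L2 lebesgue"
  shows "fourier_mult s f \<in> L2 lebesgue"
    "AE x in lebesgue. fourier (fourier_mult s f) x = s x * fourier f x"
proof -
  have "mult_op s (fourier f) \<in> L2 lebesgue"
    unfolding mult_op_def[abs_def] by (rule L2_bounded_mult(1)[OF s fourier_trunc_tendsto(1)[OF f]])
  from fourier_surj[OF this]
  have "\<exists>g. g \<in> L2 lebesgue \<and> (AE x in lebesgue. fourier g x = mult_op s (fourier f) x)" by blast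
  then have "fourier_mult s f \<in> L2 lebesgue \<and> (AE x in lebesgue. fourier (fourier_mult s f) x = mult_op s (fourier f) x)"
    unfolding fourier_mult_def L2_inv_def by (rule someI_ex)
  then show "fourier_mult s f \<in> L2 lebesgue"
    "AE x in lebesgue. fourier (fourier_mult s f) x = s x * fourier f x"
    by (auto simp: mult_op_def)
qed

text \<open>The chosen preimages satisfy linearity only almost everywhere; it is checked after
  applying \<open>fourier\<close> and pulled back by injectivity. The isometry turns the bound of
  \<open>s\<close> into an operator bound.\<close>

lemma fourier_mult_bounded:
  assumes s: "s \<in> borel_measurable lebesgue" "AE x in lebesgue. norm (s x) \<le> C"
  shows "L2_bounded_operator lebesgue lebesgue (fourier_mult s)"
proof -
  note spec = fourier_mult_spec[OF s]
  have lin: "AE x in lebesgue. fourier_mult s (\<lambda>y. c * f y + g y) x = c * fourier_mult s f x + fourier_mult s g x"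
    if f: "f \<in> L2 lebesgue" and g: "g \<in> L2 lebesgue" for c f g
  proof (rule fourier_inj)
    have fg: "(\<lambda>y. c * f y + g y) \<in> L2 lebesgue" by (intro L2_add L2_cmult f g)
    show "fourier_mult s (\<lambda>y. c * f y + g y) \<in> L2 lebesgue" by (rule spec(1)[OF fg])
    show "(\<lambda>x. c * fourier_mult s f x + fourier_mult s g x) \<in> L2 lebesgue"
      by (intro L2_add L2_cmult spec f g)
    show "AE \<xi> in lebesgue. fourier (fourier_mult s (\<lambda>y. c * f y + g y)) \<xi>
        = fourier (\<lambda>x. c * fourier_mult s f x + fourier_mult s g x) \<xi>"
      using spec(2)[OF fg] fourier_lincomb[OF f g, of c] spec(2)[OF f] spec(2)[OF g]
        fourier_lincomb[OF spec(1)[OF f] spec(1)[OF g], of c]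
      by eventually_elim (simp add: algebra_simps)
  qed
  have zero: "(\<lambda>_. 0) \<in> L2 lebesgue" by (simp add: L2_def)
  \<comment> \<open>Additivity at two zero functions says that this image equals twice
    itself.\<close>
  have mult_zero: "AE x in lebesgue. fourier_mult s (\<lambda>_. 0) x = 0"
    using lin[OF zero zero, of 1] by simp
  \<comment> \<open>Using \<open>max C 0\<close> supplies the nonnegativity needed when square roots
    are taken.\<close>
  have bound: "L2_norm lebesgue (fourier_mult s f) \<le> max C 0 * L2_norm lebesgue f" if f: "f \<in> L2 lebesgue" for f
  proof -
    have sf: "(\<lambda>x. s x * fourier f x) \<in> L2 lebesgue"
      by (rule L2_bounded_mult(1)[OF s fourier_trunc_tendsto(1)[OF f]])
    have "ennreal ((L2_norm lebesgue (fourier_mult s f))\<^sup>2) = ennreal ((L2_norm lebesgue (fourier (fourier_mult s f)))\<^sup>2)"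
      by (simp add: fourier_isometry spec(1)[OF f])
    also have "\<dots> = nrm2 lebesgue (fourier (fourier_mult s f))"
      by (intro nrm2_eq_L2_norm[symmetric] fourier_trunc_tendsto spec f)
    also have "\<dots> = nrm2 lebesgue (\<lambda>x. s x * fourier f x)"
      by (rule nrm2_cong_AE[OF spec(2)[OF f]])
    also have "\<dots> \<le> ennreal ((max C 0)\<^sup>2) * nrm2 lebesgue (fourier f)"
    proof (rule L2_bounded_mult(2)[OF s(1)])
      show "AE x in lebesgue. norm (s x) \<le> max C 0" using s(2) by eventually_elim simp
    qed (intro fourier_trunc_tendsto f)
    also have "\<dots> = ennreal ((max C 0 * L2_norm lebesgue f)\<^sup>2)"
      using nrm2_eq_L2_norm[OF fourier_trunc_tendsto(1)[OF f]]
      by (simp add: fourier_isometry[OF f] power_mult_distrib ennreal_mult)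
    finally have "(L2_norm lebesgue (fourier_mult s f))\<^sup>2 \<le> (max C 0 * L2_norm lebesgue f)\<^sup>2"
      by simp
    then show ?thesis by (rule power2_le_imp_le) simp
  qed
  show ?thesis
    unfolding L2_bounded_operator_def
  proof (intro conjI ballI allI exI)
    show "fourier_mult s f \<in> L2 lebesgue" if "f \<in> L2 lebesgue" for f by (rule spec(1)[OF that])
    show "AE x in lebesgue. fourier_mult s (\<lambda>y. f y + g y) x = fourier_mult s f x + fourier_mult s g x"
      if "f \<in> L2 lebesgue" "g \<in> L2 lebesgue" for f g
      using lin[OF that, of 1] by simp
    show "AE x in lebesgue. fourier_mult s (\<lambda>y. c * f y) x = c * fourier_mult s f x"
      if "f \<in> L2 lebesgue" for c f
      using lin[OF that zero, of c] mult_zero by eventually_elim simp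
    show "L2_norm lebesgue (fourier_mult s f) \<le> max C 0 * L2_norm lebesgue f" if "f \<in> L2 lebesgue" for f
      by (rule bound[OF that])
  qed
qed

section \<open>The Mellin transform\<close>

lemma ln_image_eq_vimage: "A \<subseteq> {0<..} \<Longrightarrow> ln ` A = exp -` (A :: real set)"
  by (force simp: image_iff)

lemma ln_differentiable_on: "A \<subseteq> {0<..} \<Longrightarrow> ln differentiable_on (A :: real set)"
  unfolding differentiable_on_def real_differentiable_def
  by (blast intro: DERIV_ln has_field_derivative_at_within)

text \<open>Continuity alone does not control preimages of Lebesgue sets. Here they are images under
  \<open>ln\<close>, and differentiable maps of the line preserve Lebesgue measurability.\<close>

lemma exp_measurable_lebesgue_pos: "exp \<in> lebesgue \<rightarrow>\<^sub>M lebesgue_pos"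
proof (rule measurableI)
  fix A :: "real set" assume "A \<in> sets lebesgue_pos"
  then have A: "A \<in> sets lebesgue" "A \<subseteq> {0<..}" by (auto simp: sets_restrict_space)
  have "ln ` A \<in> sets lebesgue"
    by (rule differentiable_image_in_sets_lebesgue) (use A ln_differentiable_on in auto)
  then show "exp -` A \<inter> space lebesgue \<in> sets lebesgue"
    using A by (simp add: ln_image_eq_vimage)
qed simp

text \<open>The exceptional set pulls back to its image under \<open>ln\<close>, which is negligible
  because differentiable maps send negligible sets to negligible sets.\<close>

lemma AE_lebesgue_pos_exp:
  assumes "AE t in lebesgue_pos. P t"
  shows "AE y in lebesgue. P (exp y)"
proof -
  obtain N where N: "N \<in> null_sets lebesgue_pos" "{t \<in> space lebesgue_pos. \<not> P t} \<subseteq> N"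
    using assms by (auto simp: eventually_ae_filter)
  then have N': "N \<subseteq> {0<..}" "negligible N"
    by (auto simp: null_sets_restrict_space negligible_iff_null_sets)
  have "negligible (ln ` N)"
    by (rule negligible_differentiable_image_negligible) (use N' ln_differentiable_on in auto)
  then have "AE y in lebesgue. y \<notin> ln ` N"
    by (intro AE_not_in) (simp add: negligible_iff_null_sets)
  then show ?thesis
  proof eventually_elim
    case (elim y)
    show ?case
    proof (rule ccontr)
      assume "\<not> P (exp y)"
      then have "exp y \<in> N" using N(2) by auto
      then have "ln (exp y) \<in> ln ` N" by (rule imageI)
      with elim show False by simp
    qed
  qed
qed

lemma
  fixes f :: "real \<Rightarrow> 'a :: euclidean_space"
  shows integrable_lebesgue_pos_exp_iff:
      "integrable lebesgue_pos f \<longleftrightarrow> integrable lebesgue (\<lambda>y. exp y *\<^sub>R f (exp y))"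
    and integral_lebesgue_pos_exp:
      "(LINT t|lebesgue_pos. f t) = (LINT y|lebesgue. exp y *\<^sub>R f (exp y))"
proof -
  \<comment> \<open>Stated for every candidate value \<open>b\<close>, so that it provides the
    equivalence of integrability and, with \<open>b\<close> the actual integral, the equality of
    values.\<close>
  have cv: "(\<lambda>y. \<bar>exp y\<bar> *\<^sub>R f (exp y)) absolutely_integrable_on UNIV
      \<and> integral UNIV (\<lambda>y. \<bar>exp y\<bar> *\<^sub>R f (exp y)) = b
      \<longleftrightarrow> f absolutely_integrable_on exp ` UNIV \<and> integral (exp ` UNIV) f = b" for b
    by (rule has_absolute_integral_change_of_variables_real)
       (auto intro!: derivative_eq_intros inj_onI)
  have im: "range (exp :: real \<Rightarrow> real) = {0<..}"
    by (auto, metis exp_ln rangeI)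
  have pos: "integrable lebesgue_pos f \<longleftrightarrow> f absolutely_integrable_on {0<..}"
    by (subst integrable_restrict_space) (auto simp: set_integrable_def)
  have UNIV: "integrable lebesgue g \<longleftrightarrow> g absolutely_integrable_on UNIV" for g :: "real \<Rightarrow> 'a"
    by (simp add: set_integrable_def)
  show iff: "integrable lebesgue_pos f \<longleftrightarrow> integrable lebesgue (\<lambda>y. exp y *\<^sub>R f (exp y))"
    unfolding pos UNIV using cv unfolding im by auto
  show "(LINT t|lebesgue_pos. f t) = (LINT y|lebesgue. exp y *\<^sub>R f (exp y))"
  proof (cases "integrable lebesgue_pos f")
    case True
    have "(LINT t|lebesgue_pos. f t) = (LINT t:{0<..}|lebesgue. f t)"
      by (subst integral_restrict_space) (auto simp: set_lebesgue_integral_def)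
    also have "\<dots> = integral {0<..} f"
      using True unfolding pos by (rule set_lebesgue_integral_eq_integral(2))
    also have "\<dots> = integral UNIV (\<lambda>y. exp y *\<^sub>R f (exp y))"
      using cv[of "integral {0<..} f"] True pos unfolding im by simp
    also have "\<dots> = (LINT y:UNIV|lebesgue. exp y *\<^sub>R f (exp y))"
      using True unfolding iff UNIV by (rule set_lebesgue_integral_eq_integral(2)[symmetric])
    finally show ?thesis by (simp add: set_lebesgue_integral_def)
  next
    case False
    then show ?thesis using iff by (simp add: not_integrable_integral_eq)
  qed
qed

text \<open>The substitution \<open>t = exp y\<close> on the half-line; the factor
  \<open>exp (y / 2)\<close> is the square root of the Jacobian, which makes it norm
  preserving.\<close>

definition log_pullback :: "(real \<Rightarrow> complex) \<Rightarrow> real \<Rightarrow> complex" where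
  "log_pullback u y = of_real (exp (y / 2)) * u (exp y)"

lemma log_pullback_measurable:
  assumes "u \<in> borel_measurable lebesgue_pos"
  shows "log_pullback u \<in> borel_measurable lebesgue"
proof -
  have [measurable]: "(\<lambda>y. u (exp y)) \<in> borel_measurable lebesgue"
    by (rule measurable_compose[OF exp_measurable_lebesgue_pos assms])
  have [measurable]: "(\<lambda>y. complex_of_real (exp (y / 2))) \<in> borel_measurable lebesgue"
    by (rule lebesgue_measurable_of_borel) measurable
  show ?thesis unfolding log_pullback_def[abs_def] by measurable
qed

lemma norm_log_pullback_sq: "(norm (log_pullback u y))\<^sup>2 = exp y *\<^sub>R (norm (u (exp y)))\<^sup>2"
proof -
  have "(exp (y / 2))\<^sup>2 = exp y" by (simp flip: exp_double)
  then show ?thesis by (simp add: log_pullback_def norm_mult power_mult_distrib)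
qed

lemma log_pullback_L2:
  assumes u: "u \<in> L2 lebesgue_pos"
  shows "log_pullback u \<in> L2 lebesgue" "L2_norm lebesgue (log_pullback u) = L2_norm lebesgue_pos u"
    "nrm2 lebesgue (log_pullback u) = nrm2 lebesgue_pos u"
proof -
  show L2: "log_pullback u \<in> L2 lebesgue"
    using u log_pullback_measurable[of u] integrable_lebesgue_pos_exp_iff[of "\<lambda>t. (norm (u t))\<^sup>2"]
    by (simp add: L2_def norm_log_pullback_sq)
  show *: "L2_norm lebesgue (log_pullback u) = L2_norm lebesgue_pos u"
    using integral_lebesgue_pos_exp[of "\<lambda>t. (norm (u t))\<^sup>2"]
    by (simp add: L2_norm_def norm_log_pullback_sq)
  show "nrm2 lebesgue (log_pullback u) = nrm2 lebesgue_pos u"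
    using L2 u * by (simp add: nrm2_eq_L2_norm)
qed

lemma log_pullback_diff:
  "log_pullback (\<lambda>t. u t - w t) = (\<lambda>y. log_pullback u y - log_pullback w y)"
  by (simp add: log_pullback_def fun_eq_iff algebra_simps)

lemma L2_tendsto_log_pullback:
  assumes "\<And>n. F n \<in> L2 lebesgue_pos" "u \<in> L2 lebesgue_pos" "L2_tendsto lebesgue_pos F u"
  shows "L2_tendsto lebesgue (\<lambda>n. log_pullback (F n)) (log_pullback u)"
  using assms(3) log_pullback_L2(3)[OF L2_diff[OF assms(1,2)]]
  unfolding L2_tendsto_def by (simp add: log_pullback_diff)

text \<open>The Jacobian \<open>exp y\<close> and the real part \<open>-1/2\<close> of the Mellin
  exponent combine to the weight \<open>exp (y / 2)\<close> of \<open>log_pullback\<close>, leaving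
  the Fourier kernel.\<close>

lemma exp_half_kernel:
  "exp y *\<^sub>R (exp ((- 1 / 2 - \<i> * of_real x) * of_real y) * w)
    = exp (- (\<i> * of_real y * of_real x)) * (of_real (exp (y / 2)) * w)"
proof -
  have "of_real (exp y) * exp ((- 1 / 2 - \<i> * of_real x) * complex_of_real y)
      = exp (- (\<i> * of_real y * of_real x)) * of_real (exp (y / 2))"
    by (simp only: exp_of_real[symmetric] exp_add[symmetric]) (simp add: algebra_simps)
  then show ?thesis by (simp add: scaleR_conv_of_real mult.assoc[symmetric])
qed

lemma ft_log_pullback:
  "ft (log_pullback u) x = of_real (1 / sqrt (2 * pi)) *
    (LINT t|lebesgue_pos. exp ((- 1 / 2 - \<i> * of_real x) * of_real (ln t)) * u t)"
  unfolding ft_def integral_lebesgue_pos_exp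
  by (simp only: ln_exp exp_half_kernel log_pullback_def)

lemma mellin_eq_L2_lim:
  "mellin u = L2_lim lebesgue (\<lambda>n. ft (\<lambda>y. indicator {- ln (real (Suc n))..ln (real (Suc n))} y *\<^sub>R log_pullback u y))"
proof -
  have "(LINT t:{1 / real (Suc n)..real (Suc n)}|lebesgue. u t * of_real t powr (- 1 / 2 - \<i> * of_real x))
      = (LINT y|lebesgue. exp (- (\<i> * of_real y * of_real x)) *
          (indicator {- ln (real (Suc n))..ln (real (Suc n))} y *\<^sub>R log_pullback u y))" for n x
  proof -
    let ?J = "{1 / real (Suc n)..real (Suc n)}" and ?K = "{- ln (real (Suc n))..ln (real (Suc n))}"
    let ?z = "- 1 / 2 - \<i> * complex_of_real x"
    have J: "t > 0" if "t \<in> ?J" for t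
      using that by (auto intro: less_le_trans[of 0 "1 / real (Suc n)"])
    have ind: "indicat_real ?J (exp y) = indicator ?K y" for y
    proof -
      have "exp y \<in> ?J \<longleftrightarrow> y \<in> ?K"
        using ln_le_cancel_iff[of "1 / real (Suc n)" "exp y"] ln_le_cancel_iff[of "exp y" "real (Suc n)"]
        by (simp add: ln_div del: ln_le_cancel_iff)
      then show ?thesis by (simp add: indicator_def)
    qed
    \<comment> \<open>The interval lies in the positive half-line, so the indicator of
      \<open>{0<..}\<close> may be inserted; there the principal power is the exponential of
      \<open>?z\<close> times the real logarithm.\<close>
    have "(LINT t:?J|lebesgue. u t * of_real t powr ?z)
        = (LINT t|lebesgue. indicator {0<..} t *\<^sub>R (indicator ?J t *\<^sub>R (exp (?z * of_real (ln t)) * u t)))"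
      unfolding set_lebesgue_integral_def
    proof (intro Bochner_Integration.integral_cong refl)
      fix t
      show "indicat_real ?J t *\<^sub>R (u t * complex_of_real t powr ?z)
          = indicat_real {0<..} t *\<^sub>R (indicat_real ?J t *\<^sub>R (exp (?z * of_real (ln t)) * u t))"
      proof (cases "t \<in> ?J")
        case True
        with J[of t] show ?thesis by (simp add: powr_def Ln_of_real)
      qed simp
    qed
    also have "\<dots> = (LINT t|lebesgue_pos. indicator ?J t *\<^sub>R (exp (?z * of_real (ln t)) * u t))"
      by (subst integral_restrict_space) auto
    also have "\<dots> = (LINT y|lebesgue. exp y *\<^sub>R (exp (?z * of_real y) * (of_real (indicator ?K y) * u (exp y))))"
      unfolding integral_lebesgue_pos_exp ind
      by (simp add: scaleR_conv_of_real mult_ac)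
    also have "\<dots> = (LINT y|lebesgue. exp (- (\<i> * of_real y * of_real x)) * (indicator ?K y *\<^sub>R log_pullback u y))"
      unfolding exp_half_kernel by (simp add: log_pullback_def scaleR_conv_of_real mult_ac)
    finally show ?thesis .
  qed
  then show ?thesis unfolding mellin_def ft_def[abs_def] by simp
qed

text \<open>In the logarithmic variable the Mellin truncations have endpoints
  \<open>- ln (Suc n)\<close> and \<open>ln (Suc n)\<close>. They still exhaust the line, so
  \<open>ft_tendsto_fourier\<close> identifies the limit.\<close>

theorem mellin_eq_fourier:
  assumes u: "u \<in> L2 lebesgue_pos"
  shows "mellin u \<in> L2 lebesgue" "AE x in lebesgue. mellin u x = fourier (log_pullback u) x"
proof -
  let ?W = "log_pullback u"
  let ?F = "\<lambda>n y. indicator {- ln (real (Suc n))..ln (real (Suc n))} y *\<^sub>R ?W y"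
  have W: "?W \<in> L2 lebesgue" by (rule log_pullback_L2(1)[OF u])
  have F: "?F n \<in> L2 lebesgue" "integrable lebesgue (?F n)" for n
    by (intro L2_interval_integrable W)+
  have ln: "filterlim (\<lambda>n. ln (real (Suc n))) at_top sequentially"
    by (intro filterlim_compose[OF ln_at_top] filterlim_compose[OF filterlim_real_sequentially filterlim_Suc])
  have "L2_tendsto lebesgue ?F ?W"
    by (rule L2_interval_tendsto[OF W]) (use ln in \<open>auto simp: filterlim_uminus_at_bot\<close>)
  then have lim: "L2_tendsto lebesgue (\<lambda>n. ft (?F n)) (fourier ?W)"
    by (rule ft_tendsto_fourier[OF W F])
  have "ft (?F n) \<in> borel_measurable lebesgue" for n
    by (intro ft_measurable L2_measurable F)
  from L2_limI[OF this fourier_trunc_tendsto(1)[OF W] lim]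
  show "mellin u \<in> L2 lebesgue" "AE x in lebesgue. mellin u x = fourier (log_pullback u) x"
    unfolding mellin_eq_L2_lim by auto
qed

section \<open>The gamma function on the critical line\<close>

lemma Gamma_critical_line_nonzero: "Gamma (1 / 2 - \<i> * complex_of_real x) \<noteq> 0"
  and Gamma_critical_line_notin: "1 / 2 - \<i> * complex_of_real x \<notin> \<int>\<^sub>\<le>\<^sub>0"
proof -
  show *: "1 / 2 - \<i> * complex_of_real x \<notin> \<int>\<^sub>\<le>\<^sub>0"
  proof
    assume "1 / 2 - \<i> * complex_of_real x \<in> \<int>\<^sub>\<le>\<^sub>0"
    then obtain n where "1 / 2 - \<i> * complex_of_real x = - of_nat n" by (auto elim!: nonpos_Ints_cases')
    from arg_cong[OF this, of Re] show False by simp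
  qed
  then show "Gamma (1 / 2 - \<i> * complex_of_real x) \<noteq> 0" by (simp add: Gamma_eq_zero_iff)
qed

lemma Gamma_critical_line_measurable:
  "(\<lambda>x. Gamma (1 / 2 - \<i> * complex_of_real x)) \<in> borel_measurable borel"
  by (intro borel_measurable_continuous_onI continuous_on_compose2[OF continuous_on_Gamma[of "- \<int>\<^sub>\<le>\<^sub>0"]]
        continuous_intros) (auto simp: Gamma_critical_line_notin)

lemma norm_Gamma_critical_line:
  "norm (Gamma (1 / 2 - \<i> * complex_of_real x)) = sqrt pi / sqrt (cosh (pi * x))"
proof -
  let ?z = "1 / 2 - \<i> * complex_of_real x"
  \<comment> \<open>On the line with real part 1/2 conjugation is \<open>z\<close> to
    \<open>1 - z\<close>, so the squared modulus is the product in Euler's reflection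
    formula.\<close>
  have cnj: "cnj ?z = 1 - ?z" by simp
  have sin: "sin (of_real pi * ?z) = of_real (cosh (pi * x))"
  proof -
    have "sin (of_real pi * ?z) = sin (of_real pi / 2 - \<i> * of_real (pi * x))" by (simp add: algebra_simps)
    also have "\<dots> = cos (\<i> * of_real (pi * x))" by (simp add: sin_cos_eq)
    also have "\<dots> = of_real (cosh (pi * x))"
      unfolding cosh_conv_cos[symmetric] cosh_field_def
      by (simp only: of_real_minus[symmetric] exp_of_real of_real_add of_real_divide of_real_numeral)
    finally show ?thesis .
  qed
  have "of_real ((norm (Gamma ?z))\<^sup>2) = Gamma ?z * cnj (Gamma ?z)"
    by (rule complex_norm_square)
  also have "\<dots> = of_real pi / sin (of_real pi * ?z)"
    unfolding cnj_Gamma cnj by (rule Gamma_reflection_complex)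
  also have "\<dots> = of_real (pi / cosh (pi * x))" unfolding sin by simp
  finally have "(norm (Gamma ?z))\<^sup>2 = pi / cosh (pi * x)" by (simp only: of_real_eq_iff)
  then have "norm (Gamma ?z) = sqrt (pi / cosh (pi * x))" by (metis norm_ge_zero real_sqrt_unique)
  then show ?thesis by (simp add: real_sqrt_divide)
qed

text \<open>Because \<open>cosh\<close> is at least 1. This bound makes multiplication by
  \<open>v\<close>, and by the gamma factor itself, continuous in the mean.\<close>

lemma norm_Gamma_critical_line_le: "norm (Gamma (1 / 2 - \<i> * complex_of_real x)) \<le> sqrt pi"
proof -
  have "sqrt pi / sqrt (cosh (pi * x)) \<le> sqrt pi / 1"
    using cosh_real_ge_1[of "pi * x"] by (intro divide_left_mono) auto
  then show ?thesis unfolding norm_Gamma_critical_line by simp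
qed

lemma bmellin_phase_L2:
  assumes "f \<in> L2 lebesgue"
  shows "(\<lambda>x. Gamma (1 / 2 - \<i> * of_real x) / of_real (norm (Gamma (1 / 2 - \<i> * of_real x :: complex))) * f x) \<in> L2 lebesgue"
proof (rule L2_bounded_mult(1)[where C=1, OF _ _ assms])
  note [measurable] = Gamma_critical_line_measurable
  show "(\<lambda>x. Gamma (1 / 2 - \<i> * of_real x) / of_real (norm (Gamma (1 / 2 - \<i> * of_real x :: complex)))) \<in> borel_measurable lebesgue"
    by (rule lebesgue_measurable_of_borel) measurable
qed (simp add: norm_divide)

lemma bmellin_L2:
  assumes "u \<in> L2 lebesgue_pos"
  shows "bmellin u \<in> L2 lebesgue"
  unfolding bmellin_def[abs_def]
  by (intro bmellin_phase_L2 L2_reflect mellin_eq_fourier assms)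

lemma mellin_inj:
  assumes u: "u \<in> L2 lebesgue_pos" and w: "w \<in> L2 lebesgue_pos"
    and eq: "AE x in lebesgue. mellin u x = mellin w x"
  shows "AE t in lebesgue_pos. u t = w t"
proof -
  have "AE x in lebesgue. fourier (log_pullback u) x = fourier (log_pullback w) x"
    using eq mellin_eq_fourier(2)[OF u] mellin_eq_fourier(2)[OF w] by eventually_elim simp
  then have "AE y in lebesgue. log_pullback u y = log_pullback w y"
    by (rule fourier_inj[OF log_pullback_L2(1)[OF u] log_pullback_L2(1)[OF w]])
  then have "AE y in lebesgue. log_pullback (\<lambda>t. u t - w t) y = 0"
    unfolding log_pullback_diff by eventually_elim simp
  then have "nrm2 lebesgue (log_pullback (\<lambda>t. u t - w t)) = 0"
    by (subst nrm2_eq_0_iff) (auto intro!: L2_measurable log_pullback_L2 L2_diff u w)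
  then have "nrm2 lebesgue_pos (\<lambda>t. u t - w t) = 0"
    by (simp add: log_pullback_L2(3)[OF L2_diff[OF u w]])
  then show ?thesis
    by (subst (asm) nrm2_eq_0_iff) (auto intro!: L2_measurable L2_diff u w)
qed

lemma bmellin_inj:
  assumes u: "u \<in> L2 lebesgue_pos" and w: "w \<in> L2 lebesgue_pos"
    and eq: "AE x in lebesgue. bmellin u x = bmellin w x"
  shows "AE t in lebesgue_pos. u t = w t"
proof (rule mellin_inj[OF u w])
  have "AE x in lebesgue. mellin u (- x) = mellin w (- x)"
    using eq by eventually_elim (simp add: bmellin_def Gamma_critical_line_nonzero)
  then show "AE x in lebesgue. mellin u x = mellin w x"
    by (rule AE_lebesgue_reflect[THEN iffD1])
qed

section \<open>The Laplace transform\<close>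

interpretation lebesgue_pos_sf: sigma_finite_measure lebesgue_pos
  by (rule sigma_finite_measure_restrict_space[OF sigma_finite_lebesgue]) simp

interpretation lebesgue_pos_pair: pair_sigma_finite lebesgue_pos lebesgue_pos
  by unfold_locales

lemma lebesgue_pos_measurable_of_borel:
  "f \<in> borel_measurable borel \<Longrightarrow> f \<in> borel_measurable lebesgue_pos"
  by (intro measurable_restrict_space1 lebesgue_measurable_of_borel)

lemma lebesgue_pos_fst_snd_measurable [measurable]:
  "(\<lambda>p. fst p) \<in> lebesgue_pos \<Otimes>\<^sub>M N \<rightarrow>\<^sub>M borel"
  "(\<lambda>p. snd p) \<in> N \<Otimes>\<^sub>M lebesgue_pos \<rightarrow>\<^sub>M borel"
  by (rule measurable_compose[OF measurable_fst lebesgue_pos_measurable_of_borel], simp,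
      rule measurable_compose[OF measurable_snd lebesgue_pos_measurable_of_borel], simp)

text \<open>Euler's integral after \<open>t = exp y\<close>. In this form rescaling \<open>t\<close>
  is a translation of \<open>y\<close>, which is how the parameter \<open>s\<close> of the Laplace
  kernel is introduced next.\<close>

lemma Gamma_integral_exp:
  assumes z: "Re z > 0"
  shows "integrable lborel (\<lambda>y. exp (z * of_real y) * of_real (exp (- exp y)))"
    and "(LINT y|lborel. exp (z * of_real y) * of_real (exp (- exp y))) = Gamma z"
proof -
  let ?f = "\<lambda>t. complex_of_real t powr (z - 1) / of_real (exp t)"
  let ?\<phi> = "\<lambda>y. exp (z * of_real y) * complex_of_real (exp (- exp y))"
  have eq: "exp y *\<^sub>R ?f (exp y) = ?\<phi> y" for y
  proof -
    have "of_real (exp y) * complex_of_real (exp y) powr (z - 1) = exp (z * of_real y)"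
      by (simp add: powr_def Ln_of_real exp_of_real[symmetric] exp_add[symmetric] algebra_simps del: exp_of_real)
    then show ?thesis
      by (simp add: scaleR_conv_of_real exp_minus field_simps)
  qed
  have [measurable]: "?\<phi> \<in> borel_measurable borel" by measurable
  have ai: "?f absolutely_integrable_on {0<..}"
    by (rule absolutely_integrable_Gamma_integral'[OF z])
  then have i: "integrable lebesgue_pos ?f"
    by (subst integrable_restrict_space) (auto simp: set_integrable_def)
  then have "integrable lebesgue ?\<phi>"
    unfolding integrable_lebesgue_pos_exp_iff eq .
  then show "integrable lborel ?\<phi>" by (simp add: integrable_completion)
  have "(LINT y|lborel. ?\<phi> y) = (LINT y|lebesgue. ?\<phi> y)"
    by (rule integral_completion[symmetric]) measurable
  also have "\<dots> = (LINT t|lebesgue_pos. ?f t)"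
    unfolding integral_lebesgue_pos_exp eq ..
  also have "\<dots> = (LINT t:{0<..}|lebesgue. ?f t)"
    by (subst integral_restrict_space) (auto simp: set_lebesgue_integral_def)
  also have "\<dots> = integral {0<..} ?f" by (rule set_lebesgue_integral_eq_integral(2)[OF ai])
  also have "\<dots> = Gamma z" by (rule integral_unique[OF Gamma_integral_complex'[OF z]])
  finally show "(LINT y|lborel. ?\<phi> y) = Gamma z" .
qed

text \<open>Three values of \<open>z\<close> matter: \<open>1 / 2 - \<i> * x\<close> for the Mellin
  kernel, \<open>1 / 2\<close> for the Schur weight, and \<open>1\<close> for the norm of an
  exponential.\<close>

lemma Gamma_integral_laplace:
  assumes z: "Re z > 0" and s: "s > 0"
  shows "integrable lebesgue_pos (\<lambda>t. exp ((z - 1) * of_real (ln t)) * of_real (exp (- t * s)))"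
    and "(LINT t|lebesgue_pos. exp ((z - 1) * of_real (ln t)) * of_real (exp (- t * s)))
      = Gamma z * exp (- z * of_real (ln s))"
proof -
  let ?\<phi> = "\<lambda>y. exp (z * of_real y) * complex_of_real (exp (- exp y))"
  have eq: "exp y *\<^sub>R (exp ((z - 1) * of_real (ln (exp y))) * complex_of_real (exp (- exp y * s)))
      = exp (- z * of_real (ln s)) * ?\<phi> (ln s + 1 * y)" for y
  proof -
    have "of_real (exp y) * exp ((z - 1) * of_real y) = exp (- z * of_real (ln s)) * exp (z * of_real (ln s + y))"
      by (simp only: exp_of_real[symmetric] exp_add[symmetric]) (simp add: algebra_simps)
    moreover have "exp (- exp y * s) = exp (- exp (ln s + 1 * y))"
      using s by (simp add: exp_add)
    ultimately show ?thesis by (simp add: scaleR_conv_of_real mult.assoc[symmetric])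
  qed
  have m: "?\<phi> \<in> borel_measurable borel" by measurable
  have i: "integrable lborel (\<lambda>y. ?\<phi> (ln s + 1 * y))"
    by (rule lborel_integrable_real_affine[OF Gamma_integral_exp(1)[OF z]]) simp
  have m': "(\<lambda>y. ?\<phi> (ln s + 1 * y)) \<in> borel_measurable lborel" by measurable
  have i': "integrable lebesgue (\<lambda>y. ?\<phi> (ln s + 1 * y))"
    using i m' by (simp only: integrable_completion)
  show "integrable lebesgue_pos (\<lambda>t. exp ((z - 1) * of_real (ln t)) * of_real (exp (- t * s)))"
    unfolding integrable_lebesgue_pos_exp_iff eq by (rule integrable_mult_right[OF i'])
  have "(LINT y|lebesgue. ?\<phi> (ln s + 1 * y)) = (LINT y|lborel. ?\<phi> (ln s + 1 * y))"
    by (rule integral_completion[OF m'])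
  also have "\<dots> = Gamma z"
    using lborel_integral_real_affine[of 1 ?\<phi> "ln s"] Gamma_integral_exp(2)[OF z] by simp
  finally show "(LINT t|lebesgue_pos. exp ((z - 1) * of_real (ln t)) * of_real (exp (- t * s)))
      = Gamma z * exp (- z * of_real (ln s))"
    unfolding integral_lebesgue_pos_exp eq integral_mult_right_zero by (simp only: mult.commute)
qed

lemma exp_half_ln: "s > 0 \<Longrightarrow> exp (- (ln s) / 2) = 1 / sqrt s"
proof -
  assume s: "s > 0"
  have "exp (- (ln s) / 2) = sqrt (exp (- ln s))"
  proof (rule real_sqrt_unique[symmetric])
    show "(exp (- (ln s) / 2))\<^sup>2 = exp (- ln s)" by (simp flip: exp_double)
  qed simp
  also have "exp (- ln s) = 1 / s" using s by (simp add: exp_minus inverse_eq_divide)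
  finally show ?thesis by (simp add: real_sqrt_divide)
qed

lemma integral_exp_div_sqrt:
  assumes "s > 0"
  shows "integrable lebesgue_pos (\<lambda>t. exp (- t * s) / sqrt t)"
    and "(LINT t|lebesgue_pos. exp (- t * s) / sqrt t) = sqrt pi / sqrt s"
    and "(\<integral>\<^sup>+t. ennreal (exp (- t * s) / sqrt t) \<partial>lebesgue_pos) = ennreal (sqrt pi / sqrt s)"
proof -
  let ?F = "\<lambda>t. exp ((1 / 2 - 1) * complex_of_real (ln t)) * of_real (exp (- t * s))"
  have eq: "?F t = of_real (exp (- t * s) / sqrt t)" if "t > 0" for t
  proof -
    have "exp ((1 / 2 - 1) * complex_of_real (ln t)) = of_real (exp (- (ln t) / 2))"
      by (simp add: exp_of_real[symmetric] del: exp_of_real)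
    then show ?thesis using exp_half_ln[OF that] by simp
  qed
  have half: "Re (1 / 2) > 0" by simp
  have "integrable lebesgue_pos (\<lambda>t. complex_of_real (exp (- t * s) / sqrt t))
      \<longleftrightarrow> integrable lebesgue_pos ?F"
    by (rule Bochner_Integration.integrable_cong) (auto simp only: eq space_restrict_space space_completion)
  with Gamma_integral_laplace(1)[OF half assms]
  show i: "integrable lebesgue_pos (\<lambda>t. exp (- t * s) / sqrt t)"
    by (simp only: complex_of_real_integrable_eq)
  have "complex_of_real (LINT t|lebesgue_pos. exp (- t * s) / sqrt t)
      = (LINT t|lebesgue_pos. complex_of_real (exp (- t * s) / sqrt t))"
    by (rule integral_complex_of_real[symmetric])
  also have "\<dots> = (LINT t|lebesgue_pos. ?F t)"
    by (rule Bochner_Integration.integral_cong) (auto simp only: eq space_restrict_space space_completion)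
  also have "\<dots> = Gamma (1 / 2) * exp (- (1 / 2) * of_real (ln s))"
    by (rule Gamma_integral_laplace(2)[OF half assms])
  also have "exp (- (1 / 2) * of_real (ln s)) = complex_of_real (exp (- (ln s) / 2))"
    by (simp add: exp_of_real[symmetric] del: exp_of_real)
  finally have "complex_of_real (LINT t|lebesgue_pos. exp (- t * s) / sqrt t) = of_real (sqrt pi / sqrt s)"
    using exp_half_ln[OF assms] by (simp add: Gamma_one_half_complex)
  then show eq2: "(LINT t|lebesgue_pos. exp (- t * s) / sqrt t) = sqrt pi / sqrt s"
    by (simp only: of_real_eq_iff)
  show "(\<integral>\<^sup>+t. ennreal (exp (- t * s) / sqrt t) \<partial>lebesgue_pos) = ennreal (sqrt pi / sqrt s)"
    by (subst nn_integral_eq_integral[OF i]) (auto simp: eq2[simplified] intro!: AE_I2)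
qed

section \<open>Boundedness of the Laplace transform and the factorisation of the Hankel
  operator\<close>

definition laplace :: "(real \<Rightarrow> complex) \<Rightarrow> real \<Rightarrow> complex" where
  "laplace u t = (LINT s|lebesgue_pos. of_real (exp (- t * s)) * u s)"

lemma exp_L2:
  assumes "t > 0"
  shows "(\<lambda>s. complex_of_real (exp (- t * s))) \<in> L2 lebesgue_pos"
proof -
  \<comment> \<open>Euler's integral with \<open>z = 1\<close>; the parameter is
    \<open>2 * t\<close> because the exponential is squared.\<close>
  have "integrable lebesgue_pos (\<lambda>s. complex_of_real (exp (- s * (2 * t))))"
    using Gamma_integral_laplace(1)[of 1 "2 * t"] assms by simp
  then have "integrable lebesgue_pos (\<lambda>s. exp (- s * (2 * t)))"
    by (simp only: complex_of_real_integrable_eq)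
  moreover have "(\<lambda>s. (norm (complex_of_real (exp (- t * s))))\<^sup>2) = (\<lambda>s. exp (- s * (2 * t)))"
    by (simp add: fun_eq_iff flip: exp_double)
  moreover have "(\<lambda>s. complex_of_real (exp (- t * s))) \<in> borel_measurable lebesgue_pos"
    by (rule lebesgue_pos_measurable_of_borel) measurable
  ultimately show ?thesis by (simp add: L2_def)
qed

lemma laplace_integrable:
  assumes "u \<in> L2 lebesgue_pos" "t > 0"
  shows "integrable lebesgue_pos (\<lambda>s. of_real (exp (- t * s)) * u s)"
  by (rule L2_mult_integrable(1)[OF exp_L2[OF assms(2)] assms(1)])

lemma laplace_diff:
  assumes "u \<in> L2 lebesgue_pos" "w \<in> L2 lebesgue_pos" "t > 0"
  shows "laplace (\<lambda>s. u s - w s) t = laplace u t - laplace w t"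
  unfolding laplace_def right_diff_distrib
  by (intro Bochner_Integration.integral_diff laplace_integrable assms)

lemma laplace_measurable:
  assumes [measurable]: "u \<in> borel_measurable lebesgue_pos"
  shows "laplace u \<in> borel_measurable lebesgue_pos"
  unfolding laplace_def[abs_def]
proof (rule lebesgue_pos_sf.borel_measurable_lebesgue_integral)
  show "(\<lambda>(t, s). complex_of_real (exp (- t * s)) * u s) \<in> borel_measurable (lebesgue_pos \<Otimes>\<^sub>M lebesgue_pos)"
    unfolding case_prod_unfold by measurable
qed

text \<open>Schur's test with the weight \<open>1 / sqrt s\<close>, which the kernel \<open>exp (- t * s)\<close> maps to
  \<open>sqrt pi / sqrt t\<close>.\<close>

lemma laplace_nrm2_le:
  assumes u: "u \<in> L2 lebesgue_pos"
  shows "nrm2 lebesgue_pos (laplace u) \<le> ennreal pi * nrm2 lebesgue_pos u"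
proof -
  note [measurable] = L2_measurable[OF u]
  have bound: "ennreal ((norm (laplace u t))\<^sup>2)
      \<le> ennreal (sqrt pi / sqrt t) * (\<integral>\<^sup>+s. ennreal (exp (- t * s) * sqrt s * (norm (u s))\<^sup>2) \<partial>lebesgue_pos)"
    if t: "t > 0" for t
  proof -
    have [measurable]: "(\<lambda>s. exp (- t * s)) \<in> borel_measurable lebesgue_pos"
      "(\<lambda>s. sqrt s) \<in> borel_measurable lebesgue_pos"
      by (rule lebesgue_pos_measurable_of_borel, measurable)+
    \<comment> \<open>The kernel is split evenly, with the weight \<open>1 / sqrt s\<close> in the
      first factor and its inverse in the second. Cauchy-Schwarz then turns the first into
      \<open>sqrt pi / sqrt t\<close>.\<close>
    let ?f = "\<lambda>s. ennreal (sqrt (exp (- t * s) / sqrt s))"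
    let ?g = "\<lambda>s. ennreal (sqrt (exp (- t * s) * sqrt s) * norm (u s))"
    have "ennreal (norm (laplace u t)) \<le> (\<integral>\<^sup>+s. ennreal (norm (of_real (exp (- t * s)) * u s)) \<partial>lebesgue_pos)"
      unfolding laplace_def by (rule integral_norm_bound_ennreal[OF laplace_integrable[OF u t]])
    also have "\<dots> = (\<integral>\<^sup>+s. ?f s * ?g s \<partial>lebesgue_pos)"
    proof (rule nn_integral_cong)
      fix s :: real assume "s \<in> space lebesgue_pos"
      then have s: "s > 0" by simp
      have "sqrt (exp (- t * s) / sqrt s) * (sqrt (exp (- t * s) * sqrt s) * norm (u s)) = exp (- t * s) * norm (u s)"
      proof -
        have "sqrt (exp (- t * s) / sqrt s) * sqrt (exp (- t * s) * sqrt s) = exp (- t * s)"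
          using s by (simp add: real_sqrt_mult[symmetric] field_simps)
        then show ?thesis by (simp add: mult.assoc[symmetric])
      qed
      then show "ennreal (norm (of_real (exp (- t * s)) * u s)) = ?f s * ?g s"
        using s by (auto simp: ennreal_mult[symmetric] norm_mult)
    qed
    finally have "(ennreal (norm (laplace u t)))\<^sup>2 \<le> (\<integral>\<^sup>+s. ?f s * ?g s \<partial>lebesgue_pos)\<^sup>2"
      by (intro power_mono) auto
    also have "\<dots> \<le> (\<integral>\<^sup>+s. (?f s)\<^sup>2 \<partial>lebesgue_pos) * (\<integral>\<^sup>+s. (?g s)\<^sup>2 \<partial>lebesgue_pos)"
      by (rule Cauchy_Schwarz_nn_integral) measurable
    also have "(\<integral>\<^sup>+s. (?f s)\<^sup>2 \<partial>lebesgue_pos) = (\<integral>\<^sup>+s. ennreal (exp (- s * t) / sqrt s) \<partial>lebesgue_pos)"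
      by (intro nn_integral_cong) (auto simp: ennreal_power mult.commute)
    also have "\<dots> = ennreal (sqrt pi / sqrt t)" by (rule integral_exp_div_sqrt(3)[OF t])
    also have "(\<integral>\<^sup>+s. (?g s)\<^sup>2 \<partial>lebesgue_pos) = (\<integral>\<^sup>+s. ennreal (exp (- t * s) * sqrt s * (norm (u s))\<^sup>2) \<partial>lebesgue_pos)"
      by (intro nn_integral_cong) (auto simp: ennreal_power power_mult_distrib)
    finally show ?thesis by (simp add: ennreal_power)
  qed
  have "nrm2 lebesgue_pos (laplace u)
      \<le> (\<integral>\<^sup>+t. ennreal (sqrt pi / sqrt t) * (\<integral>\<^sup>+s. ennreal (exp (- t * s) * sqrt s * (norm (u s))\<^sup>2) \<partial>lebesgue_pos) \<partial>lebesgue_pos)"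
    unfolding nrm2_def by (intro nn_integral_mono bound) simp
  also have "\<dots> = (\<integral>\<^sup>+t. (\<integral>\<^sup>+s. ennreal (sqrt pi / sqrt t) * ennreal (exp (- t * s) * sqrt s * (norm (u s))\<^sup>2) \<partial>lebesgue_pos) \<partial>lebesgue_pos)"
  proof (intro nn_integral_cong nn_integral_cmult[symmetric])
    fix t :: real
    have [measurable]: "(\<lambda>s. exp (- t * s)) \<in> borel_measurable lebesgue_pos"
      "(\<lambda>s. sqrt s) \<in> borel_measurable lebesgue_pos"
      by (rule lebesgue_pos_measurable_of_borel, measurable)+
    show "(\<lambda>s. ennreal (exp (- t * s) * sqrt s * (norm (u s))\<^sup>2)) \<in> borel_measurable lebesgue_pos"
      by measurable
  qed
  also have "\<dots> = (\<integral>\<^sup>+s. (\<integral>\<^sup>+t. ennreal (sqrt pi / sqrt t) * ennreal (exp (- t * s) * sqrt s * (norm (u s))\<^sup>2) \<partial>lebesgue_pos) \<partial>lebesgue_pos)"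
    by (rule lebesgue_pos_pair.Fubini'[symmetric]) (simp only: case_prod_unfold, measurable)
  also have "\<dots> = (\<integral>\<^sup>+s. ennreal pi * ennreal ((norm (u s))\<^sup>2) \<partial>lebesgue_pos)"
  proof (rule nn_integral_cong)
    fix s :: real assume "s \<in> space lebesgue_pos"
    then have s: "s > 0" by simp
    have [measurable]: "(\<lambda>t. exp (- t * s)) \<in> borel_measurable lebesgue_pos"
      "(\<lambda>s. sqrt s) \<in> borel_measurable lebesgue_pos"
      by (rule lebesgue_pos_measurable_of_borel, measurable)+
    \<comment> \<open>The weight is integrated a second time, now in \<open>t\<close>: this gives
      another \<open>sqrt pi / sqrt s\<close>, which cancels \<open>sqrt s\<close> and leaves the
      constant \<open>pi\<close>.\<close>
    have "(\<integral>\<^sup>+t. ennreal (sqrt pi / sqrt t) * ennreal (exp (- t * s) * sqrt s * (norm (u s))\<^sup>2) \<partial>lebesgue_pos)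
        = (\<integral>\<^sup>+t. ennreal (sqrt pi * sqrt s * (norm (u s))\<^sup>2) * ennreal (exp (- t * s) / sqrt t) \<partial>lebesgue_pos)"
      using s by (intro nn_integral_cong) (simp add: ennreal_mult[symmetric] mult_ac)
    also have "\<dots> = ennreal (sqrt pi * sqrt s * (norm (u s))\<^sup>2) * ennreal (sqrt pi / sqrt s)"
      by (subst nn_integral_cmult) (measurable, simp only: integral_exp_div_sqrt(3)[OF s])
    also have "\<dots> = ennreal (sqrt pi * sqrt s * (norm (u s))\<^sup>2 * (sqrt pi / sqrt s))"
      using s by (intro ennreal_mult[symmetric]) auto
    also have "sqrt pi * sqrt s * (norm (u s))\<^sup>2 * (sqrt pi / sqrt s) = pi * (norm (u s))\<^sup>2"
      using s by simp
    finally show "(\<integral>\<^sup>+t. ennreal (sqrt pi / sqrt t) * ennreal (exp (- t * s) * sqrt s * (norm (u s))\<^sup>2) \<partial>lebesgue_pos)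
        = ennreal pi * ennreal ((norm (u s))\<^sup>2)" by (simp add: ennreal_mult)
  qed
  also have "\<dots> = ennreal pi * nrm2 lebesgue_pos u"
    unfolding nrm2_def by (rule nn_integral_cmult) measurable
  finally show ?thesis .
qed

lemma laplace_L2:
  assumes u: "u \<in> L2 lebesgue_pos"
  shows "laplace u \<in> L2 lebesgue_pos"
proof -
  have "nrm2 lebesgue_pos u < \<infinity>" using u by (simp add: L2_iff_nrm2)
  then have "ennreal pi * nrm2 lebesgue_pos u < \<infinity>" by (simp add: ennreal_mult_less_top)
  then show ?thesis
    using u laplace_nrm2_le[OF u] laplace_measurable[OF L2_measurable[OF u]]
    by (auto simp: L2_iff_nrm2 intro: le_less_trans)
qed

lemma L2_tendsto_laplace:
  assumes F: "\<And>n. F n \<in> L2 lebesgue_pos" and u: "u \<in> L2 lebesgue_pos" "L2_tendsto lebesgue_pos F u"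
  shows "L2_tendsto lebesgue_pos (\<lambda>n. laplace (F n)) (laplace u)"
  unfolding L2_tendsto_def
proof (rule tendsto_sandwich[OF _ _ tendsto_const])
  have "nrm2 lebesgue_pos (\<lambda>t. laplace (F n) t - laplace u t) \<le> ennreal pi * nrm2 lebesgue_pos (\<lambda>x. F n x - u x)" for n
  proof -
    have "nrm2 lebesgue_pos (\<lambda>t. laplace (F n) t - laplace u t) = nrm2 lebesgue_pos (laplace (\<lambda>x. F n x - u x))"
      by (intro nrm2_cong_AE AE_I2) (simp add: laplace_diff[OF F u(1)])
    also have "\<dots> \<le> ennreal pi * nrm2 lebesgue_pos (\<lambda>x. F n x - u x)"
      by (intro laplace_nrm2_le L2_diff F u)
    finally show ?thesis .
  qed
  then show "\<forall>\<^sub>F n in sequentially. nrm2 lebesgue_pos (\<lambda>t. laplace (F n) t - laplace u t)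
      \<le> ennreal pi * nrm2 lebesgue_pos (\<lambda>x. F n x - u x)" by auto
  show "(\<lambda>n. ennreal pi * nrm2 lebesgue_pos (\<lambda>x. F n x - u x)) \<longlonglongrightarrow> 0"
    using ennreal_tendsto_cmult[OF _ u(2)[unfolded L2_tendsto_def], of "ennreal pi"] by simp
qed simp

text \<open>Insert the integral for \<open>h (t + s)\<close> and split the exponential. The double
  integral converges absolutely, since \<open>exp (- t * l)\<close> is square integrable in
  \<open>l\<close>, \<open>\<sigma>\<close> is bounded and the Laplace transform of the modulus of
  \<open>u\<close> is square integrable. Hence the identity holds at every
  \<open>t > 0\<close>.\<close>

lemma hankel_eq_laplace:
  assumes \<sigma>: "\<sigma> \<in> borel_measurable lebesgue_pos" "AE l in lebesgue_pos. norm (\<sigma> l) \<le> C"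
    and h: "\<And>t. t > 0 \<Longrightarrow> h t = laplace \<sigma> t"
    and u: "u \<in> L2 lebesgue_pos" and t: "t > 0"
  shows "hankel h u t = laplace (\<lambda>l. \<sigma> l * laplace u l) t"
proof -
  let ?E = "\<lambda>t s. complex_of_real (exp (- t * s))"
  let ?f = "\<lambda>l s. ?E t l * \<sigma> l * (?E l s * u s)"
  note [measurable] = \<sigma>(1) L2_measurable[OF u]
  have nu: "(\<lambda>s. complex_of_real (norm (u s))) \<in> L2 lebesgue_pos"
    using u by (simp add: L2_def)
  have int: "integrable (lebesgue_pos \<Otimes>\<^sub>M lebesgue_pos) (\<lambda>(l, s). ?f l s)"
  proof (rule lebesgue_pos_pair.Fubini_integrable)
    show "(\<lambda>(l, s). ?f l s) \<in> borel_measurable (lebesgue_pos \<Otimes>\<^sub>M lebesgue_pos)"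
      unfolding case_prod_unfold by measurable
    have "integrable lebesgue_pos (\<lambda>l. ?E t l * (\<sigma> l * laplace (\<lambda>s. of_real (norm (u s))) l))"
      by (intro laplace_integrable L2_bounded_mult(1)[OF \<sigma>] laplace_L2 nu t)
    then have "integrable lebesgue_pos (\<lambda>l. norm (?E t l * (\<sigma> l * laplace (\<lambda>s. of_real (norm (u s))) l)))"
      by (rule integrable_norm)
    also have "(\<lambda>l. norm (?E t l * (\<sigma> l * laplace (\<lambda>s. of_real (norm (u s))) l)))
        = (\<lambda>l. LINT s|lebesgue_pos. norm (case (l, s) of (l, s) \<Rightarrow> ?f l s))"
    proof
      fix l
      have "laplace (\<lambda>s. of_real (norm (u s))) l = of_real (LINT s|lebesgue_pos. exp (- l * s) * norm (u s))"
        unfolding laplace_def of_real_mult[symmetric] by (rule integral_complex_of_real)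
      moreover have "(LINT s|lebesgue_pos. exp (- l * s) * norm (u s)) \<ge> 0" by simp
      ultimately have "norm (laplace (\<lambda>s. of_real (norm (u s))) l) = (LINT s|lebesgue_pos. exp (- l * s) * norm (u s))"
        by (simp only: norm_of_real abs_of_nonneg)
      then show "norm (?E t l * (\<sigma> l * laplace (\<lambda>s. of_real (norm (u s))) l))
          = (LINT s|lebesgue_pos. norm (case (l, s) of (l, s) \<Rightarrow> ?f l s))"
        by (simp add: norm_mult)
    qed
    finally show "integrable lebesgue_pos (\<lambda>l. LINT s|lebesgue_pos. norm (case (l, s) of (l, s) \<Rightarrow> ?f l s))" .
    show "AE l in lebesgue_pos. integrable lebesgue_pos (\<lambda>s. case (l, s) of (l, s) \<Rightarrow> ?f l s)"
    proof (rule AE_I2)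
      fix l :: real assume "l \<in> space lebesgue_pos"
      then have "integrable lebesgue_pos (\<lambda>s. ?E l s * u s)" by (intro laplace_integrable u) simp
      then show "integrable lebesgue_pos (\<lambda>s. case (l, s) of (l, s) \<Rightarrow> ?f l s)"
        unfolding prod.case by (rule integrable_mult_right)
    qed
  qed
  have "hankel h u t = (LINT s|lebesgue_pos. (LINT l|lebesgue_pos. ?f l s))"
    unfolding hankel_def
  proof (rule Bochner_Integration.integral_cong)
    fix s :: real assume "s \<in> space lebesgue_pos"
    then have "h (t + s) * u s = (LINT l|lebesgue_pos. ?E (t + s) l * \<sigma> l * u s)"
      using t by (simp add: h laplace_def)
    also have "\<dots> = (LINT l|lebesgue_pos. ?f l s)"
    proof (rule Bochner_Integration.integral_cong[OF refl])
      fix l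
      have "?E (t + s) l = ?E t l * ?E l s"
        by (simp only: of_real_mult[symmetric] exp_add[symmetric]) (simp add: algebra_simps)
      then show "?E (t + s) l * \<sigma> l * u s = ?f l s" by (simp only: mult_ac)
    qed
    finally show "h (t + s) * u s = (LINT l|lebesgue_pos. ?f l s)" .
  qed simp
  also have "\<dots> = (LINT l|lebesgue_pos. (LINT s|lebesgue_pos. ?f l s))"
    by (rule lebesgue_pos_pair.Fubini_integral[OF int])
  also have "\<dots> = laplace (\<lambda>l. \<sigma> l * laplace u l) t"
    unfolding laplace_def integral_mult_right_zero by (simp only: mult.assoc)
  finally show ?thesis .
qed

text \<open>Interchange the integrals and apply Euler's integral in \<open>t\<close>. It leaves
  \<open>s\<close> to the power \<open>- 1/2 + \<i> * x\<close>, the Mellin kernel at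
  \<open>- x\<close>, whence the reflection. In modulus the inner integral is
  \<open>sqrt pi / sqrt s\<close>, so Fubini requires precisely the integrability of
  \<open>log_pullback u\<close>.\<close>

lemma ft_log_pullback_laplace:
  assumes u: "u \<in> L2 lebesgue_pos" and iu: "integrable lebesgue (log_pullback u)"
  shows "integrable lebesgue (log_pullback (laplace u))"
    and "ft (log_pullback (laplace u)) x = Gamma (1 / 2 - \<i> * of_real x) * ft (log_pullback u) (- x)"
proof -
  let ?E = "\<lambda>t s. complex_of_real (exp (- t * s))"
  let ?P = "\<lambda>x t. exp ((- 1 / 2 - \<i> * complex_of_real x) * of_real (ln t))"
  note [measurable] = L2_measurable[OF u]
  have normP: "norm (?P x t) = 1 / sqrt t" if "t > 0" for x t
    using exp_half_ln[OF that] by simp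
  have iu': "integrable lebesgue_pos (\<lambda>s. ?P 0 s * u s)"
    unfolding integrable_lebesgue_pos_exp_iff ln_exp exp_half_kernel using iu
    by (simp add: log_pullback_def[abs_def])
  have int: "integrable (lebesgue_pos \<Otimes>\<^sub>M lebesgue_pos) (\<lambda>(s, t). ?P x t * (?E t s * u s))" for x
  proof (rule lebesgue_pos_pair.Fubini_integrable)
    show "(\<lambda>(s, t). ?P x t * (?E t s * u s)) \<in> borel_measurable (lebesgue_pos \<Otimes>\<^sub>M lebesgue_pos)"
      unfolding case_prod_unfold by measurable
    have nrm: "norm (?P x t * (?E t s * u s)) = norm (u s) * (exp (- t * s) / sqrt t)" if "t > 0" for s t
      using normP[OF that, of x] by (simp add: norm_mult)
    have inner: "(LINT t|lebesgue_pos. norm (?P x t * (?E t s * u s))) = sqrt pi * norm (?P 0 s * u s)"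
      if s: "s > 0" for s
    proof -
      have "(LINT t|lebesgue_pos. norm (?P x t * (?E t s * u s)))
          = (LINT t|lebesgue_pos. norm (u s) * (exp (- t * s) / sqrt t))"
        by (intro Bochner_Integration.integral_cong refl nrm) simp
      also have "\<dots> = norm (u s) * (sqrt pi / sqrt s)"
        unfolding integral_mult_right_zero integral_exp_div_sqrt(2)[OF s] ..
      also have "\<dots> = sqrt pi * norm (?P 0 s * u s)"
        unfolding norm_mult normP[OF s] by simp
      finally show ?thesis .
    qed
    have "integrable lebesgue_pos (\<lambda>s. sqrt pi * norm (?P 0 s * u s))"
      using iu' by (intro integrable_mult_right integrable_norm)
    also have "integrable lebesgue_pos (\<lambda>s. sqrt pi * norm (?P 0 s * u s))
      \<longleftrightarrow> integrable lebesgue_pos (\<lambda>s. LINT t|lebesgue_pos. norm (case (s, t) of (s, t) \<Rightarrow> ?P x t * (?E t s * u s)))"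
      by (rule Bochner_Integration.integrable_cong[OF refl]) (unfold prod.case, rule inner[symmetric], simp)
    finally show "integrable lebesgue_pos (\<lambda>s. LINT t|lebesgue_pos. norm (case (s, t) of (s, t) \<Rightarrow> ?P x t * (?E t s * u s)))" .
    show "AE s in lebesgue_pos. integrable lebesgue_pos (\<lambda>t. case (s, t) of (s, t) \<Rightarrow> ?P x t * (?E t s * u s))"
    proof (rule AE_I2)
      fix s :: real assume "s \<in> space lebesgue_pos"
      then have "integrable lebesgue_pos (\<lambda>t. exp ((1 / 2 - \<i> * of_real x - 1) * of_real (ln t)) * ?E t s * u s)"
        by (intro integrable_mult_left Gamma_integral_laplace) auto
      then show "integrable lebesgue_pos (\<lambda>t. case (s, t) of (s, t) \<Rightarrow> ?P x t * (?E t s * u s))"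
        unfolding prod.case mult.assoc by simp
    qed
  qed
  have lap: "(LINT s|lebesgue_pos. ?P x t * (?E t s * u s)) = ?P x t * laplace u t" for x t
    unfolding laplace_def by (rule integral_mult_right_zero)
  \<comment> \<open>The other marginal of the same double integral at \<open>x = 0\<close>, where
    the oscillating factor is 1 and the integrand pulls back to
    \<open>log_pullback (laplace u)\<close>.\<close>
  have "integrable lebesgue_pos (\<lambda>t. ?P 0 t * laplace u t)"
    using lebesgue_pos_pair.integrable_snd[OF int[of 0]] unfolding lap .
  then show "integrable lebesgue (log_pullback (laplace u))"
    unfolding integrable_lebesgue_pos_exp_iff ln_exp exp_half_kernel
    by (simp add: log_pullback_def[abs_def])
  have "ft (log_pullback (laplace u)) x
      = of_real (1 / sqrt (2 * pi)) * (LINT t|lebesgue_pos. LINT s|lebesgue_pos. ?P x t * (?E t s * u s))"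
    unfolding ft_log_pullback lap ..
  also have "(LINT t|lebesgue_pos. LINT s|lebesgue_pos. ?P x t * (?E t s * u s))
      = (LINT s|lebesgue_pos. LINT t|lebesgue_pos. ?P x t * (?E t s * u s))"
    by (rule lebesgue_pos_pair.Fubini_integral[OF int])
  also have "\<dots> = (LINT s|lebesgue_pos. Gamma (1 / 2 - \<i> * of_real x) * (?P (- x) s * u s))"
  proof (rule Bochner_Integration.integral_cong[OF refl])
    fix s :: real assume "s \<in> space lebesgue_pos"
    then have s: "s > 0" by simp
    have "(LINT t|lebesgue_pos. ?P x t * (?E t s * u s))
        = (LINT t|lebesgue_pos. exp ((1 / 2 - \<i> * of_real x - 1) * of_real (ln t)) * ?E t s) * u s"
      unfolding integral_mult_left_zero[symmetric] mult.assoc by simp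
    also have "\<dots> = Gamma (1 / 2 - \<i> * of_real x) * exp (- (1 / 2 - \<i> * of_real x) * of_real (ln s)) * u s"
      by (subst Gamma_integral_laplace(2)[OF _ s]) auto
    also have "\<dots> = Gamma (1 / 2 - \<i> * of_real x) * (?P (- x) s * u s)"
      by (simp add: mult.assoc)
    finally show "(LINT t|lebesgue_pos. ?P x t * (?E t s * u s))
        = Gamma (1 / 2 - \<i> * of_real x) * (?P (- x) s * u s)" .
  qed
  finally show "ft (log_pullback (laplace u)) x = Gamma (1 / 2 - \<i> * of_real x) * ft (log_pullback u) (- x)"
    unfolding ft_log_pullback integral_mult_right_zero by (simp only: mult_ac)
qed

lemma L2_tendsto_reflect:
  fixes f :: "real \<Rightarrow> complex"
  assumes "\<And>n. F n \<in> L2 lebesgue" "f \<in> L2 lebesgue" "L2_tendsto lebesgue F f"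
  shows "L2_tendsto lebesgue (\<lambda>n x. F n (- x)) (\<lambda>x. f (- x))"
  using assms(3) nrm2_reflect[OF L2_measurable[OF L2_diff[OF assms(1,2)]]]
  unfolding L2_tendsto_def by simp

text \<open>For truncations in the logarithmic variable the formula holds pointwise by Fubini. Both
  sides pass to the limit in mean, the left by the boundedness of \<open>laplace\<close>, the right
  by that of the gamma factor, and limits in mean are unique.\<close>

theorem mellin_laplace:
  assumes u: "u \<in> L2 lebesgue_pos"
  shows "AE x in lebesgue. mellin (laplace u) x = Gamma (1 / 2 - \<i> * of_real x) * mellin u (- x)"
proof -
  define F where "F n s = indicator {- real n..real n} (ln s) *\<^sub>R u s" for n s
  let ?\<Gamma> = "\<lambda>x. Gamma (1 / 2 - \<i> * complex_of_real x)"
  have F_pull: "log_pullback (F n) = trunc n (log_pullback u)" for n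
    by (auto simp: log_pullback_def F_def trunc_def fun_eq_iff)
  have ind: "(\<lambda>s. complex_of_real (indicator {- real n..real n} (ln s))) \<in> borel_measurable lebesgue_pos" for n
    by (rule lebesgue_pos_measurable_of_borel) measurable
  have F: "F n \<in> L2 lebesgue_pos" for n
    unfolding F_def[abs_def] scaleR_conv_of_real
    by (rule L2_bounded_mult(1)[OF ind _ u, of _ 1]) (auto simp: indicator_def)
  have pu: "log_pullback u \<in> L2 lebesgue" and plu: "log_pullback (laplace u) \<in> L2 lebesgue"
    and plF: "\<And>n. log_pullback (laplace (F n)) \<in> L2 lebesgue"
    by (intro log_pullback_L2 laplace_L2 u F)+
  have "L2_tendsto lebesgue (\<lambda>n. log_pullback (F n)) (log_pullback u)"
    unfolding F_pull by (rule trunc_tendsto[OF pu])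
  then have Fu: "L2_tendsto lebesgue_pos F u"
    unfolding L2_tendsto_def log_pullback_diff[symmetric] log_pullback_L2(3)[OF L2_diff[OF F u]] .
  have iF: "integrable lebesgue (log_pullback (F n))" for n
    unfolding F_pull by (rule trunc_L2(2)[OF pu])
  have ftF: "ft (log_pullback (F n)) \<in> L2 lebesgue" for n
    by (rule ft_isometry(2)[OF log_pullback_L2(1)[OF F] iF])
  have \<Gamma>m: "?\<Gamma> \<in> borel_measurable lebesgue"
    by (rule lebesgue_measurable_of_borel[OF Gamma_critical_line_measurable])
  have \<Gamma>b: "AE x in lebesgue. norm (?\<Gamma> x) \<le> sqrt pi"
    by (intro AE_I2 norm_Gamma_critical_line_le)
  have fu: "fourier (log_pullback u) \<in> L2 lebesgue" by (rule fourier_trunc_tendsto(1)[OF pu])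
  have "L2_tendsto lebesgue (\<lambda>n. ft (log_pullback (laplace (F n)))) (fourier (log_pullback (laplace u)))"
    by (rule ft_tendsto_fourier[OF plu plF ft_log_pullback_laplace(1)[OF F iF]])
       (intro L2_tendsto_log_pullback laplace_L2 L2_tendsto_laplace F u Fu)
  then have lim1: "L2_tendsto lebesgue (\<lambda>n x. ?\<Gamma> x * ft (log_pullback (F n)) (- x)) (fourier (log_pullback (laplace u)))"
    by (simp only: ft_log_pullback_laplace(2)[OF F iF, abs_def])
  have lim2: "L2_tendsto lebesgue (\<lambda>n x. ?\<Gamma> x * ft (log_pullback (F n)) (- x))
      (\<lambda>x. ?\<Gamma> x * fourier (log_pullback u) (- x))"
    by (rule L2_tendsto_bounded_mult[OF \<Gamma>m \<Gamma>b L2_reflect[OF ftF] L2_reflect[OF fu]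
          L2_tendsto_reflect[OF ftF fu]])
       (use fourier_trunc_tendsto(2)[OF pu] in \<open>simp add: F_pull\<close>)
  have "AE x in lebesgue. fourier (log_pullback (laplace u)) x = ?\<Gamma> x * fourier (log_pullback u) (- x)"
    by (rule L2_tendsto_unique[OF L2_measurable[OF L2_bounded_mult(1)[OF \<Gamma>m \<Gamma>b L2_reflect[OF ftF]]]
          fourier_measurable[OF plu] L2_measurable[OF L2_bounded_mult(1)[OF \<Gamma>m \<Gamma>b L2_reflect[OF fu]]]
          lim1 lim2])
  moreover have "AE x in lebesgue. mellin u (- x) = fourier (log_pullback u) (- x)"
    using mellin_eq_fourier(2)[OF u] AE_lebesgue_reflect[of "\<lambda>x. mellin u x = fourier (log_pullback u) x"] by blast
  ultimately show ?thesis
    using mellin_eq_fourier(2)[OF laplace_L2[OF u]] by eventually_elim simp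
qed

section \<open>The Hankel operator\<close>

text \<open>The reflection inside \<open>bmellin\<close> cancels the one in
  \<open>mellin_laplace\<close>, and the phase of the gamma value times its conjugate is its
  modulus.\<close>

lemma bmellin_laplace:
  assumes w: "w \<in> L2 lebesgue_pos"
  shows "AE x in lebesgue. bmellin (laplace w) x = of_real (norm (Gamma (1 / 2 - \<i> * complex_of_real x))) * mellin w x"
proof -
  have "AE x in lebesgue. mellin (laplace w) (- x) = Gamma (1 / 2 - \<i> * of_real (- x)) * mellin w (- (- x))"
    using mellin_laplace[OF w]
      AE_lebesgue_reflect[of "\<lambda>x. mellin (laplace w) x = Gamma (1 / 2 - \<i> * of_real x) * mellin w (- x)"]
    by blast
  then show ?thesis
  proof eventually_elim
    case (elim x)
    let ?G = "Gamma (1 / 2 - \<i> * complex_of_real x)"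
    have "Gamma (1 / 2 - \<i> * complex_of_real (- x)) = cnj ?G" by (simp add: cnj_Gamma)
    moreover have "?G / of_real (norm ?G) * cnj ?G = of_real (norm ?G)"
    proof -
      have "?G * cnj ?G = of_real ((norm ?G)\<^sup>2)" by (rule complex_norm_square[symmetric])
      then show ?thesis
        using Gamma_critical_line_nonzero[of x] by (simp add: power2_eq_square field_simps)
    qed
    ultimately show ?case
      using elim by (simp only: bmellin_def minus_minus mult.assoc[symmetric])
  qed
qed

text \<open>Here the gamma factor is split into modulus and phase; the phase is absorbed by
  \<open>bmellin\<close>.\<close>

lemma mellin_laplace_eq_bmellin:
  assumes u: "u \<in> L2 lebesgue_pos"
  shows "AE x in lebesgue. mellin (laplace u) x = of_real (norm (Gamma (1 / 2 - \<i> * complex_of_real x))) * bmellin u x"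
  using mellin_laplace[OF u]
proof eventually_elim
  case (elim x)
  then show ?case using Gamma_critical_line_nonzero[of x] by (simp add: bmellin_def)
qed

text \<open>With \<open>W\<close> the logarithmic pullback of \<open>w\<close>, a second Fourier
  transform of its Mellin transform gives \<open>W (- y)\<close>. There
  \<open>s y = \<sigma> (exp (- y))\<close> acts as \<open>\<sigma>\<close> acts on
  \<open>w\<close>, which explains the minus sign in \<open>s\<close>; injectivity of
  \<open>fourier\<close> removes the outer transform. The function \<open>g\<close> may be any
  representative of the Mellin transform.\<close>

lemma fourier_mult_mellin:
  assumes \<sigma>: "\<sigma> \<in> borel_measurable lebesgue_pos" "AE l in lebesgue_pos. norm (\<sigma> l) \<le> C"
    and s: "\<And>\<xi>. s \<xi> = \<sigma> (exp (- \<xi>))"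
    and w: "w \<in> L2 lebesgue_pos" and g: "g \<in> L2 lebesgue" "AE x in lebesgue. g x = mellin w x"
    and sm: "s \<in> borel_measurable lebesgue" "AE x in lebesgue. norm (s x) \<le> C"
  shows "AE x in lebesgue. fourier_mult s g x = mellin (\<lambda>l. \<sigma> l * w l) x"
proof -
  let ?W = "log_pullback w" and ?V = "log_pullback (\<lambda>l. \<sigma> l * w l)"
  have \<sigma>w: "(\<lambda>l. \<sigma> l * w l) \<in> L2 lebesgue_pos" by (rule L2_bounded_mult(1)[OF \<sigma> w])
  note W = log_pullback_L2(1)[OF w] and V = log_pullback_L2(1)[OF \<sigma>w]
  have "AE x in lebesgue. g x = fourier ?W x"
    using g(2) mellin_eq_fourier(2)[OF w] by eventually_elim simp
  then have "fourier g = fourier (fourier ?W)"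
    by (rule fourier_cong_AE[OF L2_measurable[OF g(1)] fourier_measurable[OF W]])
  then have "AE x in lebesgue. fourier (fourier_mult s g) x = s x * fourier (fourier ?W) x"
    using fourier_mult_spec(2)[OF sm g(1)] by simp
  then have "AE x in lebesgue. fourier (fourier_mult s g) x = fourier (fourier ?V) x"
    using fourier_fourier[OF W] fourier_fourier[OF V]
    by eventually_elim (simp add: s log_pullback_def mult_ac)
  then have "AE x in lebesgue. fourier_mult s g x = fourier ?V x"
    by (rule fourier_inj[OF fourier_mult_spec(1)[OF sm g(1)] fourier_trunc_tendsto(1)[OF V]])
  then show ?thesis
    using mellin_eq_fourier(2)[OF \<sigma>w] by eventually_elim simp
qed

theorem theorem2p3:
  fixes \<sigma> h s :: "real \<Rightarrow> complex" and v :: "real \<Rightarrow> real"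
  assumes "\<sigma> \<in> Linf lebesgue_pos"
    and "\<And>t. t > 0 \<Longrightarrow> h t = (LINT l|lebesgue_pos. of_real (exp (- t * l)) * \<sigma> l)"
    and "\<And>\<xi>. s \<xi> = \<sigma> (exp (- \<xi>))"
    and "\<And>x. v x = sqrt pi / sqrt (cosh (pi * x))"
  shows "L2_bounded_operator lebesgue lebesgue (fourier_mult s) \<and>
    L2_op_eq lebesgue_pos lebesgue_pos (hankel h)
      (bmellin_inv \<circ> mult_op (\<lambda>x. of_real (v x)) \<circ> fourier_mult s
        \<circ> mult_op (\<lambda>x. of_real (v x)) \<circ> bmellin)"
proof -
  obtain C where \<sigma>: "\<sigma> \<in> borel_measurable lebesgue_pos" "AE l in lebesgue_pos. norm (\<sigma> l) \<le> C"
    using assms(1) by (auto simp: Linf_def)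
  have h: "h t = laplace \<sigma> t" if "t > 0" for t using assms(2)[OF that] by (simp add: laplace_def)
  note s = assms(3)
  have v: "v x = norm (Gamma (1 / 2 - \<i> * complex_of_real x))" for x
    by (simp only: assms(4) norm_Gamma_critical_line)
  have sm: "s \<in> borel_measurable lebesgue" "AE x in lebesgue. norm (s x) \<le> C"
  proof -
    have "(\<lambda>y. \<sigma> (exp y)) \<in> borel_measurable lebesgue"
      by (rule measurable_compose[OF exp_measurable_lebesgue_pos \<sigma>(1)])
    from reflect_measurable[OF this] show "s \<in> borel_measurable lebesgue" by (simp add: s[abs_def])
    have "AE y in lebesgue. norm (\<sigma> (exp y)) \<le> C" by (rule AE_lebesgue_pos_exp[OF \<sigma>(2)])
    then show "AE x in lebesgue. norm (s x) \<le> C"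
      unfolding s by (rule AE_lebesgue_reflect[of "\<lambda>y. norm (\<sigma> (exp y)) \<le> C", THEN iffD2])
  qed
  have vm: "(\<lambda>x. complex_of_real (v x)) \<in> borel_measurable lebesgue"
  proof (rule lebesgue_measurable_of_borel)
    note [measurable] = Gamma_critical_line_measurable
    show "(\<lambda>x. complex_of_real (v x)) \<in> borel_measurable borel" unfolding v by measurable
  qed
  have vb: "AE x in lebesgue. norm (complex_of_real (v x)) \<le> sqrt pi"
    unfolding v by (intro AE_I2) (simp add: norm_Gamma_critical_line_le)
  have "hankel h u \<in> L2 lebesgue_pos
      \<and> bmellin_inv (\<lambda>x. of_real (v x) * fourier_mult s (\<lambda>x. of_real (v x) * bmellin u x) x) \<in> L2 lebesgue_pos
      \<and> (AE t in lebesgue_pos. hankel h u t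
          = bmellin_inv (\<lambda>x. of_real (v x) * fourier_mult s (\<lambda>x. of_real (v x) * bmellin u x) x) t)"
    if u: "u \<in> L2 lebesgue_pos" for u
  proof -
    define w where "w l = \<sigma> l * laplace u l" for l
    define g where "g x = of_real (v x) * bmellin u x" for x
    let ?r = "\<lambda>x. of_real (v x) * fourier_mult s g x"
    have w: "w \<in> L2 lebesgue_pos"
      unfolding w_def[abs_def] by (rule L2_bounded_mult(1)[OF \<sigma> laplace_L2[OF u]])
    have g: "g \<in> L2 lebesgue"
      unfolding g_def[abs_def] by (rule L2_bounded_mult(1)[OF vm vb bmellin_L2[OF u]])
    have eq: "hankel h u t = laplace w t" if "t > 0" for t
      unfolding w_def[abs_def] by (rule hankel_eq_laplace[OF \<sigma> h u that])
    \<comment> \<open>The space of \<open>lebesgue_pos\<close> consists of the positive reals, where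
      the two functions agree at every point; measurability therefore transfers as well.\<close>
    have H: "hankel h u \<in> L2 lebesgue_pos"
    proof -
      have "hankel h u \<in> borel_measurable lebesgue_pos \<longleftrightarrow> laplace w \<in> borel_measurable lebesgue_pos"
        by (rule measurable_cong) (simp add: eq)
      moreover have "nrm2 lebesgue_pos (hankel h u) = nrm2 lebesgue_pos (laplace w)"
        by (rule nrm2_cong_AE, rule AE_I2) (simp add: eq)
      ultimately show ?thesis using laplace_L2[OF w] by (simp add: L2_iff_nrm2)
    qed
    have "AE x in lebesgue. g x = mellin (laplace u) x"
      using mellin_laplace_eq_bmellin[OF u] by eventually_elim (simp add: g_def v)
    from fourier_mult_mellin[OF \<sigma> s laplace_L2[OF u] g this sm]
    have "AE x in lebesgue. fourier_mult s g x = mellin w x" by (simp add: w_def[abs_def])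
    with bmellin_laplace[OF w] have r: "AE x in lebesgue. bmellin (laplace w) x = ?r x"
      by eventually_elim (simp add: v)
    \<comment> \<open>The function \<open>laplace w\<close> is an explicit preimage of
      \<open>?r\<close>, so the choice in \<open>bmellin_inv\<close> succeeds; injectivity of
      \<open>bmellin\<close> then identifies the chosen preimage with it.\<close>
    then have "\<exists>f. f \<in> L2 lebesgue_pos \<and> (AE x in lebesgue. bmellin f x = ?r x)"
      using laplace_L2[OF w] by blast
    then have inv: "bmellin_inv ?r \<in> L2 lebesgue_pos \<and> (AE x in lebesgue. bmellin (bmellin_inv ?r) x = ?r x)"
      unfolding bmellin_inv_def L2_inv_def by (rule someI_ex)
    then have "AE x in lebesgue. bmellin (laplace w) x = bmellin (bmellin_inv ?r) x"
      using r by (auto elim: eventually_elim2)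
    then have "AE t in lebesgue_pos. laplace w t = bmellin_inv ?r t"
      using bmellin_inj[OF laplace_L2[OF w]] inv by blast
    moreover have "AE t in lebesgue_pos. hankel h u t = laplace w t"
      by (rule AE_I2) (simp add: eq)
    ultimately have "AE t in lebesgue_pos. hankel h u t = bmellin_inv ?r t"
      by eventually_elim simp
    with H inv show ?thesis by (simp add: g_def[abs_def])
  qed
  then have "L2_op_eq lebesgue_pos lebesgue_pos (hankel h)
      (bmellin_inv \<circ> mult_op (\<lambda>x. of_real (v x)) \<circ> fourier_mult s
        \<circ> mult_op (\<lambda>x. of_real (v x)) \<circ> bmellin)"
    unfolding L2_op_eq_def comp_def mult_op_def[abs_def] by blast
  with fourier_mult_bounded[OF sm] show ?thesis by blast
qed

end
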